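(* Let $X$ be a simply connected $E_\infty$-space, and consider the Serre spectral sequence (in mod $p$ homology) of the path--loop fibration $$\Omega X\longrightarrow PX\xrightarrow{\ \mathrm{ev}_1\ }X,$$ where $\mathrm{ev}_1$ is the evaluation map $\alpha\mapsto\alpha(1)$. Suppose that in this spectral sequence $x\in H_s(X)$ is a transgressive element with transgression $y\in H_{s-1}(\Omega X)$. Then for every $r\in\bigoplus_{k\ge0}H_*(\Sigma_k)$, the element $r\circ x\in H_*(X)$ is transgressive with transgression $r\circ y\in H_*(\Omega X)$.
   Context: Fix a prime $p$; $H_*$ denotes homology with $\mathbb{F}_p$-coefficients. Spaces are compactly generated weak Hausdorff. Operads are operads in spaces whose $0$-th space is a point. An $E_\infty$-operad is an operad $\mathcal{C}$ such that for all $n\ge0$ the space $\mathcal{C}(n)$ is contractible, the $\Sigma_n$-action on it is free, and $\mathcal{C}(n)$ is $\Sigma_n$-equivariantly homotopy equivalent to a $\Sigma_n$-CW complex. Fix an $E_\infty$-operad $\mathcal{C}$; an $E_\infty$-space is a $\mathcal{C}$-algebra $X$, with structure maps $\theta:\mathcal{C}(n)\times_{\Sigma_n}X^n\to X$. Its basepoint $x_0=1$ is the image of $\theta:\mathcal{C}(0)\times X^0\to X$. The path space $PX=\{\alpha\in X^I\mid\alpha(0)=x_0\}$ and the loop space $\Omega X=\Omega(X,x_0)\subset PX$ are $E_\infty$-spaces under the pointwise action of $\mathcal{C}$. For an $E_\infty$-space $Y$, the pairing $\circ:H_*(\Sigma_k)\otimes H_*(Y)\to H_*(Y)$ is the cross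 product into $H_*((\mathcal{C}(k)/\Sigma_k)\times Y)$ followed by the map induced by $([c],y)\mapsto\theta(c;y,\dots,y)$ ($\mathcal{C}(k)/\Sigma_k$ is a model for $B\Sigma_k$); it is extended linearly to $\bigoplus_{k\ge0}H_*(\Sigma_k)$. Elements are implicitly homogeneous. The transgression is defined in terms of the differentials from the bottom row (homology of the base $X$) to the left column (homology of the fiber $\Omega X$) of the spectral sequence; equivalently, it is the additive relation $\partial\,(\mathrm{ev}_1)_*^{-1}j_*$ from $H_*(X)$ to $H_{*-1}(\Omega X)$ given by $H_*(X)\xrightarrow{j_*}H_*(X,x_0)\xleftarrow{(\mathrm{ev}_1)_*}H_*(PX,\Omega X)\xrightarrow{\partial}H_{*-1}(\Omega X)$: $x$ is transgressive with transgression $y$ if there is $w\in H_*(PX,\Omega X)$ with $(\mathrm{ev}_1)_*w=j_*x$ and $\partial w=y$.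
   Formalization: The connecting map ∂ in the transgression is taken with the sign (-1)^n on degree-n relative classes; with the usual unsigned ∂ and standard cross product, r∘x transgresses to (-1)^{|r|} r∘y, so the sign-free claim would fail for odd p and odd |r|. *)

theory Defs
  imports
    "HOL-Homology.Homology"
    "HOL-Algebra.Product_Groups"
    "HOL-Combinatorics.Permutations"
    "HOL-Computational_Algebra.Primes"
begin

section \<open>Compactly generated weak Hausdorff spaces\<close>

text \<open>
  A space is weak Hausdorff if every continuous image of every compact Hausdorff space is
  closed. A definition cannot quantify over all types, so the test spaces live on the type
  \<open>'a set set\<close>; the lemma \<open>weakly_Hausdorff_space_image\<close> below shows that nothing is lost.
\<close>

definition weakly_Hausdorff_space :: "'a topology \<Rightarrow> bool" where
  "weakly_Hausdorff_space X \<longleftrightarrow>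
     (\<forall>(K :: 'a set set topology) u.
        compact_space K \<and> Hausdorff_space K \<and> continuous_map K X u
          \<longrightarrow> closedin X (u ` topspace K))"

text \<open>
  In a weak Hausdorff space the image of a map from a compact Hausdorff space is a compact
  Hausdorff subspace, so there it suffices to test closedness on such subspaces. The library's
  \<open>k_space\<close> tests on all quasi-compact subspaces instead.
\<close>

definition compactly_closed :: "'a topology \<Rightarrow> 'a set \<Rightarrow> bool" where
  "compactly_closed X A \<longleftrightarrow> A \<subseteq> topspace X \<and>
     (\<forall>K. compactin X K \<and> Hausdorff_space (subtopology X K)
        \<longrightarrow> closedin (subtopology X K) (K \<inter> A))"

definition cgwh_space :: "'a topology \<Rightarrow> bool" where
  "cgwh_space X \<longleftrightarrow>
     weakly_Hausdorff_space X \<and> (\<forall>A. compactly_closed X A \<longrightarrow> closedin X A)"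

definition kification :: "'a topology \<Rightarrow> 'a topology" where
  "kification X = topology (\<lambda>U. U \<subseteq> topspace X \<and> compactly_closed X (topspace X - U))"

abbreviation k_prod :: "'a topology \<Rightarrow> 'b topology \<Rightarrow> ('a \<times> 'b) topology" where
  "k_prod X Y \<equiv> kification (prod_topology X Y)"

lemma weakly_Hausdorff_space_image:
  fixes X :: "'a topology" and K :: "'b topology"
  assumes X: "weakly_Hausdorff_space X"
    and K: "compact_space K" "Hausdorff_space K" and u: "continuous_map K X u"
  shows "closedin X (u ` topspace K)"
proof -
  obtain D where D: "D \<subseteq> topspace K" "inj_on u D" "u ` D = u ` topspace K"
    by (metis subset_image_inj subset_refl)
  define L where "L = K closure_of D"
  have LK: "L \<subseteq> topspace K"
    by (simp add: L_def closure_of_subset_topspace)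
  have DL: "D \<subseteq> L"
    by (simp add: D L_def closure_of_subset)
  define f :: "'b \<Rightarrow> 'a set set" where "f x = {u ` (U \<inter> D) |U. openin K U \<and> x \<in> U}" for x
  have sep: "u ` (U \<inter> D) \<noteq> u ` (W \<inter> D)"
    if "openin K U" "openin K V" "openin K W" "U \<inter> V = {}" "y \<in> V" "y \<in> W" "y \<in> L" for U V W y
  proof
    assume "u ` (U \<inter> D) = u ` (W \<inter> D)"
    then have "U \<inter> D = W \<inter> D"
      by (meson D(2) inf_le2 inj_on_image_eq_iff)
    moreover have "\<exists>z. z \<in> D \<and> z \<in> V \<inter> W"
      using that unfolding L_def in_closure_of by (meson IntI openin_Int)
    ultimately show False
      using that(4) by blast
  qed
  have "inj_on f L"
  proof (rule inj_onI, rule ccontr)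
    fix x y assume xy: "x \<in> L" "y \<in> L" "f x = f y" "x \<noteq> y"
    then obtain U V where UV: "openin K U" "openin K V" "x \<in> U" "y \<in> V" "U \<inter> V = {}"
      using K(2) LK unfolding Hausdorff_space_def disjnt_def by (metis subsetD)
    then have "u ` (U \<inter> D) \<in> f y"
      using xy(3) unfolding f_def by blast
    then obtain W where "openin K W" "y \<in> W" "u ` (U \<inter> D) = u ` (W \<inter> D)"
      unfolding f_def by blast
    with sep UV xy show False
      by metis
  qed
  define g where "g = inv_into L f"
  have gf: "g (f x) = x" if "x \<in> L" for x
    using that \<open>inj_on f L\<close> by (simp add: g_def)
  define M where "M = pullback_topology (f ` L) g (subtopology K L)"
  have topM: "topspace M = f ` L"
    using LK gf by (auto simp: M_def topspace_pullback_topology)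
  have gM: "continuous_map M (subtopology K L) g"
    unfolding M_def using continuous_map_pullback [OF continuous_map_id] by fastforce
  have fM: "continuous_map (subtopology K L) M f"
    unfolding M_def
  proof (rule continuous_map_pullback')
    show "continuous_map (subtopology K L) (subtopology K L) (g \<circ> f)"
      by (rule continuous_map_eq [OF continuous_map_id]) (use gf in auto)
    show "topspace (subtopology K L) \<subseteq> f -` f ` L"
      by auto
  qed
  have "homeomorphic_maps (subtopology K L) M f g"
    using gM fM gf topM by (auto simp: homeomorphic_maps_def)
  then have hom: "subtopology K L homeomorphic_space M"
    using homeomorphic_space_def by blast
  have "compact_space (subtopology K L)"
    by (metis K(1) L_def closedin_closure_of closedin_compact_space compact_space_subtopology)
  then have "compact_space M"
    using hom homeomorphic_compact_space by blast
  moreover have "Hausdorff_space M"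
    using hom K(2) Hausdorff_space_subtopology homeomorphic_Hausdorff_space by blast
  moreover have "continuous_map M X (u \<circ> g)"
    using gM u continuous_map_compose continuous_map_from_subtopology by blast
  ultimately have "closedin X ((u \<circ> g) ` topspace M)"
    using X unfolding weakly_Hausdorff_space_def by blast
  moreover have "(u \<circ> g) ` topspace M = u ` L"
    using gf by (force simp: topM image_iff)
  moreover have "u ` L = u ` topspace K"
    using D(3) DL LK by blast
  ultimately show ?thesis
    by simp
qed

lemma openin_kification:
  "openin (kification X) U \<longleftrightarrow> U \<subseteq> topspace X \<and> compactly_closed X (topspace X - U)"
proof -
  have *: "K \<inter> (topspace X - U) = K - U" if "compactin X K" for K U
    using that compactin_subset_topspace by fastforce
  have eq: "U \<subseteq> topspace X \<and> compactly_closed X (topspace X - U) \<longleftrightarrow>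
      U \<subseteq> topspace X \<and> (\<forall>K. compactin X K \<and> Hausdorff_space (subtopology X K)
        \<longrightarrow> openin (subtopology X K) (K \<inter> U))" for U
    unfolding compactly_closed_def openin_closedin_eq
    by (auto simp: * compactin_subset_topspace Int_absorb1 Diff_Int)
  have "istopology (\<lambda>U. U \<subseteq> topspace X \<and> compactly_closed X (topspace X - U))"
    unfolding eq istopology_def
  proof (intro conjI allI impI)
    fix S T K
    assume S: "S \<subseteq> topspace X \<and> (\<forall>K. compactin X K \<and> Hausdorff_space (subtopology X K)
        \<longrightarrow> openin (subtopology X K) (K \<inter> S))"
      and T: "T \<subseteq> topspace X \<and> (\<forall>K. compactin X K \<and> Hausdorff_space (subtopology X K)
        \<longrightarrow> openin (subtopology X K) (K \<inter> T))"
      and K: "compactin X K \<and> Hausdorff_space (subtopology X K)"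
    have "openin (subtopology X K) ((K \<inter> S) \<inter> (K \<inter> T))"
      using S T K by blast
    then show "openin (subtopology X K) (K \<inter> (S \<inter> T))"
      by (rule back_subst[of "openin (subtopology X K)"]) auto
  next
    fix \<K> K
    assume U: "\<forall>S\<in>\<K>. S \<subseteq> topspace X \<and> (\<forall>K. compactin X K \<and> Hausdorff_space (subtopology X K)
        \<longrightarrow> openin (subtopology X K) (K \<inter> S))"
      and K: "compactin X K \<and> Hausdorff_space (subtopology X K)"
    have "openin (subtopology X K) (\<Union>S\<in>\<K>. K \<inter> S)"
      using U K by blast
    then show "openin (subtopology X K) (K \<inter> \<Union>\<K>)"
      by (rule back_subst[of "openin (subtopology X K)"]) auto
  qed auto
  then show ?thesis
    by (simp add: kification_def)
qed

definition simply_connected_space :: "'a topology \<Rightarrow> bool" where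
  "simply_connected_space X \<longleftrightarrow> topspace X \<noteq> {} \<and> path_connected_space X \<and>
     (\<forall>l. pathin X l \<and> l 0 = l 1 \<longrightarrow>
        homotopic_with (\<lambda>h. h 0 = l 0 \<and> h 1 = l 0) (top_of_set {0..1}) X l (\<lambda>_. l 0))"

section \<open>Actions, orbit spaces and equivariant CW complexes\<close>

abbreviation Sym :: "nat \<Rightarrow> (nat \<Rightarrow> nat) set" where
  "Sym n \<equiv> {\<sigma>. \<sigma> permutes {..<n}}"

definition right_action :: "nat \<Rightarrow> 'a topology \<Rightarrow> ('a \<Rightarrow> (nat \<Rightarrow> nat) \<Rightarrow> 'a) \<Rightarrow> bool" where
  "right_action n X act \<longleftrightarrow>
     (\<forall>\<sigma>\<in>Sym n. continuous_map X X (\<lambda>x. act x \<sigma>)) \<and>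
     (\<forall>x\<in>topspace X. act x id = x \<and>
        (\<forall>\<sigma>\<in>Sym n. \<forall>\<tau>\<in>Sym n. act (act x \<sigma>) \<tau> = act x (\<sigma> \<circ> \<tau>)))"

definition free_action :: "nat \<Rightarrow> 'a topology \<Rightarrow> ('a \<Rightarrow> (nat \<Rightarrow> nat) \<Rightarrow> 'a) \<Rightarrow> bool" where
  "free_action n X act \<longleftrightarrow>
     (\<forall>x\<in>topspace X. \<forall>\<sigma>\<in>Sym n. act x \<sigma> = x \<longrightarrow> \<sigma> = id)"

definition orbit_of :: "nat \<Rightarrow> ('a \<Rightarrow> (nat \<Rightarrow> nat) \<Rightarrow> 'a) \<Rightarrow> 'a \<Rightarrow> 'a set" where
  "orbit_of n act x = act x ` Sym n"

definition orbit_space :: "nat \<Rightarrow> 'a topology \<Rightarrow> ('a \<Rightarrow> (nat \<Rightarrow> nat) \<Rightarrow> 'a) \<Rightarrow> 'a set topology" where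
  "orbit_space n X act =
     topology (\<lambda>U. U \<subseteq> orbit_of n act ` topspace X \<and>
                   openin X {x \<in> topspace X. orbit_of n act x \<in> U})"

lemma openin_orbit_space:
  "openin (orbit_space n X act) U \<longleftrightarrow>
     U \<subseteq> orbit_of n act ` topspace X \<and> openin X {x \<in> topspace X. orbit_of n act x \<in> U}"
proof -
  have "istopology (\<lambda>U. U \<subseteq> orbit_of n act ` topspace X \<and>
                       openin X {x \<in> topspace X. orbit_of n act x \<in> U})"
    unfolding istopology_def
  proof (intro conjI allI impI)
    fix S T
    assume S: "S \<subseteq> orbit_of n act ` topspace X \<and> openin X {x \<in> topspace X. orbit_of n act x \<in> S}"
      and T: "T \<subseteq> orbit_of n act ` topspace X \<and> openin X {x \<in> topspace X. orbit_of n act x \<in> T}"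
    have "openin X ({x \<in> topspace X. orbit_of n act x \<in> S} \<inter>
                         {x \<in> topspace X. orbit_of n act x \<in> T})"
      using S T by blast
    then show "openin X {x \<in> topspace X. orbit_of n act x \<in> S \<inter> T}"
      by (rule back_subst[of "openin X"]) auto
  next
    fix \<K>
    assume "\<forall>S\<in>\<K>. S \<subseteq> orbit_of n act ` topspace X \<and>
                openin X {x \<in> topspace X. orbit_of n act x \<in> S}"
    then have "openin X (\<Union>S\<in>\<K>. {x \<in> topspace X. orbit_of n act x \<in> S})"
      by blast
    then show "openin X {x \<in> topspace X. orbit_of n act x \<in> \<Union>\<K>}"
      by (rule back_subst[of "openin X"]) auto
  qed auto
  then show ?thesis
    by (simp add: orbit_space_def)
qed

definition disc :: "nat \<Rightarrow> (nat \<Rightarrow> real) topology" where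
  "disc d = subtopology (Euclidean_space d) {x. (\<Sum>i<d. x i ^ 2) \<le> 1}"

definition disc_interior :: "nat \<Rightarrow> (nat \<Rightarrow> real) set" where
  "disc_interior d = {x \<in> topspace (disc d). (\<Sum>i<d. x i ^ 2) < 1}"

text \<open>
  The set \<open>E d\<close> contains one characteristic map \<open>\<phi>\<close> for each equivariant cell of dimension \<open>d\<close>.
  If \<open>H\<close> is the subgroup fixing the image of \<open>\<phi>\<close> pointwise, the equivariant cell is the map
  \<open>(H\<sigma>, x) \<mapsto> act (\<phi> x) \<sigma>\<close> from the product of the right cosets of \<open>H\<close> with \<open>disc d\<close>.
\<close>

definition skeleton_below ::
    "nat \<Rightarrow> ('z \<Rightarrow> (nat \<Rightarrow> nat) \<Rightarrow> 'z) \<Rightarrow> (nat \<Rightarrow> ((nat \<Rightarrow> real) \<Rightarrow> 'z) set) \<Rightarrow> nat \<Rightarrow> 'z set" where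
  "skeleton_below n act E N =
     {act (\<phi> x) \<sigma> |d \<phi> x \<sigma>. d < N \<and> \<phi> \<in> E d \<and> x \<in> topspace (disc d) \<and> \<sigma> \<in> Sym n}"

text \<open>
  The last two conditions say that each skeleton carries the topology of the pushout attaching
  its top-dimensional cells, and that the whole space is the colimit of its skeleta. The
  condition before them says that the open equivariant cells are embedded and disjoint.
\<close>

definition equivariant_cell_structure ::
    "nat \<Rightarrow> 'z topology \<Rightarrow> ('z \<Rightarrow> (nat \<Rightarrow> nat) \<Rightarrow> 'z) \<Rightarrow>
     (nat \<Rightarrow> ((nat \<Rightarrow> real) \<Rightarrow> 'z) set) \<Rightarrow> bool" where
  "equivariant_cell_structure n Z act E \<longleftrightarrow>
     topspace Z = (\<Union>N. skeleton_below n act E N) \<and>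
     (\<forall>d. \<forall>\<phi>\<in>E d. continuous_map (disc d) Z \<phi> \<and>
        \<phi> ` (topspace (disc d) - disc_interior d) \<subseteq> skeleton_below n act E d) \<and>
     (\<forall>d e. \<forall>\<phi>\<in>E d. \<forall>\<psi>\<in>E e. \<forall>x\<in>disc_interior d. \<forall>y\<in>disc_interior e. \<forall>\<sigma>\<in>Sym n. \<forall>\<tau>\<in>Sym n.
        act (\<phi> x) \<sigma> = act (\<psi> y) \<tau> \<longrightarrow>
          d = e \<and> \<phi> = \<psi> \<and> x = y \<and> (\<forall>z\<in>topspace (disc d). act (\<phi> z) \<sigma> = act (\<phi> z) \<tau>)) \<and>
     (\<forall>N. \<forall>A \<subseteq> skeleton_below n act E N.
        (\<forall>d<N. \<forall>\<phi>\<in>E d. \<forall>\<sigma>\<in>Sym n. closedin (disc d) {x \<in> topspace (disc d). act (\<phi> x) \<sigma> \<in> A})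
          \<longrightarrow> closedin Z A) \<and>
     (\<forall>A \<subseteq> topspace Z. (\<forall>N. closedin Z (A \<inter> skeleton_below n act E N)) \<longrightarrow> closedin Z A)"

definition equivariant_CW_complex ::
    "nat \<Rightarrow> 'z topology \<Rightarrow> ('z \<Rightarrow> (nat \<Rightarrow> nat) \<Rightarrow> 'z) \<Rightarrow> bool" where
  "equivariant_CW_complex n Z act \<longleftrightarrow>
     right_action n Z act \<and> (\<exists>E. equivariant_cell_structure n Z act E)"

definition equivariant ::
    "nat \<Rightarrow> 'a topology \<Rightarrow> ('a \<Rightarrow> (nat \<Rightarrow> nat) \<Rightarrow> 'a) \<Rightarrow> ('b \<Rightarrow> (nat \<Rightarrow> nat) \<Rightarrow> 'b) \<Rightarrow>
     ('a \<Rightarrow> 'b) \<Rightarrow> bool" where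
  "equivariant n X act act' f \<longleftrightarrow>
     (\<forall>x\<in>topspace X. \<forall>\<sigma>\<in>Sym n. f (act x \<sigma>) = act' (f x) \<sigma>)"

definition equivariantly_homotopy_equivalent ::
    "nat \<Rightarrow> 'a topology \<Rightarrow> ('a \<Rightarrow> (nat \<Rightarrow> nat) \<Rightarrow> 'a) \<Rightarrow>
     'b topology \<Rightarrow> ('b \<Rightarrow> (nat \<Rightarrow> nat) \<Rightarrow> 'b) \<Rightarrow> bool" where
  "equivariantly_homotopy_equivalent n X actX Y actY \<longleftrightarrow>
     (\<exists>f g. continuous_map X Y f \<and> equivariant n X actX actY f \<and>
            continuous_map Y X g \<and> equivariant n Y actY actX g \<and>
            homotopic_with (equivariant n X actX actX) X X (g \<circ> f) id \<and>
            homotopic_with (equivariant n Y actY actY) Y Y (f \<circ> g) id)"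

section \<open>Operads and their algebras\<close>

text \<open>
  An \<open>n\<close>-tuple is a function that is extensional on \<open>{..<n}\<close>. For a list \<open>js = [j\<^sub>0, \<dots>, j\<^sub>k\<^sub>-\<^sub>1]\<close>,
  \<open>op_comp C js\<close> is the structure map
  \<open>C(k) \<times> C(j\<^sub>0) \<times> \<dots> \<times> C(j\<^sub>k\<^sub>-\<^sub>1) \<rightarrow> C(j\<^sub>0 + \<dots> + j\<^sub>k\<^sub>-\<^sub>1)\<close>.
\<close>

record 'c operad =
  op_space :: "nat \<Rightarrow> 'c topology"
  op_act :: "nat \<Rightarrow> 'c \<Rightarrow> (nat \<Rightarrow> nat) \<Rightarrow> 'c"
  op_unit :: "'c"
  op_comp :: "nat list \<Rightarrow> 'c \<Rightarrow> (nat \<Rightarrow> 'c) \<Rightarrow> 'c"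

abbreviation offset :: "nat list \<Rightarrow> nat \<Rightarrow> nat" where
  "offset js s \<equiv> sum_list (take s js)"

definition block_index :: "nat list \<Rightarrow> nat \<Rightarrow> nat" where
  "block_index js i = (LEAST s. i < offset js (Suc s))"

definition tuple_block :: "nat list \<Rightarrow> nat \<Rightarrow> (nat \<Rightarrow> 'a) \<Rightarrow> nat \<Rightarrow> 'a" where
  "tuple_block js s e = (\<lambda>i\<in>{..<js ! s}. e (offset js s + i))"

definition list_block :: "nat list \<Rightarrow> nat \<Rightarrow> 'a list \<Rightarrow> 'a list" where
  "list_block js s ls = take (js ! s) (drop (offset js s) ls)"

definition permute_tuple :: "nat \<Rightarrow> (nat \<Rightarrow> nat) \<Rightarrow> (nat \<Rightarrow> 'a) \<Rightarrow> nat \<Rightarrow> 'a" where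
  "permute_tuple n \<sigma> e = (\<lambda>s\<in>{..<n}. e (inv_into UNIV \<sigma> s))"

text \<open>The permutation that moves the \<open>s\<close>-th of the consecutive blocks of lengths \<open>js\<close> to place
  \<open>\<sigma> s\<close>, keeping the order within each block.\<close>

definition block_perm :: "(nat \<Rightarrow> nat) \<Rightarrow> nat list \<Rightarrow> nat \<Rightarrow> nat" where
  "block_perm \<sigma> js i =
     (if i < sum_list js
      then let s = block_index js i in offset (permute_list (inv_into UNIV \<sigma>) js) (\<sigma> s) + (i - offset js s)
      else i)"

definition sum_perm :: "nat list \<Rightarrow> (nat \<Rightarrow> nat \<Rightarrow> nat) \<Rightarrow> nat \<Rightarrow> nat" where
  "sum_perm js \<tau> i =
     (if i < sum_list js
      then let s = block_index js i in offset js s + \<tau> s (i - offset js s)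
      else i)"

definition operad :: "'c operad \<Rightarrow> bool" where
  "operad C \<longleftrightarrow>
     (\<forall>n. cgwh_space (op_space C n) \<and> right_action n (op_space C n) (op_act C n)) \<and>
     (\<exists>a. topspace (op_space C 0) = {a}) \<and>
     op_unit C \<in> topspace (op_space C 1) \<and>
     (\<forall>js. continuous_map
        (k_prod (op_space C (length js)) (product_topology (\<lambda>s. op_space C (js ! s)) {..<length js}))
        (op_space C (sum_list js)) (\<lambda>(c, d). op_comp C js c d)) \<and>
     (\<forall>n. \<forall>c\<in>topspace (op_space C n).
        op_comp C [n] (op_unit C) (\<lambda>i\<in>{..<1}. c) = c \<and>
        op_comp C (replicate n 1) c (\<lambda>i\<in>{..<n}. op_unit C) = c) \<and>
     (\<forall>js ls. length ls = sum_list js \<longrightarrow>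
        (\<forall>c\<in>topspace (op_space C (length js)).
         \<forall>d\<in>(\<Pi>\<^sub>E s\<in>{..<length js}. topspace (op_space C (js ! s))).
         \<forall>e\<in>(\<Pi>\<^sub>E i\<in>{..<length ls}. topspace (op_space C (ls ! i))).
           op_comp C ls (op_comp C js c d) e =
           op_comp C (map (\<lambda>s. sum_list (list_block js s ls)) [0..<length js]) c
             (\<lambda>s\<in>{..<length js}. op_comp C (list_block js s ls) (d s) (tuple_block js s e)))) \<and>
     (\<forall>js. \<forall>c\<in>topspace (op_space C (length js)).
        \<forall>d\<in>(\<Pi>\<^sub>E s\<in>{..<length js}. topspace (op_space C (js ! s))).
          (\<forall>\<sigma>\<in>Sym (length js).
             op_comp C js (op_act C (length js) c \<sigma>) d =
             op_act C (sum_list js)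
               (op_comp C (permute_list (inv_into UNIV \<sigma>) js) c (permute_tuple (length js) \<sigma> d))
               (block_perm \<sigma> js)) \<and>
          (\<forall>\<tau>. (\<forall>s<length js. \<tau> s \<in> Sym (js ! s)) \<longrightarrow>
             op_comp C js c (\<lambda>s\<in>{..<length js}. op_act C (js ! s) (d s) (\<tau> s)) =
             op_act C (sum_list js) (op_comp C js c d) (sum_perm js \<tau>)))"

text \<open>
  The type argument is the type that carries the equivariant CW models; in a theorem it is an
  otherwise unconstrained type variable, so that the models may live anywhere. The conjunct
  \<open>topspace _ \<noteq> {}\<close> is there because the library counts the empty space as contractible.
\<close>

definition E_infinity_operad :: "'z itself \<Rightarrow> 'c operad \<Rightarrow> bool" where
  "E_infinity_operad T C \<longleftrightarrow> operad C \<and>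
     (\<forall>n. topspace (op_space C n) \<noteq> {} \<and> contractible_space (op_space C n) \<and>
          free_action n (op_space C n) (op_act C n) \<and>
          (\<exists>(Z :: 'z topology) act. equivariant_CW_complex n Z act \<and>
             equivariantly_homotopy_equivalent n (op_space C n) (op_act C n) Z act))"

definition operad_algebra ::
    "'c operad \<Rightarrow> 'a topology \<Rightarrow> (nat \<Rightarrow> 'c \<Rightarrow> (nat \<Rightarrow> 'a) \<Rightarrow> 'a) \<Rightarrow> bool" where
  "operad_algebra C X \<theta> \<longleftrightarrow> cgwh_space X \<and>
     (\<forall>n. continuous_map (k_prod (op_space C n) (product_topology (\<lambda>_. X) {..<n})) X
        (\<lambda>(c, x). \<theta> n c x)) \<and>
     (\<forall>x\<in>topspace X. \<theta> 1 (op_unit C) (\<lambda>i\<in>{..<1}. x) = x) \<and>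
     (\<forall>js. \<forall>c\<in>topspace (op_space C (length js)).
        \<forall>d\<in>(\<Pi>\<^sub>E s\<in>{..<length js}. topspace (op_space C (js ! s))).
        \<forall>x\<in>({..<sum_list js} \<rightarrow>\<^sub>E topspace X).
          \<theta> (sum_list js) (op_comp C js c d) x =
          \<theta> (length js) c (\<lambda>s\<in>{..<length js}. \<theta> (js ! s) (d s) (tuple_block js s x))) \<and>
     (\<forall>n. \<forall>c\<in>topspace (op_space C n). \<forall>\<sigma>\<in>Sym n. \<forall>x\<in>({..<n} \<rightarrow>\<^sub>E topspace X).
        \<theta> n (op_act C n c \<sigma>) x = \<theta> n c (permute_tuple n \<sigma> x))"

definition algebra_point :: "'c operad \<Rightarrow> (nat \<Rightarrow> 'c \<Rightarrow> (nat \<Rightarrow> 'a) \<Rightarrow> 'a) \<Rightarrow> 'a" where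
  "algebra_point C \<theta> = \<theta> 0 (the_elem (topspace (op_space C 0))) (\<lambda>_. undefined)"

section \<open>Path and loop spaces\<close>

definition compact_open_paths :: "'a topology \<Rightarrow> (real \<Rightarrow> 'a) topology" where
  "compact_open_paths X =
     topology_generated_by
       {{\<alpha>. pathin X \<alpha> \<and> \<alpha> \<in> extensional {0..1} \<and> \<alpha> ` K \<subseteq> U} |K U.
          compact K \<and> K \<subseteq> {0..1} \<and> openin X U}"

definition path_space :: "'a topology \<Rightarrow> 'a \<Rightarrow> (real \<Rightarrow> 'a) topology" where
  "path_space X x\<^sub>0 = subtopology (kification (compact_open_paths X)) {\<alpha>. \<alpha> 0 = x\<^sub>0}"

definition loops :: "'a topology \<Rightarrow> 'a \<Rightarrow> (real \<Rightarrow> 'a) set" where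
  "loops X x\<^sub>0 = {\<alpha> \<in> topspace (path_space X x\<^sub>0). \<alpha> 1 = x\<^sub>0}"

definition loop_space :: "'a topology \<Rightarrow> 'a \<Rightarrow> (real \<Rightarrow> 'a) topology" where
  "loop_space X x\<^sub>0 = subtopology (path_space X x\<^sub>0) (loops X x\<^sub>0)"

definition pointwise_action ::
    "(nat \<Rightarrow> 'c \<Rightarrow> (nat \<Rightarrow> 'a) \<Rightarrow> 'a) \<Rightarrow>
     nat \<Rightarrow> 'c \<Rightarrow> (nat \<Rightarrow> real \<Rightarrow> 'a) \<Rightarrow> real \<Rightarrow> 'a" where
  "pointwise_action \<theta> n c \<alpha> = (\<lambda>t\<in>{0..1}. \<theta> n c (\<lambda>i\<in>{..<n}. \<alpha> i t))"

section \<open>Singular homology with coefficients in the field of order \<open>p\<close>\<close>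

text \<open>
  Chains modulo \<open>p\<close> are represented by integral singular chains, two of which are identified
  when they differ by \<open>p\<close> times a chain; that is, this is the homology of
  \<open>(S(X) / S(A)) \<otimes> Z/p\<close>. As in the library's integral homology, degrees are integers;
  the chain groups vanish in negative degrees.
\<close>

definition graded_chain :: "int \<Rightarrow> 'a topology \<Rightarrow> 'a chain \<Rightarrow> bool" where
  "graded_chain n X c \<longleftrightarrow> (if n < 0 then c = 0 else singular_chain (nat n) X c)"

definition mod_relcycle :: "nat \<Rightarrow> int \<Rightarrow> 'a topology \<Rightarrow> 'a set \<Rightarrow> 'a chain \<Rightarrow> bool" where
  "mod_relcycle p n X A c \<longleftrightarrow> graded_chain n X c \<and>
     (\<exists>a d. graded_chain (n - 1) (subtopology X A) a \<and> graded_chain (n - 1) X d \<and>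
        chain_boundary (nat n) c = a + frag_cmul (int p) d)"

definition mod_relboundary :: "nat \<Rightarrow> int \<Rightarrow> 'a topology \<Rightarrow> 'a set \<Rightarrow> 'a chain \<Rightarrow> bool" where
  "mod_relboundary p n X A c \<longleftrightarrow>
     (\<exists>b a d. graded_chain (n + 1) X b \<and> graded_chain n (subtopology X A) a \<and> graded_chain n X d \<and>
        c = chain_boundary (nat (n + 1)) b + a + frag_cmul (int p) d)"

definition rel_homology_mod :: "nat \<Rightarrow> int \<Rightarrow> 'a topology \<Rightarrow> 'a set \<Rightarrow> 'a chain set monoid" where
  "rel_homology_mod p n X A =
     (chain_group (nat n) X)\<lparr>carrier := Collect (mod_relcycle p n X A)\<rparr>
       Mod Collect (mod_relboundary p n X A)"

abbreviation homology_mod :: "nat \<Rightarrow> int \<Rightarrow> 'a topology \<Rightarrow> 'a chain set monoid" where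
  "homology_mod p n X \<equiv> rel_homology_mod p n X {}"

definition homology_class :: "nat \<Rightarrow> int \<Rightarrow> 'a topology \<Rightarrow> 'a set \<Rightarrow> 'a chain \<Rightarrow> 'a chain set" where
  "homology_class p n X A c = {c'. mod_relboundary p n X A (c' - c)}"

text \<open>
  The following maps on homology are given by formulas on representing chains; \<open>the_elem\<close>
  picks the resulting class, which does not depend on the representatives.
\<close>

definition induced ::
    "nat \<Rightarrow> int \<Rightarrow> 'b topology \<Rightarrow> 'b set \<Rightarrow> ('a \<Rightarrow> 'b) \<Rightarrow> 'a chain set \<Rightarrow> 'b chain set" where
  "induced p n Y B f w = the_elem {homology_class p n Y B (chain_map (nat n) f c) |c. c \<in> w}"

text \<open>
  Sign convention: the connecting homomorphism on degree \<open>n\<close> classes is \<open>(-1)\<^sup>n\<close> times the class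
  of the boundary of a relative cycle, i.e. the differential acts from the right. With the cross
  product below, whose boundary formula is \<open>\<partial>(a \<times> b) = \<partial>a \<times> b + (-1)\<^sup>m a \<times> \<partial>b\<close> for \<open>a\<close> of degree
  \<open>m\<close>, this is the convention under which the connecting homomorphism commutes with
  \<open>a \<times> _\<close> without a sign.
\<close>

definition connecting :: "nat \<Rightarrow> int \<Rightarrow> 'a topology \<Rightarrow> 'a set \<Rightarrow> 'a chain set \<Rightarrow> 'a chain set" where
  "connecting p n X A w =
     the_elem {homology_class p (n - 1) (subtopology X A) {} (frag_cmul ((-1) ^ nat n) a) |a c d.
       c \<in> w \<and> graded_chain (n - 1) (subtopology X A) a \<and> graded_chain (n - 1) X d \<and>
       chain_boundary (nat n) c = a + frag_cmul (int p) d}"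

text \<open>
  Cross product by the Eilenberg--Zilber shuffle map. An \<open>(m,n)\<close>-shuffle is a monotone lattice
  path with \<open>m + n\<close> steps, given by the set \<open>\<mu>\<close> of its steps in the first direction. The simplex
  of \<open>\<Delta>\<^sup>m \<times> \<Delta>\<^sup>n\<close> belonging to it sends its \<open>i\<close>-th vertex to the pair of vertices whose
  indices are the numbers of steps before time \<open>i\<close> in the two directions. The sign counts the
  pairs of a second-direction step preceding a first-direction step.
\<close>

definition shuffles_of :: "nat \<Rightarrow> nat \<Rightarrow> nat set set" where
  "shuffles_of m n = {\<mu>. \<mu> \<subseteq> {..<m + n} \<and> card \<mu> = m}"

definition shuffle_sign :: "nat \<Rightarrow> nat set \<Rightarrow> int" where
  "shuffle_sign N \<mu> = (-1) ^ card {(i, j). i \<in> \<mu> \<and> j \<in> {..<N} - \<mu> \<and> j < i}"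

definition shuffle_projection :: "nat \<Rightarrow> nat set \<Rightarrow> (nat \<Rightarrow> real) \<Rightarrow> nat \<Rightarrow> real" where
  "shuffle_projection N \<mu> t = (\<lambda>j. \<Sum>i | i \<le> N \<and> card (\<mu> \<inter> {..<i}) = j. t i)"

definition shuffle_simplex ::
    "nat \<Rightarrow> nat set \<Rightarrow> ((nat \<Rightarrow> real) \<Rightarrow> 'a) \<Rightarrow> ((nat \<Rightarrow> real) \<Rightarrow> 'b) \<Rightarrow>
     (nat \<Rightarrow> real) \<Rightarrow> 'a \<times> 'b" where
  "shuffle_simplex N \<mu> f g =
     (\<lambda>t\<in>standard_simplex N.
        (f (shuffle_projection N \<mu> t), g (shuffle_projection N ({..<N} - \<mu>) t)))"

definition cross_chain :: "nat \<Rightarrow> nat \<Rightarrow> 'a chain \<Rightarrow> 'b chain \<Rightarrow> ('a \<times> 'b) chain" where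
  "cross_chain m n a b =
     frag_extend (\<lambda>f. frag_extend (\<lambda>g.
       \<Sum>\<mu>\<in>shuffles_of m n.
         frag_cmul (shuffle_sign (m + n) \<mu>) (frag_of (shuffle_simplex (m + n) \<mu> f g))) b) a"

definition cross_product ::
    "nat \<Rightarrow> int \<Rightarrow> int \<Rightarrow> 'a topology \<Rightarrow> 'b topology \<Rightarrow>
     'a chain set \<Rightarrow> 'b chain set \<Rightarrow> ('a \<times> 'b) chain set" where
  "cross_product p m n X Y u v =
     the_elem {homology_class p (m + n) (k_prod X Y) {} (cross_chain (nat m) (nat n) a b) |a b.
       a \<in> u \<and> b \<in> v}"

section \<open>The pairing and the transgression\<close>

abbreviation BSym :: "'c operad \<Rightarrow> nat \<Rightarrow> 'c set topology" where
  "BSym C k \<equiv> orbit_space k (op_space C k) (op_act C k)"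

definition diagonal_action ::
    "(nat \<Rightarrow> 'c \<Rightarrow> (nat \<Rightarrow> 'a) \<Rightarrow> 'a) \<Rightarrow> nat \<Rightarrow> 'c set \<times> 'a \<Rightarrow> 'a" where
  "diagonal_action \<theta> k = (\<lambda>(o', y). the_elem ((\<lambda>c. \<theta> k c (\<lambda>i\<in>{..<k}. y)) ` o'))"

definition circ_summand ::
    "nat \<Rightarrow> 'c operad \<Rightarrow> int \<Rightarrow> int \<Rightarrow> 'a topology \<Rightarrow> (nat \<Rightarrow> 'c \<Rightarrow> (nat \<Rightarrow> 'a) \<Rightarrow> 'a) \<Rightarrow>
     nat \<Rightarrow> 'c set chain set \<Rightarrow> 'a chain set \<Rightarrow> 'a chain set" where
  "circ_summand p C m n Y \<theta> k u y =
     induced p (m + n) Y {} (diagonal_action \<theta> k) (cross_product p m n (BSym C k) Y u y)"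

abbreviation homology_Sym_sum :: "nat \<Rightarrow> 'c operad \<Rightarrow> int \<Rightarrow> (nat \<Rightarrow> 'c set chain set) monoid" where
  "homology_Sym_sum p C m \<equiv> sum_group UNIV (\<lambda>k. homology_mod p m (BSym C k))"

definition circ ::
    "nat \<Rightarrow> 'c operad \<Rightarrow> int \<Rightarrow> int \<Rightarrow> 'a topology \<Rightarrow> (nat \<Rightarrow> 'c \<Rightarrow> (nat \<Rightarrow> 'a) \<Rightarrow> 'a) \<Rightarrow>
     (nat \<Rightarrow> 'c set chain set) \<Rightarrow> 'a chain set \<Rightarrow> 'a chain set" where
  "circ p C m n Y \<theta> r y =
     finprod (homology_mod p (m + n) Y) (\<lambda>k. circ_summand p C m n Y \<theta> k (r k) y)
       {k. r k \<noteq> \<one>\<^bsub>homology_mod p m (BSym C k)\<^esub>}"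

definition transgresses ::
    "nat \<Rightarrow> int \<Rightarrow> 'a topology \<Rightarrow> 'a \<Rightarrow> 'a chain set \<Rightarrow> (real \<Rightarrow> 'a) chain set \<Rightarrow> bool" where
  "transgresses p s X x\<^sub>0 x y \<longleftrightarrow>
     x \<in> carrier (homology_mod p s X) \<and>
     y \<in> carrier (homology_mod p (s - 1) (loop_space X x\<^sub>0)) \<and>
     (\<exists>w \<in> carrier (rel_homology_mod p s (path_space X x\<^sub>0) (loops X x\<^sub>0)).
        induced p s X {x\<^sub>0} (\<lambda>\<alpha>. \<alpha> 1) w = induced p s X {x\<^sub>0} id x \<and>
        connecting p s (path_space X x\<^sub>0) (loops X x\<^sub>0) w = y)"

end

theory Submission
  imports Defs "HOL-Analysis.Abstract_Topological_Spaces"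
begin

text \<open>
  Let \<open>a\<close> be a cycle modulo \<open>p\<close> representing a class of \<open>\<Sigma>\<^sub>k\<close> and let \<open>c\<close> be a relative cycle of the
  pair of path and loop space that exhibits \<open>x\<close> as transgressive. The diagonal action maps the pair
  of path and loop space, multiplied by \<open>B\<Sigma>\<^sub>k\<close>, to itself, and it commutes with the evaluation at 1.
  So the image of \<open>a \<times> c\<close> under the diagonal action is a relative cycle that evaluates to the image
  of \<open>a \<times> ev c\<close>, and the Leibniz rule for the shuffle product identifies its boundary with the image
  of \<open>\<plusminus> a \<times> \<partial>c\<close>.

  Continuity of the action on orbits holds although \<open>C(k)\<close> is only weak Hausdorff: it suffices to
  test it on compact Hausdorff spaces \<open>L\<close>, where \<open>C(k) \<times> L\<close> is already compactly generated and the
  open orbit projection stays open after multiplication with \<open>L\<close>.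
\<close>

section \<open>Weak Hausdorff spaces and k-ification\<close>

text \<open>Two obstacles shape the proof. Products carry the k-ified topology, so the continuity of
  a shuffle simplex rests on its two factors having Hausdorff images. \<open>BSym C k\<close> is
  weakly Hausdorff because the orbit relation is a finite union of equalizers; in path spaces the
  evaluations into \<open>X\<close> separate points, which suffices. Classes modulo p are
  represented by integral chains, so every boundary carries a summand that is p times a chain. If
  such a multiple is supported in a subspace, so is the chain that is multiplied, since p is
  nonzero; this makes the connecting map well defined. The Leibniz rule is combinatorial: a shuffle
  is a list of lattice points, a sum of shuffles is a cone over shorter ones with the last point as
  apex, and the rule follows by induction from the boundary of a cone. The sign in
  \<open>connecting\<close> absorbs the Leibniz sign, as (-1)^(m+s) times (-1)^m is (-1)^s. Since
  transgression is an additive relation, a sum over k reduces to a single k.\<close>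

lemma Hausdorff_compact_image:
  assumes L: "compact_space L" "Hausdorff_space L" and f: "continuous_map L X f"
    and X: "weakly_Hausdorff_space X"
  shows "Hausdorff_space (subtopology X (f ` topspace L))"
proof -
  let ?Y = "subtopology X (f ` topspace L)"
  have sub: "f ` topspace L \<subseteq> topspace X"
    by (rule continuous_map_image_subset_topspace [OF f])
  \<comment> \<open>A closed subset of \<open>L\<close> is again compact Hausdorff, so weak
    Hausdorffness makes its image closed. A closed continuous image of the normal T1 space
    \<open>L\<close> is then normal and T1, hence Hausdorff.\<close>
  have "closed_map L ?Y f"
    unfolding closed_map_def
  proof (intro allI impI)
    fix U assume U: "closedin L U"
    then have "compact_space (subtopology L U)" "Hausdorff_space (subtopology L U)"
      using L by (simp_all add: closedin_compact_space compact_space_subtopology Hausdorff_space_subtopology)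
    moreover have "continuous_map (subtopology L U) X f"
      by (rule continuous_map_from_subtopology [OF f])
    ultimately have "closedin X (f ` topspace (subtopology L U))"
      using X weakly_Hausdorff_space_image by blast
    then have "closedin X (f ` U)"
      using closedin_subset [OF U] by (simp add: Int_absorb1)
    then show "closedin ?Y (f ` U)"
      using closedin_subset [OF U] by (simp add: closedin_subset_topspace image_mono)
  qed
  moreover have "continuous_map L ?Y f"
    by (simp add: continuous_map_in_subtopology f)
  moreover have "f ` topspace L = topspace ?Y"
    using sub by auto
  moreover have "normal_space L"
    using L by (simp add: compact_Hausdorff_or_regular_imp_normal_space)
  ultimately show ?thesis
    using L(2) by (metis normal_space_continuous_closed_map_image normal_t1_eq_Hausdorff_space
        t1_space_closed_map_image)
qed

text \<open>Disjoint neighbourhoods are pulled back from the image in \<open>W\<close>, which is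
  Hausdorff by the previous lemma. This serves powers of \<open>X\<close> and spaces of paths, whose
  points are separated by projections or evaluations into \<open>X\<close>.\<close>

lemma Hausdorff_compact_image_separating:
  assumes L: "compact_space L" "Hausdorff_space L" and f: "continuous_map L Z f"
    and W: "weakly_Hausdorff_space W"
    and sep: "\<And>y z. \<lbrakk>y \<in> topspace Z; z \<in> topspace Z; y \<noteq> z\<rbrakk> \<Longrightarrow> \<exists>h. continuous_map Z W h \<and> h y \<noteq> h z"
  shows "Hausdorff_space (subtopology Z (f ` topspace L))"
proof -
  have sub: "f ` topspace L \<subseteq> topspace Z"
    by (rule continuous_map_image_subset_topspace [OF f])
  show ?thesis
    unfolding Hausdorff_space_def
  proof (intro allI impI)
    fix y z assume yz: "y \<in> topspace (subtopology Z (f ` topspace L)) \<and>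
      z \<in> topspace (subtopology Z (f ` topspace L)) \<and> y \<noteq> z"
    then obtain h where h: "continuous_map Z W h" "h y \<noteq> h z"
      using sep by auto
    let ?H = "subtopology W ((h \<circ> f) ` topspace L)"
    have "Hausdorff_space ?H"
      by (rule Hausdorff_compact_image [OF L continuous_map_compose [OF f h(1)] W])
    moreover have hc: "continuous_map (subtopology Z (f ` topspace L)) ?H h"
      using sub h(1) by (auto simp: continuous_map_in_subtopology intro: continuous_map_from_subtopology)
    moreover have "h y \<in> topspace ?H" "h z \<in> topspace ?H"
      using hc yz by (auto simp: continuous_map_def Pi_iff)
    ultimately obtain U V where UV: "openin ?H U" "openin ?H V" "h y \<in> U" "h z \<in> V" "disjnt U V"
      using h(2) unfolding Hausdorff_space_def by (metis (no_types, lifting))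
    let ?P = "\<lambda>U. {x \<in> topspace (subtopology Z (f ` topspace L)). h x \<in> U}"
    have "openin (subtopology Z (f ` topspace L)) (?P U)" "openin (subtopology Z (f ` topspace L)) (?P V)"
      using UV hc openin_continuous_map_preimage by blast+
    moreover have "y \<in> ?P U" "z \<in> ?P V" "disjnt (?P U) (?P V)"
      using yz UV by (auto simp: disjnt_iff)
    ultimately show "\<exists>U V. openin (subtopology Z (f ` topspace L)) U \<and>
        openin (subtopology Z (f ` topspace L)) V \<and> y \<in> U \<and> z \<in> V \<and> disjnt U V"
      by blast
  qed
qed

text \<open>\<open>W\<close> itself need not be Hausdorff. The two maps are glued to one map on two
  copies of \<open>L\<close>; its image is a Hausdorff subspace that contains both images, and there
  the usual equalizer argument applies.\<close>

lemma closedin_weakly_Hausdorff_eq: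
  assumes L: "compact_space L" "Hausdorff_space L" and W: "weakly_Hausdorff_space W"
    and f: "continuous_map L W f" and g: "continuous_map L W g"
  shows "closedin L {x \<in> topspace L. f x = g x}"
proof -
  let ?M = "prod_topology L (discrete_topology (UNIV :: bool set))"
  let ?h = "\<lambda>(x, b). if b then f x else g x"
  have h: "continuous_map ?M W ?h"
    unfolding continuous_map_def
  proof (intro conjI allI impI)
    show "?h \<in> topspace ?M \<rightarrow> topspace W"
      using f g by (auto simp: continuous_map_def Pi_iff)
    fix U assume "openin W U"
    then have "openin L {x \<in> topspace L. f x \<in> U}" "openin L {x \<in> topspace L. g x \<in> U}"
      using f g by (auto simp: continuous_map_def)
    then have "openin ?M ({x \<in> topspace L. f x \<in> U} \<times> {True} \<union> {x \<in> topspace L. g x \<in> U} \<times> {False})"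
      by (intro openin_Un) (auto simp: openin_prod_Times_iff)
    then show "openin ?M {x \<in> topspace ?M. ?h x \<in> U}"
      by (rule back_subst [of "openin ?M"]) (auto split: if_splits)
  qed
  have "compact_space ?M" "Hausdorff_space ?M"
    using L by (simp_all add: compact_space_prod_topology compact_space_discrete_topology
        Hausdorff_space_prod_topology)
  then have H: "Hausdorff_space (subtopology W (?h ` topspace ?M))"
    using h W by (rule Hausdorff_compact_image)
  have "f ` topspace L \<subseteq> ?h ` topspace ?M" "g ` topspace L \<subseteq> ?h ` topspace ?M"
    by force+
  then have "continuous_map L (subtopology W (?h ` topspace ?M)) f"
      "continuous_map L (subtopology W (?h ` topspace ?M)) g"
    using f g by (auto simp: continuous_map_in_subtopology)
  then show ?thesis
    using H closedin_continuous_maps_eq by blast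
qed

section \<open>Maps into and out of the k-ification\<close>

lemma topspace_kification [simp]: "topspace (kification X) = topspace X"
proof -
  have "compactly_closed X {}"
    by (simp add: compactly_closed_def)
  then have "openin (kification X) (topspace X)"
    by (simp add: openin_kification)
  then show ?thesis
    by (meson openin_kification openin_subset openin_topspace subset_antisym)
qed

lemma compactly_closed_closedin: "closedin X A \<Longrightarrow> compactly_closed X A"
  by (auto simp: compactly_closed_def closedin_subset closedin_subtopology)

lemma continuous_map_kification_id: "continuous_map (kification X) X id"
  unfolding continuous_map_def
proof (intro conjI allI impI)
  fix U assume U: "openin X U"
  then have "U \<subseteq> topspace X"
    by (rule openin_subset)
  moreover have "compactly_closed X (topspace X - U)"
    using U by (intro compactly_closed_closedin) auto
  ultimately have "openin (kification X) U"
    by (simp add: openin_kification)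
  moreover have "{x \<in> topspace (kification X). id x \<in> U} = U"
    using \<open>U \<subseteq> topspace X\<close> by auto
  ultimately show "openin (kification X) {x \<in> topspace (kification X). id x \<in> U}"
    by simp
qed auto

text \<open>The image of \<open>L\<close> is itself one of the compact Hausdorff subspaces on which
  k-closed sets are tested, so their preimages are controlled by the map from \<open>L\<close> onto
  its image.\<close>

lemma continuous_map_into_kification:
  assumes L: "compact_space L" and f: "continuous_map L X f"
    and H: "Hausdorff_space (subtopology X (f ` topspace L))"
  shows "continuous_map L (kification X) f"
  unfolding continuous_map_def
proof (intro conjI allI impI)
  show "f \<in> topspace L \<rightarrow> topspace (kification X)"
    using f by (simp add: continuous_map_def)
  fix U assume "openin (kification X) U"
  then have U: "U \<subseteq> topspace X" "compactly_closed X (topspace X - U)"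
    by (auto simp: openin_kification)
  have K: "compactin X (f ` topspace L)"
    using L f compact_space_def image_compactin by blast
  let ?Y = "subtopology X (f ` topspace L)"
  have c: "closedin ?Y (f ` topspace L \<inter> (topspace X - U))"
    using U K H by (auto simp: compactly_closed_def)
  have "continuous_map L ?Y f"
    by (simp add: continuous_map_in_subtopology f)
  then have "closedin L {x \<in> topspace L. f x \<in> f ` topspace L \<inter> (topspace X - U)}"
    using c closedin_continuous_map_preimage by blast
  then have "openin L (topspace L - {x \<in> topspace L. f x \<in> f ` topspace L \<inter> (topspace X - U)})"
    by blast
  then show "openin L {x \<in> topspace L. f x \<in> U}"
    using f by (auto intro: back_subst [of "openin L"] simp: continuous_map_def Pi_iff)
qed

lemma continuous_map_from_kification:
  assumes "\<And>K. \<lbrakk>compactin X K; Hausdorff_space (subtopology X K)\<rbrakk> \<Longrightarrow> continuous_map (subtopology X K) Y f"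
  shows "continuous_map (kification X) Y f"
  unfolding continuous_map_def
proof (intro conjI allI impI)
  \<comment> \<open>Singletons are compact Hausdorff subspaces, so the assumption also controls the
    values of \<open>f\<close> at points.\<close>
  have "f x \<in> topspace Y" if "x \<in> topspace X" for x
  proof -
    have "continuous_map (subtopology X {x}) Y f"
      using that by (intro assms) (auto simp: Hausdorff_space_def)
    then show ?thesis
      using that by (auto simp: continuous_map_def)
  qed
  then show fY: "f \<in> topspace (kification X) \<rightarrow> topspace Y"
    by simp
  fix U assume U: "openin Y U"
  let ?P = "{x \<in> topspace X. f x \<in> U}"
  have "closedin (subtopology X K) (K \<inter> (topspace X - ?P))"
    if "compactin X K" "Hausdorff_space (subtopology X K)" for K
  proof -
    have "closedin (subtopology X K) {x \<in> topspace (subtopology X K). f x \<in> topspace Y - U}"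
      using assms [OF that] U closedin_continuous_map_preimage by blast
    then show ?thesis
      using compactin_subset_topspace [OF that(1)] fY
      by (auto intro: back_subst [of "closedin (subtopology X K)"] simp: Pi_iff)
  qed
  then show "openin (kification X) {x \<in> topspace (kification X). f x \<in> U}"
    by (auto simp: openin_kification compactly_closed_def)
qed

lemma continuous_map_into_k_prod:
  assumes L: "compact_space L"
    and f: "continuous_map L X f" "Hausdorff_space (subtopology X (f ` topspace L))"
    and g: "continuous_map L Y g" "Hausdorff_space (subtopology Y (g ` topspace L))"
  shows "continuous_map L (k_prod X Y) (\<lambda>x. (f x, g x))"
proof (rule continuous_map_into_kification [OF L])
  show "continuous_map L (prod_topology X Y) (\<lambda>x. (f x, g x))"
    using f g by (intro continuous_intros)
  \<comment> \<open>The image of the pair lies in the product of the two Hausdorff images and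
    inherits the property from there.\<close>
  have "Hausdorff_space (subtopology (prod_topology X Y) (f ` topspace L \<times> g ` topspace L))"
    using f g by (simp add: subtopology_Times Hausdorff_space_prod_topology)
  then have "Hausdorff_space (subtopology (subtopology (prod_topology X Y)
      (f ` topspace L \<times> g ` topspace L)) ((\<lambda>x. (f x, g x)) ` topspace L))"
    by (rule Hausdorff_space_subtopology)
  moreover have "(f ` topspace L \<times> g ` topspace L) \<inter> (\<lambda>x. (f x, g x)) ` topspace L =
      (\<lambda>x. (f x, g x)) ` topspace L"
    by auto
  ultimately show "Hausdorff_space (subtopology (prod_topology X Y) ((\<lambda>x. (f x, g x)) ` topspace L))"
    by (simp add: subtopology_subtopology)
qed

text \<open>Whitehead's argument: the product of a compactly generated space with a compact Hausdorff
  space needs no k-ification.\<close>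

lemma closedin_prod_compactly_generated:
  assumes X: "\<And>A. compactly_closed X A \<Longrightarrow> closedin X A"
    and L: "compact_space L" "Hausdorff_space L"
    and D: "D \<subseteq> topspace X \<times> topspace L"
    and cl: "\<And>K. \<lbrakk>compactin X K; Hausdorff_space (subtopology X K)\<rbrakk>
      \<Longrightarrow> closedin (prod_topology (subtopology X K) L) (D \<inter> K \<times> topspace L)"
  shows "closedin (prod_topology X L) D"
proof -
  have "\<exists>U V. openin X U \<and> openin L V \<and> x \<in> U \<and> l \<in> V \<and> U \<times> V \<subseteq> topspace X \<times> topspace L - D"
    if x: "x \<in> topspace X" and l: "l \<in> topspace L" and xl: "(x, l) \<notin> D" for x l
  proof -
    have sx: "compactin X {x}" "Hausdorff_space (subtopology X {x})"
      using x by (auto simp: Hausdorff_space_def)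
    \<comment> \<open>The test set {x} shows that the slice of \<open>D\<close> over
      \<open>x\<close> is closed in \<open>L\<close>; regularity of \<open>L\<close> then gives a
      closed neighbourhood \<open>B\<close> of \<open>l\<close> that misses this slice.\<close>
    have "continuous_map L (prod_topology (subtopology X {x}) L) (\<lambda>l'. (x, l'))"
      using x by (auto intro!: continuous_intros simp: continuous_map_in_subtopology)
    then have "closedin L {l' \<in> topspace L. (x, l') \<in> D \<inter> {x} \<times> topspace L}"
      using cl [OF sx] closedin_continuous_map_preimage by blast
    then have "closedin L {l' \<in> topspace L. (x, l') \<in> D}"
      by (rule back_subst [of "closedin L"]) auto
    moreover have "l \<in> topspace L - {l' \<in> topspace L. (x, l') \<in> D}"
      using l xl by blast
    ultimately obtain V W where VW: "openin L V" "openin L W" "l \<in> V"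
        "{l' \<in> topspace L. (x, l') \<in> D} \<subseteq> W" "disjnt V W"
      using compact_Hausdorff_imp_regular_space [OF L]
      unfolding regular_space_def by (metis (no_types, lifting))
    define B where "B = topspace L - W"
    have B: "closedin L B" "V \<subseteq> B" "B \<inter> {l' \<in> topspace L. (x, l') \<in> D} = {}"
      using VW openin_subset [OF VW(1)] by (auto simp: B_def disjnt_iff)
    \<comment> \<open>\<open>A\<close> collects the points whose slice meets \<open>B\<close>.
      Projection along the compact \<open>L\<close> is closed, so \<open>A\<close> is closed on
      every test set, and the complement of \<open>A\<close> times \<open>V\<close> is the required
      rectangle around (x, l).\<close>
    define A where "A = fst ` (D \<inter> topspace X \<times> B)"
    have "compactly_closed X A"
      unfolding compactly_closed_def
    proof (intro conjI allI impI)
      show "A \<subseteq> topspace X"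
        by (auto simp: A_def)
      fix K assume K: "compactin X K \<and> Hausdorff_space (subtopology X K)"
      have KX: "K \<subseteq> topspace X"
        using K compactin_subset_topspace by blast
      have "closedin (prod_topology (subtopology X K) L) (K \<times> B)"
        using KX B(1) by (metis closedin_prod_Times_iff closedin_topspace inf.absorb2 topspace_subtopology)
      then have "closedin (prod_topology (subtopology X K) L) ((D \<inter> K \<times> topspace L) \<inter> K \<times> B)"
        using cl K by blast
      then have "closedin (subtopology X K) (fst ` ((D \<inter> K \<times> topspace L) \<inter> K \<times> B))"
        using closed_map_fst [OF L(1)] closed_map_def by blast
      moreover have "fst ` ((D \<inter> K \<times> topspace L) \<inter> K \<times> B) = K \<inter> A"
        using KX closedin_subset [OF B(1)] unfolding A_def by force
      ultimately show "closedin (subtopology X K) (K \<inter> A)"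
        by simp
    qed
    then have "openin X (topspace X - A)"
      using X by blast
    moreover have "x \<in> topspace X - A"
      using x B(3) closedin_subset [OF B(1)] by (auto simp: A_def)
    moreover have "(topspace X - A) \<times> V \<subseteq> topspace X \<times> topspace L - D"
      using B(2) openin_subset [OF VW(1)] by (force simp: A_def)
    ultimately show ?thesis
      using VW by blast
  qed
  then have "openin (prod_topology X L) (topspace X \<times> topspace L - D)"
    unfolding openin_prod_topology_alt by blast
  then show ?thesis
    using D by (simp add: closedin_def)
qed

lemma continuous_map_prod_compactly_generated:
  assumes X: "\<And>A. compactly_closed X A \<Longrightarrow> closedin X A"
    and L: "compact_space L" "Hausdorff_space L"
    and f: "\<And>K. \<lbrakk>compactin X K; Hausdorff_space (subtopology X K)\<rbrakk>
      \<Longrightarrow> continuous_map (prod_topology (subtopology X K) L) Y f"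
  shows "continuous_map (prod_topology X L) Y f"
  unfolding continuous_map_closedin
proof (intro conjI allI impI ballI)
  show "f \<in> topspace (prod_topology X L) \<rightarrow> topspace Y"
  proof (clarsimp)
    fix x l assume "x \<in> topspace X" "l \<in> topspace L"
    moreover from this have "continuous_map (prod_topology (subtopology X {x}) L) Y f"
      by (intro f) (auto simp: Hausdorff_space_def)
    ultimately show "f (x, l) \<in> topspace Y"
      by (auto simp: continuous_map_def)
  qed
next
  fix B assume B: "closedin Y B"
  show "closedin (prod_topology X L) {z \<in> topspace (prod_topology X L). f z \<in> B}"
  proof (rule closedin_prod_compactly_generated [OF X L])
    fix K assume K: "compactin X K" "Hausdorff_space (subtopology X K)"
    have "closedin (prod_topology (subtopology X K) L)
        {z \<in> topspace (prod_topology (subtopology X K) L). f z \<in> B}"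
      using f [OF K] B closedin_continuous_map_preimage by blast
    then show "closedin (prod_topology (subtopology X K) L)
        ({z \<in> topspace (prod_topology X L). f z \<in> B} \<inter> K \<times> topspace L)"
      using compactin_subset_topspace [OF K(1)]
      by (auto intro: back_subst [of "closedin (prod_topology (subtopology X K) L)"])
  qed auto
qed

section \<open>Orbit spaces\<close>

lemma topspace_orbit_space: "topspace (orbit_space n X act) = orbit_of n act ` topspace X"
proof -
  have "{x \<in> topspace X. orbit_of n act x \<in> orbit_of n act ` topspace X} = topspace X"
    by auto
  then have "openin (orbit_space n X act) (orbit_of n act ` topspace X)"
    by (simp add: openin_orbit_space)
  then show ?thesis
    by (metis openin_orbit_space openin_subset openin_topspace subset_antisym)
qed

lemma orbit_of_self:
  assumes "right_action n X act" "x \<in> topspace X"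
  shows "x \<in> orbit_of n act x"
proof -
  have "act x id = x"
    using assms by (simp add: right_action_def)
  moreover have "id \<in> Sym n"
    by (simp add: permutes_id)
  ultimately show ?thesis
    by (metis image_eqI orbit_of_def)
qed

lemma act_in_topspace:
  assumes "right_action n X act" "x \<in> topspace X" "\<sigma> \<in> Sym n"
  shows "act x \<sigma> \<in> topspace X"
  using assms by (auto simp: right_action_def continuous_map_def Pi_iff)

lemma orbit_of_act:
  assumes act: "right_action n X act" and x: "x \<in> topspace X" and \<sigma>: "\<sigma> \<in> Sym n"
  shows "orbit_of n act (act x \<sigma>) = orbit_of n act x"
proof -
  have mult: "act (act x \<sigma>) \<tau> = act x (\<sigma> \<circ> \<tau>)" if "\<tau> \<in> Sym n" for \<tau>
    using that act x \<sigma> by (simp add: right_action_def)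
  have inv: "inv_into UNIV \<sigma> \<in> Sym n" "\<sigma> \<circ> inv_into UNIV \<sigma> = id"
    using \<sigma> by (simp_all add: permutes_inv permutes_inv_o)
  have "act x \<tau> \<in> orbit_of n act (act x \<sigma>)" if "\<tau> \<in> Sym n" for \<tau>
  proof -
    have "inv_into UNIV \<sigma> \<circ> \<tau> \<in> Sym n"
      using that inv by (simp add: permutes_compose)
    moreover have "act x \<tau> = act (act x \<sigma>) (inv_into UNIV \<sigma> \<circ> \<tau>)"
      using mult [OF \<open>inv_into UNIV \<sigma> \<circ> \<tau> \<in> Sym n\<close>] inv(2) by (simp flip: comp_assoc)
    ultimately show ?thesis
      by (auto simp: orbit_of_def)
  qed
  moreover have "act (act x \<sigma>) \<tau> \<in> orbit_of n act x" if "\<tau> \<in> Sym n" for \<tau>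
    using that \<sigma> mult [OF that] by (auto simp: orbit_of_def permutes_compose)
  ultimately show ?thesis
    by (auto simp: orbit_of_def)
qed

lemma orbit_of_eq_iff:
  assumes act: "right_action n X act" and xy: "x \<in> topspace X" "y \<in> topspace X"
  shows "orbit_of n act x = orbit_of n act y \<longleftrightarrow> (\<exists>\<sigma>\<in>Sym n. x = act y \<sigma>)"
  using orbit_of_self [OF act xy(1)] orbit_of_act [OF act xy(2)] by (auto simp: orbit_of_def)

text \<open>The saturation of an open set is the union of its preimages under the homeomorphisms
  given by the group elements.\<close>

lemma open_map_orbit_of:
  assumes act: "right_action n X act"
  shows "open_map X (orbit_space n X act) (orbit_of n act)"
  unfolding open_map_def openin_orbit_space
proof (intro allI impI conjI)
  fix U assume U: "openin X U"
  then have UX: "U \<subseteq> topspace X"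
    by (rule openin_subset)
  then show "orbit_of n act ` U \<subseteq> orbit_of n act ` topspace X"
    by (rule image_mono)
  have "openin X {x \<in> topspace X. act x \<sigma> \<in> U}" if "\<sigma> \<in> Sym n" for \<sigma>
    using act U that by (auto simp: right_action_def continuous_map_def)
  then have "openin X (\<Union>\<sigma>\<in>Sym n. {x \<in> topspace X. act x \<sigma> \<in> U})"
    by blast
  moreover have "x \<in> topspace X \<and> orbit_of n act x \<in> orbit_of n act ` U \<longleftrightarrow>
      x \<in> topspace X \<and> (\<exists>\<sigma>\<in>Sym n. act x \<sigma> \<in> U)" for x
  proof
    assume "x \<in> topspace X \<and> orbit_of n act x \<in> orbit_of n act ` U"
    then obtain u where "x \<in> topspace X" "u \<in> U" "orbit_of n act u = orbit_of n act x"
      by auto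
    then show "x \<in> topspace X \<and> (\<exists>\<sigma>\<in>Sym n. act x \<sigma> \<in> U)"
      using orbit_of_eq_iff [OF act, of u x] UX by auto
  next
    assume "x \<in> topspace X \<and> (\<exists>\<sigma>\<in>Sym n. act x \<sigma> \<in> U)"
    then show "x \<in> topspace X \<and> orbit_of n act x \<in> orbit_of n act ` U"
      using orbit_of_act [OF act] by (metis imageI)
  qed
  then have "{x \<in> topspace X. orbit_of n act x \<in> orbit_of n act ` U} =
      (\<Union>\<sigma>\<in>Sym n. {x \<in> topspace X. act x \<sigma> \<in> U})"
    by auto
  ultimately show "openin X {x \<in> topspace X. orbit_of n act x \<in> orbit_of n act ` U}"
    by simp
qed

text \<open>Products of quotient maps need not be quotient maps, but an open map stays open after
  multiplication with an identity; this replaces any statement about quotient topologies on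
  products.\<close>

lemma openin_orbit_of_prod:
  assumes act: "right_action n X act" and W: "openin (prod_topology X L) W"
  shows "openin (prod_topology (orbit_space n X act) L) (map_prod (orbit_of n act) id ` W)"
  unfolding openin_prod_topology_alt
proof (intro allI impI)
  fix o' l assume "(o', l) \<in> map_prod (orbit_of n act) id ` W"
  then obtain x where x: "(x, l) \<in> W" "o' = orbit_of n act x"
    by auto
  then obtain U V where UV: "openin X U" "openin L V" "x \<in> U" "l \<in> V" "U \<times> V \<subseteq> W"
    using W unfolding openin_prod_topology_alt by meson
  then have "openin (orbit_space n X act) (orbit_of n act ` U)"
    using open_map_orbit_of [OF act] by (simp add: open_map_def)
  moreover have "orbit_of n act ` U \<times> V \<subseteq> map_prod (orbit_of n act) id ` W"
    using UV(5) by force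
  ultimately show "\<exists>U V. openin (orbit_space n X act) U \<and> openin L V \<and> o' \<in> U \<and> l \<in> V \<and>
      U \<times> V \<subseteq> map_prod (orbit_of n act) id ` W"
    using UV x(2) by (meson imageI)
qed

text \<open>Closedness in the quotient is closedness of the preimage in \<open>X\<close>, which
  compact generation reduces to a compact Hausdorff \<open>K\<close> in \<open>X\<close>. There the
  pairs (k, l) with \<open>v l\<close> equal to the orbit of k form a closed subset of
  \<open>K\<close> times \<open>L\<close>, whose projection to \<open>K\<close> is the set in
  question.\<close>

lemma weakly_Hausdorff_orbit_space:
  assumes X: "cgwh_space X" and act: "right_action n X act"
  shows "weakly_Hausdorff_space (orbit_space n X act)"
  unfolding weakly_Hausdorff_space_def
proof (intro allI impI)
  fix L :: "'a set set set topology" and v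
  assume "compact_space L \<and> Hausdorff_space L \<and> continuous_map L (orbit_space n X act) v"
  then have L: "compact_space L" "Hausdorff_space L" and v: "continuous_map L (orbit_space n X act) v"
    by auto
  let ?q = "orbit_of n act"
  have wH: "weakly_Hausdorff_space X" and cg: "\<And>A. compactly_closed X A \<Longrightarrow> closedin X A"
    using X by (auto simp: cgwh_space_def)
  \<comment> \<open>The orbit relation is closed once one factor is cut down to a compact Hausdorff
    \<open>K\<close>: on test sets of the other factor it is a finite union, over the permutations,
    of equalizers of maps into \<open>X\<close>.\<close>
  have same: "closedin (prod_topology X M) {z \<in> topspace (prod_topology X M). ?q (fst z) = ?q (snd z)}"
    if M: "M = subtopology X K" and K: "compactin X K" "Hausdorff_space (subtopology X K)" for M K
  proof (rule closedin_prod_compactly_generated [OF cg])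
    show M': "compact_space M" "Hausdorff_space M"
      using M K by (auto simp: compact_space_subtopology)
    fix K' assume K': "compactin X K'" "Hausdorff_space (subtopology X K')"
    let ?P = "prod_topology (subtopology X K') M"
    have P: "compact_space ?P" "Hausdorff_space ?P"
      using K' M' by (simp_all add: compact_space_prod_topology compact_space_subtopology
          Hausdorff_space_prod_topology)
    have f: "continuous_map ?P X fst"
      using continuous_map_fst continuous_map_in_subtopology by blast
    have s: "continuous_map ?P X snd"
      using continuous_map_snd continuous_map_in_subtopology M by blast
    have "closedin ?P {z \<in> topspace ?P. fst z = act (snd z) \<sigma>}" if "\<sigma> \<in> Sym n" for \<sigma>
    proof (rule closedin_weakly_Hausdorff_eq [OF P wH f])
      have "continuous_map X X (\<lambda>x. act x \<sigma>)"
        using act that by (simp add: right_action_def)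
      then show "continuous_map ?P X (\<lambda>z. act (snd z) \<sigma>)"
        using continuous_map_compose [OF s] by (simp add: o_def)
    qed
    moreover have "finite (Sym n)"
      by (simp add: finite_permutations)
    ultimately have "closedin ?P (\<Union>\<sigma>\<in>Sym n. {z \<in> topspace ?P. fst z = act (snd z) \<sigma>})"
      by (intro closedin_Union) auto
    moreover have "{z \<in> topspace (prod_topology X M). ?q (fst z) = ?q (snd z)} \<inter> K' \<times> topspace M =
        (\<Union>\<sigma>\<in>Sym n. {z \<in> topspace ?P. fst z = act (snd z) \<sigma>})"
      using compactin_subset_topspace [OF K'(1)]
      by (auto simp: M orbit_of_eq_iff [OF act] orbit_of_act [OF act])
    ultimately show "closedin ?P ({z \<in> topspace (prod_topology X M). ?q (fst z) = ?q (snd z)} \<inter>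
        K' \<times> topspace M)"
      by simp
  qed auto
  let ?A = "{x \<in> topspace X. ?q x \<in> v ` topspace L}"
  have "compactly_closed X ?A"
    unfolding compactly_closed_def
  proof (intro conjI allI impI)
    fix K assume "compactin X K \<and> Hausdorff_space (subtopology X K)"
    then have K: "compactin X K" "Hausdorff_space (subtopology X K)"
      by auto
    define M where "M = subtopology X K"
    have topM: "topspace M = K"
      using compactin_subset_topspace [OF K(1)] by (auto simp: M_def)
    let ?E = "{z \<in> topspace (prod_topology X M). ?q (fst z) \<noteq> ?q (snd z)}"
    have "openin (prod_topology X M) (topspace (prod_topology X M) -
        {z \<in> topspace (prod_topology X M). ?q (fst z) = ?q (snd z)})"
      using same [OF M_def K] by blast
    then have "openin (prod_topology X M) ?E"
      by (rule back_subst [of "openin (prod_topology X M)"]) auto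
    \<comment> \<open>The complement of the orbit relation is saturated in its first variable, so
      its image consists exactly of the pairs (orbit, k) in which k lies outside the orbit.\<close>
    then have o: "openin (prod_topology (orbit_space n X act) M) (map_prod ?q id ` ?E)"
      by (rule openin_orbit_of_prod [OF act])
    let ?N = "prod_topology M L"
    have "continuous_map ?N (prod_topology (orbit_space n X act) M) (\<lambda>(k, l). (v l, k))"
      unfolding case_prod_unfold
      using continuous_map_compose [OF continuous_map_snd v]
      by (intro continuous_intros) (simp add: o_def)
    then have "openin ?N {z \<in> topspace ?N. (\<lambda>(k, l). (v l, k)) z \<in> map_prod ?q id ` ?E}"
      using o openin_continuous_map_preimage by blast
    moreover have "{z \<in> topspace ?N. (\<lambda>(k, l). (v l, k)) z \<in> map_prod ?q id ` ?E} =
        {z \<in> topspace ?N. v (snd z) \<noteq> ?q (fst z)}"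
    proof -
      have "(v l, k) \<in> map_prod ?q id ` ?E \<longleftrightarrow> v l \<noteq> ?q k" if kl: "k \<in> topspace M" "l \<in> topspace L" for k l
      proof
        obtain x where x: "x \<in> topspace X" "v l = ?q x"
          using continuous_map_image_subset_topspace [OF v] kl by (auto simp: topspace_orbit_space)
        assume "v l \<noteq> ?q k"
        then have "(x, k) \<in> ?E"
          using x kl by simp
        then have "map_prod ?q id (x, k) \<in> map_prod ?q id ` ?E"
          by (rule imageI)
        then show "(v l, k) \<in> map_prod ?q id ` ?E"
          using x by simp
      next
        assume "(v l, k) \<in> map_prod ?q id ` ?E"
        then show "v l \<noteq> ?q k"
          by fastforce
      qed
      then show ?thesis
        by (intro Collect_cong conj_cong refl) (simp add: case_prod_unfold mem_Times_iff)
    qed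
    ultimately have "openin ?N {z \<in> topspace ?N. v (snd z) \<noteq> ?q (fst z)}"
      by (simp only:)
    then have "closedin ?N (topspace ?N - {z \<in> topspace ?N. v (snd z) \<noteq> ?q (fst z)})"
      by (rule closedin_diff [OF closedin_topspace])
    \<comment> \<open>Compactness of \<open>L\<close> enters here: projecting it away is a closed
      map.\<close>
    then have "closedin M (fst ` (topspace ?N - {z \<in> topspace ?N. v (snd z) \<noteq> ?q (fst z)}))"
      using closed_map_fst [OF L(1)] closed_map_def by blast
    moreover have "fst ` (topspace ?N - {z \<in> topspace ?N. v (snd z) \<noteq> ?q (fst z)}) = K \<inter> ?A"
    proof (intro equalityI subsetI)
      fix x assume "x \<in> fst ` (topspace ?N - {z \<in> topspace ?N. v (snd z) \<noteq> ?q (fst z)})"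
      then obtain l where "x \<in> K" "l \<in> topspace L" "v l = ?q x"
        using topM by auto
      moreover have "x \<in> topspace X"
        using \<open>x \<in> K\<close> compactin_subset_topspace [OF K(1)] by blast
      moreover have "?q x \<in> v ` topspace L"
        using \<open>l \<in> topspace L\<close> unfolding \<open>v l = ?q x\<close> [symmetric] by (rule imageI)
      ultimately show "x \<in> K \<inter> ?A"
        by simp
    next
      fix x assume "x \<in> K \<inter> ?A"
      then have "x \<in> K" "?q x \<in> v ` topspace L"
        by simp_all
      then obtain l where l: "x \<in> K" "l \<in> topspace L" "v l = ?q x"
        unfolding image_iff by metis
      then have "(x, l) \<in> topspace ?N - {z \<in> topspace ?N. v (snd z) \<noteq> ?q (fst z)}"
        by (simp add: topM)
      then have "fst (x, l) \<in> fst ` (topspace ?N - {z \<in> topspace ?N. v (snd z) \<noteq> ?q (fst z)})"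
        by (rule imageI)
      then show "x \<in> fst ` (topspace ?N - {z \<in> topspace ?N. v (snd z) \<noteq> ?q (fst z)})"
        by simp
    qed
    ultimately show "closedin (subtopology X K) (K \<inter> ?A)"
      by (simp add: M_def)
  qed auto
  then have "openin X (topspace X - ?A)"
    using cg by blast
  then have "openin (orbit_space n X act) (topspace (orbit_space n X act) - v ` topspace L)"
    by (auto simp: openin_orbit_space topspace_orbit_space intro: back_subst [of "openin X"])
  then show "closedin (orbit_space n X act) (v ` topspace L)"
    using continuous_map_image_subset_topspace [OF v] by (simp add: closedin_def)
qed

section \<open>Operad actions\<close>

locale algebra_over_operad =
  fixes C :: "'c operad" and X :: "'a topology" and \<theta> :: "nat \<Rightarrow> 'c \<Rightarrow> (nat \<Rightarrow> 'a) \<Rightarrow> 'a"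
  assumes operad: "operad C" and algebra: "operad_algebra C X \<theta>"
begin

lemma cgwh_op_space: "cgwh_space (op_space C k)"
  and right_action_op_act: "right_action k (op_space C k) (op_act C k)"
  using operad by (simp_all add: operad_def)

lemma weakly_Hausdorff_X: "weakly_Hausdorff_space X"
  using algebra by (simp add: operad_algebra_def cgwh_space_def)

lemma weakly_Hausdorff_BSym: "weakly_Hausdorff_space (BSym C k)"
  using cgwh_op_space right_action_op_act by (rule weakly_Hausdorff_orbit_space)

lemma continuous_map_algebra:
  "continuous_map (k_prod (op_space C n) (product_topology (\<lambda>_. X) {..<n})) X (\<lambda>(c, x). \<theta> n c x)"
  using algebra unfolding operad_algebra_def by (elim conjE) (erule spec)

lemma continuous_map_op_comp:
  "continuous_map
    (k_prod (op_space C (length js)) (product_topology (\<lambda>s. op_space C (js ! s)) {..<length js}))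
    (op_space C (sum_list js)) (\<lambda>(c, d). op_comp C js c d)"
  using operad unfolding operad_def by (elim conjE) (erule spec)

lemma algebra_comp:
  "\<lbrakk>c \<in> topspace (op_space C (length js));
    d \<in> (\<Pi>\<^sub>E s\<in>{..<length js}. topspace (op_space C (js ! s)));
    x \<in> {..<sum_list js} \<rightarrow>\<^sub>E topspace X\<rbrakk>
    \<Longrightarrow> \<theta> (sum_list js) (op_comp C js c d) x =
        \<theta> (length js) c (\<lambda>s\<in>{..<length js}. \<theta> (js ! s) (d s) (tuple_block js s x))"
  using algebra unfolding operad_algebra_def by blast

lemma algebra_act:
  "\<lbrakk>c \<in> topspace (op_space C n); \<sigma> \<in> Sym n; x \<in> {..<n} \<rightarrow>\<^sub>E topspace X\<rbrakk>
    \<Longrightarrow> \<theta> n (op_act C n c \<sigma>) x = \<theta> n c (permute_tuple n \<sigma> x)"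
  using algebra unfolding operad_algebra_def by blast

text \<open>A constant tuple is unchanged by permuting its entries, so equivariance makes the action
  constant along an orbit; hence \<open>the_elem\<close> is applied to a singleton.\<close>

lemma diagonal_action_orbit:
  assumes c: "c \<in> topspace (op_space C k)" and y: "y \<in> topspace X"
  shows "diagonal_action \<theta> k (orbit_of k (op_act C k) c, y) = \<theta> k c (\<lambda>i\<in>{..<k}. y)"
proof -
  let ?y = "\<lambda>i\<in>{..<k}. y"
  have "\<theta> k (op_act C k c \<sigma>) ?y = \<theta> k c ?y" if \<sigma>: "\<sigma> \<in> Sym k" for \<sigma>
  proof -
    have "permute_tuple k \<sigma> ?y = ?y"
    proof
      fix s
      have "inv_into UNIV \<sigma> permutes {..<k}"
        using \<sigma> by (simp add: permutes_inv)
      then have "s < k \<Longrightarrow> inv_into UNIV \<sigma> s < k"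
        using permutes_in_image by fastforce
      then show "permute_tuple k \<sigma> ?y s = ?y s"
        by (simp add: permute_tuple_def)
    qed
    moreover have "?y \<in> {..<k} \<rightarrow>\<^sub>E topspace X"
      using y by auto
    ultimately show ?thesis
      using algebra_act [OF c \<sigma>] by simp
  qed
  then have "(\<lambda>c. \<theta> k c ?y) ` orbit_of k (op_act C k) c \<subseteq> {\<theta> k c ?y}"
    by (auto simp: orbit_of_def)
  moreover have "c \<in> orbit_of k (op_act C k) c"
    using right_action_op_act c by (rule orbit_of_self)
  ultimately have "(\<lambda>c. \<theta> k c ?y) ` orbit_of k (op_act C k) c = {\<theta> k c ?y}"
    by blast
  then show ?thesis
    by (simp add: diagonal_action_def)
qed

abbreviation pt where "pt \<equiv> algebra_point C \<theta>"

lemma pt_in_topspace: "pt \<in> topspace X"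
proof -
  \<comment> \<open>The function with value \<open>undefined\<close> everywhere is the unique tuple
    of length 0.\<close>
  let ?u = "\<lambda>_::nat. undefined :: 'a"
  obtain a where a: "topspace (op_space C 0) = {a}"
    using operad by (auto simp: operad_def)
  have "(\<lambda>(c, x). \<theta> 0 c x) (a, ?u) \<in> topspace X"
    by (rule funcset_mem [OF continuous_map_funspace [OF continuous_map_algebra]]) (simp add: a)
  then show ?thesis
    by (simp add: algebra_point_def a)
qed

text \<open>Substituting the unique nullary operation into all inputs of c gives an element of
  \<open>C(0)\<close>, which is a point; associativity of the action turns this into the invariance
  of the base point.\<close>

lemma diagonal_action_pt:
  assumes "o' \<in> topspace (BSym C k)"
  shows "diagonal_action \<theta> k (o', pt) = pt"
proof -
  let ?u = "\<lambda>_::nat. undefined :: 'a"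
  obtain a where a: "topspace (op_space C 0) = {a}"
    using operad by (auto simp: operad_def)
  have x: "pt = \<theta> 0 a ?u"
    by (simp add: algebra_point_def a)
  obtain c where c: "c \<in> topspace (op_space C k)" "o' = orbit_of k (op_act C k) c"
    using assms by (auto simp: topspace_orbit_space)
  let ?js = "replicate k (0::nat)"
  let ?d = "\<lambda>s\<in>{..<k}. a"
  have js: "sum_list ?js = 0" "length ?js = k"
    by (simp_all add: sum_list_replicate)
  have d: "?d \<in> (\<Pi>\<^sub>E s\<in>{..<length ?js}. topspace (op_space C (?js ! s)))"
    by (auto simp: a)
  have "(\<lambda>(c, d). op_comp C ?js c d) (c, ?d) \<in> topspace (op_space C (sum_list ?js))"
    by (rule funcset_mem [OF continuous_map_funspace [OF continuous_map_op_comp]])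
      (use c d in \<open>simp add: PiE_iff\<close>)
  then have "op_comp C ?js c ?d = a"
    by (simp add: js a)
  moreover have "\<theta> (sum_list ?js) (op_comp C ?js c ?d) ?u =
      \<theta> (length ?js) c (\<lambda>s\<in>{..<length ?js}. \<theta> (?js ! s) (?d s) (tuple_block ?js s ?u))"
  proof -
    have "?u \<in> {..<sum_list ?js} \<rightarrow>\<^sub>E topspace X" "c \<in> topspace (op_space C (length ?js))"
      using c by (simp_all add: js)
    then show ?thesis
      using d by (intro algebra_comp)
  qed
  moreover have "(\<lambda>s\<in>{..<length ?js}. \<theta> (?js ! s) (?d s) (tuple_block ?js s ?u)) = (\<lambda>s\<in>{..<k}. pt)"
  proof -
    have "tuple_block ?js s ?u = ?u" if "s < k" for s
      using that by (auto simp: tuple_block_def)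
    then show ?thesis
      unfolding js(2) by (intro restrict_ext) (simp add: x)
  qed
  ultimately have "\<theta> k c (\<lambda>s\<in>{..<k}. pt) = pt"
    by (simp add: js x)
  then show ?thesis
    using c pt_in_topspace by (simp add: diagonal_action_orbit)
qed

text \<open>There is no continuous choice of representatives of the orbits
  \<open>\<sigma> l\<close>. Instead the preimage of an open set is formed in \<open>C(k)\<close>
  times \<open>L\<close>, pushed forward along the open orbit projection, and pulled back along the
  graph of \<open>\<sigma>\<close>.\<close>

lemma continuous_map_diagonal_action:
  assumes L: "compact_space L" "Hausdorff_space L"
    and \<sigma>: "continuous_map L (BSym C k) \<sigma>" and \<tau>: "continuous_map L X \<tau>"
  shows "continuous_map L X (\<lambda>l. diagonal_action \<theta> k (\<sigma> l, \<tau> l))"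
proof -
  let ?C = "op_space C k" and ?q = "orbit_of k (op_act C k)"
  let ?f = "\<lambda>z. \<theta> k (fst z) (\<lambda>i\<in>{..<k}. \<tau> (snd z))"
  have cg: "\<And>A. compactly_closed ?C A \<Longrightarrow> closedin ?C A" and wH: "weakly_Hausdorff_space ?C"
    using cgwh_op_space by (auto simp: cgwh_space_def)
  have f: "continuous_map (prod_topology ?C L) X ?f"
  proof (rule continuous_map_prod_compactly_generated [OF cg L])
    fix K assume K: "compactin ?C K" "Hausdorff_space (subtopology ?C K)"
    let ?P = "prod_topology (subtopology ?C K) L" and ?X = "product_topology (\<lambda>_. X) {..<k}"
    let ?t = "\<lambda>z::'c \<times> 'b. \<lambda>i\<in>{..<k}. \<tau> (snd z)"
    have P: "compact_space ?P" "Hausdorff_space ?P"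
      using K L by (simp_all add: compact_space_prod_topology compact_space_subtopology
          Hausdorff_space_prod_topology)
    have fst: "continuous_map ?P ?C fst"
      using continuous_map_fst continuous_map_in_subtopology by blast
    have t: "continuous_map ?P ?X ?t"
      using continuous_map_compose [OF continuous_map_snd \<tau>]
      by (auto simp: continuous_map_componentwise o_def)
    \<comment> \<open>The power of \<open>X\<close> carries the plain product topology, so
      Hausdorffness of the image is obtained from the coordinate projections rather than from weak
      Hausdorffness of the power.\<close>
    have "Hausdorff_space (subtopology ?X (?t ` topspace ?P))"
    proof (rule Hausdorff_compact_image_separating [OF P t weakly_Hausdorff_X])
      fix y z assume yz: "y \<in> topspace ?X" "z \<in> topspace ?X" "y \<noteq> z"
      then obtain i where "i < k" "y i \<noteq> z i"
        by (auto simp: PiE_def extensional_def fun_eq_iff) metis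
      then show "\<exists>h. continuous_map ?X X h \<and> h y \<noteq> h z"
        using continuous_map_product_projection [of i "{..<k}" "\<lambda>_. X"] by blast
    qed
    then have "continuous_map ?P (k_prod ?C ?X) (\<lambda>z. (fst z, ?t z))"
      by (intro continuous_map_into_k_prod P fst t Hausdorff_compact_image [OF P fst wH])
    then have "continuous_map ?P X ((\<lambda>(c, x). \<theta> k c x) \<circ> (\<lambda>z. (fst z, ?t z)))"
      using continuous_map_algebra by (rule continuous_map_compose)
    then show "continuous_map ?P X ?f"
      by (simp add: o_def)
  qed
  have \<sigma>': "\<sigma> l \<in> ?q ` topspace ?C" if "l \<in> topspace L" for l
    using continuous_map_image_subset_topspace [OF \<sigma>] that by (auto simp: topspace_orbit_space)
  have \<tau>': "\<tau> l \<in> topspace X" if "l \<in> topspace L" for l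
    using continuous_map_image_subset_topspace [OF \<tau>] that by auto
  have f': "?f (c, l) = diagonal_action \<theta> k (?q c, \<tau> l)" if "c \<in> topspace ?C" "l \<in> topspace L" for c l
    using that \<tau>' by (simp add: diagonal_action_orbit)
  show ?thesis
    unfolding continuous_map_def
  proof (intro conjI allI impI)
    show "(\<lambda>l. diagonal_action \<theta> k (\<sigma> l, \<tau> l)) \<in> topspace L \<rightarrow> topspace X"
    proof
      fix l assume l: "l \<in> topspace L"
      then obtain c where c: "c \<in> topspace ?C" "\<sigma> l = ?q c"
        using \<sigma>' by blast
      have "?f (c, l) \<in> topspace X"
        by (rule funcset_mem [OF continuous_map_funspace [OF f]]) (simp add: c l)
      then show "diagonal_action \<theta> k (\<sigma> l, \<tau> l) \<in> topspace X"
        using f' l c by simp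
    qed
    fix V assume V: "openin X V"
    let ?W = "{z \<in> topspace (prod_topology ?C L). ?f z \<in> V}"
    have "openin (prod_topology ?C L) ?W"
      using f V openin_continuous_map_preimage by blast
    then have "openin (prod_topology (BSym C k) L) (map_prod ?q id ` ?W)"
      by (rule openin_orbit_of_prod [OF right_action_op_act])
    moreover have "continuous_map L (prod_topology (BSym C k) L) (\<lambda>l. (\<sigma> l, l))"
      using \<sigma> by (intro continuous_intros) auto
    ultimately have "openin L {l \<in> topspace L. (\<sigma> l, l) \<in> map_prod ?q id ` ?W}"
      using openin_continuous_map_preimage by fastforce
    \<comment> \<open>Whether a pair lies in \<open>?W\<close> depends only on the orbit of its
      first entry, so a single representative of \<open>\<sigma> l\<close> decides.\<close>
    moreover have eq: "(\<sigma> l, l) \<in> map_prod ?q id ` ?W \<longleftrightarrow> diagonal_action \<theta> k (\<sigma> l, \<tau> l) \<in> V"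
      if l: "l \<in> topspace L" for l
    proof
      obtain c where c: "c \<in> topspace ?C" "\<sigma> l = ?q c"
        using \<sigma>' l by blast
      assume "diagonal_action \<theta> k (\<sigma> l, \<tau> l) \<in> V"
      then have "?f (c, l) \<in> V"
        unfolding f' [OF c(1) l] c(2) .
      then have "(c, l) \<in> ?W"
        using c(1) l by simp
      then have "map_prod ?q id (c, l) \<in> map_prod ?q id ` ?W"
        by (rule imageI)
      then show "(\<sigma> l, l) \<in> map_prod ?q id ` ?W"
        unfolding c(2) by simp
    next
      assume "(\<sigma> l, l) \<in> map_prod ?q id ` ?W"
      then obtain c where "c \<in> topspace ?C" "\<sigma> l = ?q c" "?f (c, l) \<in> V"
        by auto
      then show "diagonal_action \<theta> k (\<sigma> l, \<tau> l) \<in> V"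
        using f' [OF _ l, of c] by simp
    qed
    moreover have "{l \<in> topspace L. (\<sigma> l, l) \<in> map_prod ?q id ` ?W} =
        {l \<in> topspace L. diagonal_action \<theta> k (\<sigma> l, \<tau> l) \<in> V}"
      by (intro Collect_cong conj_cong refl eq)
    ultimately show "openin L {l \<in> topspace L. diagonal_action \<theta> k (\<sigma> l, \<tau> l) \<in> V}"
      by (simp only:)
  qed
qed
end

section \<open>Path and loop spaces\<close>

lemma topspace_compact_open_paths:
  "topspace (compact_open_paths X) = {\<alpha>. pathin X \<alpha> \<and> \<alpha> \<in> extensional {0..1}}"
proof -
  \<comment> \<open>With the empty compact set the subbasic condition is void, so the set of all
    paths is itself subbasic.\<close>
  have "\<exists>K U. {\<alpha>. pathin X \<alpha> \<and> \<alpha> \<in> extensional {0..1}} =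
        {\<alpha>. pathin X \<alpha> \<and> \<alpha> \<in> extensional {0..1} \<and> \<alpha> ` K \<subseteq> U} \<and>
      compact K \<and> K \<subseteq> {0..1} \<and> openin X U"
    by (intro exI [of _ "{}"]) auto
  then show ?thesis
    unfolding compact_open_paths_def topology_generated_by_topspace by blast
qed

lemma openin_compact_open_paths:
  assumes "compact K" "K \<subseteq> {0..1}" "openin X U"
  shows "openin (compact_open_paths X)
    {\<alpha> \<in> topspace (compact_open_paths X). \<alpha> ` K \<subseteq> U}"
proof -
  have "{\<alpha> \<in> topspace (compact_open_paths X). \<alpha> ` K \<subseteq> U} =
      {\<alpha>. pathin X \<alpha> \<and> \<alpha> \<in> extensional {0..1} \<and> \<alpha> ` K \<subseteq> U}"
    by (auto simp: topspace_compact_open_paths)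
  then show ?thesis
    unfolding compact_open_paths_def using assms by (auto intro!: topology_generated_by_Basis)
qed

text \<open>Evaluation is continuous because the interval is locally compact: a closed ball around
  t, cut with the interval, is a compact \<open>K\<close> to which a subbasic open set of paths
  applies.\<close>

lemma continuous_map_compact_open_uncurry:
  assumes \<tau>: "continuous_map L (compact_open_paths X) \<tau>"
  shows "continuous_map (prod_topology L (top_of_set {0..1})) X (\<lambda>z. \<tau> (fst z) (snd z))"
proof -
  let ?I = "top_of_set {0..1::real}"
  have path: "continuous_map ?I X (\<tau> l)" if "l \<in> topspace L" for l
    using continuous_map_image_subset_topspace [OF \<tau>] that
    by (auto simp: topspace_compact_open_paths pathin_def)
  show ?thesis
    unfolding continuous_map_def
  proof (intro conjI allI impI)
    show "(\<lambda>z. \<tau> (fst z) (snd z)) \<in> topspace (prod_topology L ?I) \<rightarrow> topspace X"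
      using continuous_map_funspace [OF path] by (auto simp: Pi_iff)
    fix U assume U: "openin X U"
    show "openin (prod_topology L ?I) {z \<in> topspace (prod_topology L ?I). \<tau> (fst z) (snd z) \<in> U}"
      unfolding openin_prod_topology_alt
    proof (intro allI impI)
      fix l t assume "(l, t) \<in> {z \<in> topspace (prod_topology L ?I). \<tau> (fst z) (snd z) \<in> U}"
      then have lt: "l \<in> topspace L" "t \<in> {0..1}" "\<tau> l t \<in> U"
        by auto
      have "openin ?I {s \<in> topspace ?I. \<tau> l s \<in> U}"
        using path [OF lt(1)] U openin_continuous_map_preimage by blast
      then obtain T where T: "open T" "{s \<in> {0..1}. \<tau> l s \<in> U} = {0..1} \<inter> T"
        by (auto simp: openin_open)
      have "t \<in> T"
        using T lt by auto
      then obtain e where e: "e > 0" "cball t e \<subseteq> T"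
        using T(1) open_contains_cball by blast
      define K where "K = cball t e \<inter> {0..1}"
      have K: "compact K" "K \<subseteq> {0..1}"
        by (auto simp: K_def compact_Int)
      have "\<tau> l ` K \<subseteq> U"
        using e(2) T(2) by (auto simp: K_def)
      let ?V = "{l' \<in> topspace L. \<tau> l' ` K \<subseteq> U}"
      have "openin L {l' \<in> topspace L. \<tau> l' \<in> {\<alpha> \<in> topspace (compact_open_paths X). \<alpha> ` K \<subseteq> U}}"
        using \<tau> openin_compact_open_paths [OF K U] openin_continuous_map_preimage by blast
      moreover have "{l' \<in> topspace L. \<tau> l' \<in> {\<alpha> \<in> topspace (compact_open_paths X). \<alpha> ` K \<subseteq> U}} = ?V"
        using continuous_map_image_subset_topspace [OF \<tau>] by auto
      ultimately have "openin L ?V"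
        by simp
      moreover have "openin ?I ({0..1} \<inter> ball t e)"
        by (simp add: openin_open_Int)
      moreover have "l \<in> ?V" "t \<in> {0..1} \<inter> ball t e"
        using lt e(1) \<open>\<tau> l ` K \<subseteq> U\<close> by auto
      moreover have "?V \<times> ({0..1} \<inter> ball t e) \<subseteq>
          {z \<in> topspace (prod_topology L ?I). \<tau> (fst z) (snd z) \<in> U}"
        using ball_subset_cball [of t e] by (auto simp: K_def)
      ultimately show "\<exists>V W. openin L V \<and> openin ?I W \<and> l \<in> V \<and> t \<in> W \<and>
          V \<times> W \<subseteq> {z \<in> topspace (prod_topology L ?I). \<tau> (fst z) (snd z) \<in> U}"
        by blast
    qed
  qed
qed

text \<open>On subbasic sets this is the tube lemma: the points l whose path leaves \<open>U\<close>
  somewhere on \<open>K\<close> form the projection of a closed set along the compact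
  \<open>K\<close>.\<close>

lemma continuous_map_compact_open_curry:
  assumes h: "continuous_map (prod_topology L (top_of_set {0..1})) X h"
  shows "continuous_map L (compact_open_paths X) (\<lambda>l. \<lambda>t\<in>{0..1}. h (l, t))"
  unfolding compact_open_paths_def
proof (rule continuous_on_generated_topo)
  let ?I = "top_of_set {0..1::real}" and ?\<tau> = "\<lambda>l. \<lambda>t\<in>{0..1::real}. h (l, t)"
  let ?S = "{{\<alpha>. pathin X \<alpha> \<and> \<alpha> \<in> extensional {0..1} \<and> \<alpha> ` K \<subseteq> U} |K U.
          compact K \<and> K \<subseteq> {0..1} \<and> openin X U}"
  have path: "pathin X (?\<tau> l)" if "l \<in> topspace L" for l
  proof -
    have "continuous_map ?I (prod_topology L ?I) (\<lambda>t. (l, t))"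
      using that by (intro continuous_intros) auto
    then have "continuous_map ?I X (h \<circ> (\<lambda>t. (l, t)))"
      using h by (rule continuous_map_compose)
    then show ?thesis
      unfolding pathin_def by (rule continuous_map_eq) auto
  qed
  then have top: "?\<tau> l \<in> topspace (compact_open_paths X)" if "l \<in> topspace L" for l
    using that by (simp add: topspace_compact_open_paths)
  then show "?\<tau> ` topspace L \<subseteq> \<Union> ?S"
    unfolding compact_open_paths_def topology_generated_by_topspace by blast
  fix N assume "N \<in> ?S"
  then obtain K U where N: "N = {\<alpha>. pathin X \<alpha> \<and> \<alpha> \<in> extensional {0..1} \<and> \<alpha> ` K \<subseteq> U}"
      and K: "compact K" "K \<subseteq> {0..1}" and U: "openin X U"
    by blast
  let ?P = "prod_topology L (top_of_set K)"
  have "continuous_map ?P (prod_topology L ?I) id"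
    unfolding continuous_map_pairwise using K(2)
    by (auto simp: continuous_map_in_subtopology continuous_map_snd_of
        intro: continuous_map_into_fulltopology [OF continuous_map_snd] continuous_map_fst)
  then have hP: "continuous_map ?P X (h \<circ> id)"
    using h by (rule continuous_map_compose)
  have "closedin ?P {z \<in> topspace ?P. (h \<circ> id) z \<in> topspace X - U}"
    using U by (intro closedin_continuous_map_preimage [OF hP]) auto
  then have "closedin L (fst ` {z \<in> topspace ?P. (h \<circ> id) z \<in> topspace X - U})"
    using closed_map_fst [of "top_of_set K" L] K(1) unfolding closed_map_def
    by (simp add: compact_space_subtopology)
  then have "openin L (topspace L - fst ` {z \<in> topspace ?P. (h \<circ> id) z \<in> topspace X - U})"
    by blast
  moreover have "topspace L - fst ` {z \<in> topspace ?P. (h \<circ> id) z \<in> topspace X - U} = ?\<tau> -` N \<inter> topspace L"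
  proof (intro equalityI subsetI)
    fix l assume l: "l \<in> topspace L - fst ` {z \<in> topspace ?P. (h \<circ> id) z \<in> topspace X - U}"
    have "h (l, t) \<in> U" if "t \<in> K" for t
    proof -
      have lt: "(l, t) \<in> topspace ?P"
        using l that by simp
      then have "h (l, t) \<in> topspace X"
        using funcset_mem [OF continuous_map_funspace [OF hP]] by simp
      moreover have "(h \<circ> id) (l, t) \<notin> topspace X - U"
      proof
        assume "(h \<circ> id) (l, t) \<in> topspace X - U"
        then have "fst (l, t) \<in> fst ` {z \<in> topspace ?P. (h \<circ> id) z \<in> topspace X - U}"
          using lt by (intro imageI) simp
        then show False
          using l by simp
      qed
      ultimately show ?thesis
        by simp
    qed
    then have "?\<tau> l ` K \<subseteq> U"
      using K(2) by auto
    then show "l \<in> ?\<tau> -` N \<inter> topspace L"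
      using l path by (simp add: N)
  next
    fix l assume "l \<in> ?\<tau> -` N \<inter> topspace L"
    then have l: "l \<in> topspace L" "?\<tau> l ` K \<subseteq> U"
      by (simp_all add: N)
    have "h (l, t) \<in> U" if "t \<in> K" for t
    proof -
      have "?\<tau> l t \<in> U"
        using l(2) that by blast
      then show ?thesis
        using that K(2) by (simp add: subset_iff)
    qed
    then show "l \<in> topspace L - fst ` {z \<in> topspace ?P. (h \<circ> id) z \<in> topspace X - U}"
      using l(1) by auto
  qed
  ultimately show "openin L (?\<tau> -` N \<inter> topspace L)"
    by simp
qed

lemma topspace_path_space:
  "topspace (path_space X x\<^sub>0) = {\<alpha>. pathin X \<alpha> \<and> \<alpha> \<in> extensional {0..1} \<and> \<alpha> 0 = x\<^sub>0}"
  by (auto simp: path_space_def topspace_compact_open_paths)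

lemma continuous_map_path_space_id: "continuous_map (path_space X x\<^sub>0) (compact_open_paths X) id"
  unfolding path_space_def by (rule continuous_map_from_subtopology [OF continuous_map_kification_id])

lemma continuous_map_path_eval:
  assumes "t \<in> {0..1}"
  shows "continuous_map (path_space X x\<^sub>0) X (\<lambda>\<alpha>. \<alpha> t)"
proof -
  have "continuous_map (path_space X x\<^sub>0) (prod_topology (path_space X x\<^sub>0) (top_of_set {0..1})) (\<lambda>\<alpha>. (\<alpha>, t))"
    using assms by (intro continuous_intros) auto
  from continuous_map_compose [OF this continuous_map_compact_open_uncurry [OF continuous_map_path_space_id]]
  show ?thesis
    by (simp add: o_def)
qed

lemma Hausdorff_path_space_image:
  assumes X: "weakly_Hausdorff_space X" and L: "compact_space L" "Hausdorff_space L"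
    and \<tau>: "continuous_map L (path_space X x\<^sub>0) \<tau>"
  shows "Hausdorff_space (subtopology (path_space X x\<^sub>0) (\<tau> ` topspace L))"
proof (rule Hausdorff_compact_image_separating [OF L \<tau> X])
  fix \<alpha> \<beta> assume "\<alpha> \<in> topspace (path_space X x\<^sub>0)" "\<beta> \<in> topspace (path_space X x\<^sub>0)" "\<alpha> \<noteq> \<beta>"
  then obtain t where "t \<in> {0..1}" "\<alpha> t \<noteq> \<beta> t"
    using extensionalityI [of \<alpha> "{0..1}" \<beta>] by (auto simp: topspace_path_space)
  then show "\<exists>h. continuous_map (path_space X x\<^sub>0) X h \<and> h \<alpha> \<noteq> h \<beta>"
    using continuous_map_path_eval [of t X x\<^sub>0] by (intro exI [of _ "\<lambda>\<alpha>. \<alpha> t"]) simp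
qed

lemma continuous_map_into_path_space:
  assumes X: "weakly_Hausdorff_space X" and L: "compact_space L" "Hausdorff_space L"
    and \<tau>: "continuous_map L (compact_open_paths X) \<tau>" and 0: "\<And>l. l \<in> topspace L \<Longrightarrow> \<tau> l 0 = x\<^sub>0"
  shows "continuous_map L (path_space X x\<^sub>0) \<tau>"
proof -
  \<comment> \<open>This is what allows the passage to the k-ified topology of the path space;
    evaluations at times t separate paths.\<close>
  have "Hausdorff_space (subtopology (compact_open_paths X) (\<tau> ` topspace L))"
  proof (rule Hausdorff_compact_image_separating [OF L \<tau> X])
    let ?CO = "compact_open_paths X"
    fix \<alpha> \<beta> assume "\<alpha> \<in> topspace ?CO" "\<beta> \<in> topspace ?CO" "\<alpha> \<noteq> \<beta>"
    then obtain t where t: "t \<in> {0..1}" "\<alpha> t \<noteq> \<beta> t"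
      using extensionalityI [of \<alpha> "{0..1}" \<beta>] by (auto simp: topspace_compact_open_paths)
    have "continuous_map ?CO (prod_topology ?CO (top_of_set {0..1})) (\<lambda>\<alpha>. (\<alpha>, t))"
      using t by (intro continuous_intros) auto
    from continuous_map_compose [OF this continuous_map_compact_open_uncurry [OF continuous_map_id]]
    have "continuous_map ?CO X (\<lambda>\<alpha>. \<alpha> t)"
      by (simp add: o_def)
    then show "\<exists>h. continuous_map ?CO X h \<and> h \<alpha> \<noteq> h \<beta>"
      using t(2) by (intro exI [of _ "\<lambda>\<alpha>. \<alpha> t"]) simp
  qed
  then have "continuous_map L (kification (compact_open_paths X)) \<tau>"
    by (rule continuous_map_into_kification [OF L(1) \<tau>])
  then show ?thesis
    using 0 by (auto simp: path_space_def continuous_map_in_subtopology)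
qed

section \<open>The diagonal action on paths and loops\<close>

context algebra_over_operad
begin

text \<open>Each representative of the orbit gives the same value at every time, by
  \<open>diagonal_action_orbit\<close> in \<open>X\<close>; so the action on paths is read off from
  that on \<open>X\<close>.\<close>

lemma diagonal_action_pointwise:
  assumes o': "o' \<in> topspace (BSym C k)" and \<alpha>: "\<alpha> \<in> topspace (path_space X pt)"
  shows "diagonal_action (pointwise_action \<theta>) k (o', \<alpha>) = (\<lambda>t\<in>{0..1}. diagonal_action \<theta> k (o', \<alpha> t))"
proof -
  obtain c where c: "c \<in> topspace (op_space C k)" "o' = orbit_of k (op_act C k) c"
    using o' by (auto simp: topspace_orbit_space)
  have act: "right_action k (op_space C k) (op_act C k)"
    by (rule right_action_op_act)
  have \<alpha>X: "\<alpha> t \<in> topspace X" if "t \<in> {0..1}" for t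
    using continuous_map_funspace [OF continuous_map_path_eval [OF that]] \<alpha> by (rule funcset_mem)
  have "pointwise_action \<theta> k c' (\<lambda>i\<in>{..<k}. \<alpha>) = (\<lambda>t\<in>{0..1}. diagonal_action \<theta> k (o', \<alpha> t))"
    if c'o: "c' \<in> o'" for c'
    unfolding pointwise_action_def
  proof (rule restrict_ext)
    fix t :: real assume t: "t \<in> {0..1}"
    obtain \<sigma> where "\<sigma> \<in> Sym k" "c' = op_act C k c \<sigma>"
      using c'o c by (auto simp: orbit_of_def)
    then have c': "c' \<in> topspace (op_space C k)" "o' = orbit_of k (op_act C k) c'"
      using act_in_topspace [OF act c(1)] orbit_of_act [OF act c(1)] c(2) by simp_all
    have "(\<lambda>i\<in>{..<k}. (\<lambda>i\<in>{..<k}. \<alpha>) i t) = (\<lambda>i\<in>{..<k}. \<alpha> t)"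
      by (rule restrict_ext) simp
    then show "\<theta> k c' (\<lambda>i\<in>{..<k}. (\<lambda>i\<in>{..<k}. \<alpha>) i t) = diagonal_action \<theta> k (o', \<alpha> t)"
      using diagonal_action_orbit [OF c'(1) \<alpha>X [OF t]] c'(2) by simp
  qed
  moreover have "c \<in> o'"
    using orbit_of_self [OF act c(1)] c(2) by simp
  ultimately have "(\<lambda>c. pointwise_action \<theta> k c (\<lambda>i\<in>{..<k}. \<alpha>)) ` o' =
      {\<lambda>t\<in>{0..1}. diagonal_action \<theta> k (o', \<alpha> t)}"
    by (intro equalityI subsetI) (auto simp: image_iff)
  then show ?thesis
    by (simp add: diagonal_action_def)
qed

text \<open>By adjunction the claim concerns a map on \<open>L\<close> times the interval, which is
  again compact Hausdorff, so \<open>continuous_map_diagonal_action\<close> applies there. The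
  result consists of based paths since the base point is fixed by the action.\<close>

lemma continuous_map_diagonal_action_paths:
  assumes L: "compact_space L" "Hausdorff_space L"
    and \<sigma>: "continuous_map L (BSym C k) \<sigma>" and \<tau>: "continuous_map L (path_space X pt) \<tau>"
  shows "continuous_map L (path_space X pt) (\<lambda>l. diagonal_action (pointwise_action \<theta>) k (\<sigma> l, \<tau> l))"
proof -
  let ?I = "top_of_set {0..1::real}"
  let ?f = "\<lambda>l. \<lambda>t\<in>{0..1}. diagonal_action \<theta> k (\<sigma> l, \<tau> l t)"
  have \<tau>': "\<tau> l \<in> topspace (path_space X pt)" and \<sigma>': "\<sigma> l \<in> topspace (BSym C k)" if "l \<in> topspace L" for l
    using funcset_mem [OF continuous_map_funspace [OF \<tau>] that]
      funcset_mem [OF continuous_map_funspace [OF \<sigma>] that] .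
  have P: "compact_space (prod_topology L ?I)" "Hausdorff_space (prod_topology L ?I)"
    using L by (auto simp: compact_space_prod_topology Hausdorff_space_prod_topology
        compact_space_subtopology Hausdorff_space_subtopology)
  have "continuous_map L (compact_open_paths X) (id \<circ> \<tau>)"
    using \<tau> continuous_map_path_space_id by (rule continuous_map_compose)
  then have "continuous_map (prod_topology L ?I) X (\<lambda>z. \<tau> (fst z) (snd z))"
    using continuous_map_compact_open_uncurry by (simp add: o_def)
  moreover have "continuous_map (prod_topology L ?I) (BSym C k) (\<lambda>z. \<sigma> (fst z))"
    using continuous_map_compose [OF continuous_map_fst \<sigma>] by (simp add: o_def)
  ultimately have "continuous_map (prod_topology L ?I) X
      (\<lambda>z. diagonal_action \<theta> k (\<sigma> (fst z), \<tau> (fst z) (snd z)))"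
    by (intro continuous_map_diagonal_action [OF P])
  from continuous_map_compact_open_curry [OF this]
  have "continuous_map L (compact_open_paths X) ?f"
    by simp
  then have "continuous_map L (path_space X pt) ?f"
  proof (rule continuous_map_into_path_space [OF weakly_Hausdorff_X L])
    fix l assume l: "l \<in> topspace L"
    then show "?f l 0 = pt"
      using \<tau>' [OF l] diagonal_action_pt [OF \<sigma>' [OF l]] by (simp add: topspace_path_space)
  qed
  then show ?thesis
    by (rule continuous_map_eq) (use \<tau>' \<sigma>' in \<open>simp add: diagonal_action_pointwise\<close>)
qed

text \<open>A compact Hausdorff subspace of the product serves as the test space \<open>L\<close>,
  with the two projections as its maps; the versions for paths and loops below work in the same
  way.\<close>

lemma continuous_map_diagonal_action_k_prod:
  "continuous_map (k_prod (BSym C k) X) X (diagonal_action \<theta> k)"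
proof (rule continuous_map_from_kification)
  fix K let ?K = "subtopology (prod_topology (BSym C k) X) K"
  assume K: "compactin (prod_topology (BSym C k) X) K" "Hausdorff_space ?K"
  then have "continuous_map ?K X (\<lambda>z. diagonal_action \<theta> k (fst z, snd z))"
    by (intro continuous_map_diagonal_action continuous_map_from_subtopology continuous_map_fst
        continuous_map_snd) (simp_all add: compact_space_subtopology)
  then show "continuous_map ?K X (diagonal_action \<theta> k)"
    by simp
qed

lemma continuous_map_diagonal_action_k_prod_paths:
  "continuous_map (k_prod (BSym C k) (path_space X pt)) (path_space X pt)
    (diagonal_action (pointwise_action \<theta>) k)"
proof (rule continuous_map_from_kification)
  fix K let ?K = "subtopology (prod_topology (BSym C k) (path_space X pt)) K"
  assume K: "compactin (prod_topology (BSym C k) (path_space X pt)) K" "Hausdorff_space ?K"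
  then have "continuous_map ?K (path_space X pt)
      (\<lambda>z. diagonal_action (pointwise_action \<theta>) k (fst z, snd z))"
    by (intro continuous_map_diagonal_action_paths continuous_map_from_subtopology continuous_map_fst
        continuous_map_snd) (simp_all add: compact_space_subtopology)
  then show "continuous_map ?K (path_space X pt) (diagonal_action (pointwise_action \<theta>) k)"
    by simp
qed

lemma diagonal_action_loops:
  assumes o': "o' \<in> topspace (BSym C k)" and \<alpha>: "\<alpha> \<in> loops X pt"
  shows "diagonal_action (pointwise_action \<theta>) k (o', \<alpha>) \<in> loops X pt"
proof -
  have \<alpha>': "\<alpha> \<in> topspace (path_space X pt)" "\<alpha> 1 = pt"
    using \<alpha> by (auto simp: loops_def)
  have "diagonal_action (pointwise_action \<theta>) k (o', \<alpha>) \<in> topspace (path_space X pt)"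
    using o' \<alpha>' by (intro funcset_mem [OF continuous_map_funspace
          [OF continuous_map_diagonal_action_k_prod_paths]]) simp
  then show ?thesis
    using diagonal_action_pt [OF o'] \<alpha>'
    by (simp add: loops_def diagonal_action_pointwise [OF o'])
qed

lemma continuous_map_diagonal_action_k_prod_loops:
  "continuous_map (k_prod (BSym C k) (loop_space X pt)) (loop_space X pt)
    (diagonal_action (pointwise_action \<theta>) k)"
proof (rule continuous_map_from_kification)
  fix K let ?K = "subtopology (prod_topology (BSym C k) (loop_space X pt)) K"
  assume K: "compactin (prod_topology (BSym C k) (loop_space X pt)) K" "Hausdorff_space ?K"
  have f: "continuous_map ?K (BSym C k) fst"
    by (intro continuous_map_from_subtopology continuous_map_fst)
  have s: "continuous_map ?K (loop_space X pt) snd"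
    by (intro continuous_map_from_subtopology continuous_map_snd)
  then have s': "continuous_map ?K (path_space X pt) snd"
    unfolding loop_space_def by (rule continuous_map_into_fulltopology)
  have "continuous_map ?K (path_space X pt)
      (\<lambda>z. diagonal_action (pointwise_action \<theta>) k (fst z, snd z))"
    using K f s' by (intro continuous_map_diagonal_action_paths) (simp_all add: compact_space_subtopology)
  moreover have "diagonal_action (pointwise_action \<theta>) k z \<in> loops X pt" if z: "z \<in> topspace ?K" for z
  proof -
    have "snd z \<in> topspace (loop_space X pt)" "fst z \<in> topspace (BSym C k)"
      using z by auto
    then have "diagonal_action (pointwise_action \<theta>) k (fst z, snd z) \<in> loops X pt"
      by (intro diagonal_action_loops) (simp_all add: loop_space_def)
    then show ?thesis
      by simp
  qed
  ultimately show "continuous_map ?K (loop_space X pt) (diagonal_action (pointwise_action \<theta>) k)"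
    by (simp add: loop_space_def continuous_map_in_subtopology image_subset_iff Pi_iff)
qed

end

section \<open>The boundary of a sum of shuffles\<close>

definition del_at :: "nat \<Rightarrow> 'v list \<Rightarrow> 'v list" where
  "del_at i u = take i u @ drop (Suc i) u"

text \<open>The simplicial boundary of ordered vertex lists, in augmented form: the face of a
  one-vertex list is \<open>[]\<close>, so that the cone formula below holds in every
  length.\<close>

definition face_sum :: "('v list \<Rightarrow>\<^sub>0 int) \<Rightarrow> 'v list \<Rightarrow>\<^sub>0 int" where
  "face_sum = frag_extend (\<lambda>u. \<Sum>i<length u. frag_cmul ((-1) ^ i) (frag_of (del_at i u)))"

text \<open>The cone with apex \<open>v\<close>, placed last in the vertex order.\<close>

definition snoc_chain :: "'v \<Rightarrow> ('v list \<Rightarrow>\<^sub>0 int) \<Rightarrow> 'v list \<Rightarrow>\<^sub>0 int" where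
  "snoc_chain v = frag_extend (\<lambda>u. frag_of (u @ [v]))"

definition map_chain :: "('v \<Rightarrow> 'w) \<Rightarrow> ('v list \<Rightarrow>\<^sub>0 int) \<Rightarrow> 'w list \<Rightarrow>\<^sub>0 int" where
  "map_chain h = frag_extend (\<lambda>u. frag_of (map h u))"

lemma frag_cmul_diff_right: "frag_cmul c (a - b) = frag_cmul c a - frag_cmul c b"
  by (metis add_diff_cancel diff_add_cancel frag_cmul_distrib2)

lemma frag_cmul_minus_right: "frag_cmul c (- a) = - frag_cmul c a"
  using frag_cmul_diff_right [of c 0 a] by simp

lemma frag_extend_lin:
  "frag_extend b (x + y) = frag_extend b x + frag_extend b y"
  "frag_extend b (frag_cmul c x) = frag_cmul c (frag_extend b x)"
  "frag_extend b (- x) = - frag_extend b x"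
  "frag_extend b (x - y) = frag_extend b x - frag_extend b y"
  by (simp_all add: frag_extend_add frag_extend_cmul frag_extend_minus frag_extend_diff)

lemma frag_extend_sum': "frag_extend b (\<Sum>i\<in>I. x i) = (\<Sum>i\<in>I. frag_extend b (x i))"
  by (induction I rule: infinite_finite_induct) (auto simp: frag_extend_add)

text \<open>Deleting a vertex other than the apex gives the cone over a face; deleting the apex,
  which sits at position \<open>N\<close>, gives back the base with sign (-1)^N. The fixed length
  makes this sign uniform.\<close>

lemma face_sum_snoc_chain:
  assumes "Poly_Mapping.keys c \<subseteq> {u. length u = N}"
  shows "face_sum (snoc_chain v c) = snoc_chain v (face_sum c) + frag_cmul ((-1) ^ N) c"
  using assms
proof (induction rule: frag_induction)
  case (one u)
  have "(\<Sum>i<N. frag_cmul ((-1) ^ i) (frag_of (del_at i (u @ [v])))) =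
      (\<Sum>i<N. frag_cmul ((-1) ^ i) (frag_of (del_at i u @ [v])))"
    using one by (intro sum.cong) (auto simp: del_at_def)
  moreover have "del_at N (u @ [v]) = u"
    using one by (simp add: del_at_def)
  ultimately show ?case
    using one by (simp add: face_sum_def snoc_chain_def frag_extend_sum' frag_extend_cmul)
next
  case (diff a b)
  then show ?case
    by (simp add: face_sum_def snoc_chain_def frag_extend_lin frag_cmul_diff_right)
qed (simp add: face_sum_def snoc_chain_def)

section \<open>Shuffles as chains of lattice paths\<close>

definition skip :: "nat \<Rightarrow> nat \<Rightarrow> nat" where
  "skip j a = (if a < j then a else Suc a)"

definition lattice_path :: "nat \<Rightarrow> nat set \<Rightarrow> (nat \<times> nat) list" where
  "lattice_path N \<mu> = map (\<lambda>i. (card (\<mu> \<inter> {..<i}), card ({..<i} - \<mu>))) [0..<Suc N]"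

text \<open>Both indices are shifted by one, so that the recursion over the last step of a lattice path
  needs no case distinction at the two axes.\<close>

fun shuffle_chain :: "nat \<Rightarrow> nat \<Rightarrow> (nat \<times> nat) list \<Rightarrow>\<^sub>0 int" where
  "shuffle_chain (Suc m) (Suc n) =
     (\<Sum>\<mu>\<in>shuffles_of m n. frag_cmul (shuffle_sign (m + n) \<mu>) (frag_of (lattice_path (m + n) \<mu>)))"
| "shuffle_chain _ _ = 0"

lemma finite_shuffles_of: "finite (shuffles_of m n)"
  by (rule finite_subset [of _ "Pow {..<m + n}"]) (auto simp: shuffles_of_def)

lemma shuffle_chain_0 [simp]: "shuffle_chain 0 n = 0" "shuffle_chain m 0 = 0"
  by (cases n; cases m; simp)+

lemma lattice_path_snoc: "lattice_path (Suc N) \<mu> =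
    lattice_path N \<mu> @ [(card (\<mu> \<inter> {..<Suc N}), card ({..<Suc N} - \<mu>))]"
  by (simp add: lattice_path_def)

lemma lattice_path_insert: "lattice_path N (insert N \<mu>) = lattice_path N \<mu>"
proof -
  have "insert N \<mu> \<inter> {..<i} = \<mu> \<inter> {..<i}" "{..<i} - insert N \<mu> = {..<i} - \<mu>" if "i \<le> N" for i
    using that by auto
  then show ?thesis
    by (simp add: lattice_path_def)
qed

lemma shuffle_sign_Suc:
  assumes "\<mu> \<subseteq> {..<N}"
  shows "shuffle_sign (Suc N) \<mu> = shuffle_sign N \<mu>"
proof -
  have "{(i, j). i \<in> \<mu> \<and> j \<in> {..<Suc N} - \<mu> \<and> j < i} = {(i, j). i \<in> \<mu> \<and> j \<in> {..<N} - \<mu> \<and> j < i}"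
    using assms by auto
  then show ?thesis
    by (simp add: shuffle_sign_def)
qed

text \<open>The new last step goes in the first direction and is preceded by all
  \<open>N - card \<mu>\<close> steps in the second direction, each contributing one
  inversion.\<close>

lemma shuffle_sign_insert:
  assumes "\<mu> \<subseteq> {..<N}"
  shows "shuffle_sign (Suc N) (insert N \<mu>) = (-1) ^ (N - card \<mu>) * shuffle_sign N \<mu>"
proof -
  let ?A = "{(i, j). i \<in> \<mu> \<and> j \<in> {..<N} - \<mu> \<and> j < i}" and ?B = "{N} \<times> ({..<N} - \<mu>)"
  have "{(i, j). i \<in> insert N \<mu> \<and> j \<in> {..<Suc N} - insert N \<mu> \<and> j < i} = ?A \<union> ?B"
    using assms by auto
  moreover have "finite ?A"
    by (rule finite_subset [of _ "{..<N} \<times> {..<N}"]) (use assms in auto)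
  moreover have "?A \<inter> ?B = {}"
    using assms by auto
  moreover have "card ?B = N - card \<mu>"
    using assms by (simp add: card_cartesian_product card_Diff_subset finite_subset)
  ultimately show ?thesis
    by (simp add: shuffle_sign_def card_Un_disjoint power_add)
qed

text \<open>Shuffles are split by their last step. A step in the first direction arrives from (m -
  1, n) and jumps over n earlier steps in the second direction, hence the sign; a step in the second
  direction adds no inversion. Only (0, 0) has no last step.\<close>

lemma shuffle_chain_rec:
  assumes "(m, n) \<noteq> (0, 0)"
  shows "shuffle_chain (Suc m) (Suc n) =
    snoc_chain (m, n) (frag_cmul ((-1) ^ n) (shuffle_chain m (Suc n)) + shuffle_chain (Suc m) n)"
proof -
  obtain N where N: "m + n = Suc N"
    using assms by (cases "m + n") auto
  let ?F = "\<lambda>\<mu>. frag_cmul (shuffle_sign (m + n) \<mu>) (frag_of (lattice_path (m + n) \<mu>))"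
  let ?A = "{\<mu> \<in> shuffles_of m n. N \<in> \<mu>}" and ?B = "{\<mu> \<in> shuffles_of m n. N \<notin> \<mu>}"
  have split: "shuffles_of m n = ?A \<union> ?B" "?A \<inter> ?B = {}"
    by auto
  have "(\<Sum>\<mu>\<in>?A. ?F \<mu>) = snoc_chain (m, n) (frag_cmul ((-1) ^ n) (shuffle_chain m (Suc n)))"
  proof (cases m)
    case 0
    then have A: "?A = {}"
      by (auto simp: shuffles_of_def dest: finite_subset)
    show ?thesis
      unfolding A by (simp add: 0 snoc_chain_def)
  next
    case (Suc m')
    have A: "?A = insert N ` shuffles_of m' n"
    proof (intro equalityI subsetI)
      fix \<mu> assume \<mu>: "\<mu> \<in> ?A"
      then have "finite \<mu>"
        by (auto simp: shuffles_of_def intro: finite_subset)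
      then have "\<mu> - {N} \<in> shuffles_of m' n"
        using \<mu> N Suc by (auto simp: shuffles_of_def)
      moreover have "\<mu> = insert N (\<mu> - {N})"
        using \<mu> by auto
      ultimately show "\<mu> \<in> insert N ` shuffles_of m' n"
        by blast
    next
      fix \<mu> assume "\<mu> \<in> insert N ` shuffles_of m' n"
      then obtain \<nu> where \<nu>: "\<nu> \<subseteq> {..<N}" "card \<nu> = m'" "\<mu> = insert N \<nu>"
        using N Suc by (auto simp: shuffles_of_def)
      then have "finite \<nu>" "N \<notin> \<nu>"
        by (auto intro: finite_subset)
      then show "\<mu> \<in> ?A"
        using \<nu> N Suc by (auto simp: shuffles_of_def)
    qed
    have inj: "inj_on (insert N) (shuffles_of m' n)"
    proof (rule inj_onI)
      fix \<mu> \<nu> assume "\<mu> \<in> shuffles_of m' n" "\<nu> \<in> shuffles_of m' n" "insert N \<mu> = insert N \<nu>"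
      moreover from this have "N \<notin> \<mu>" "N \<notin> \<nu>"
        using N Suc by (auto simp: shuffles_of_def)
      ultimately show "\<mu> = \<nu>"
        by (simp add: insert_ident)
    qed
    have "?F (insert N \<nu>) = snoc_chain (m, n) (frag_cmul ((-1) ^ n)
        (frag_cmul (shuffle_sign (m' + n) \<nu>) (frag_of (lattice_path (m' + n) \<nu>))))"
      if "\<nu> \<in> shuffles_of m' n" for \<nu>
    proof -
      have \<nu>: "\<nu> \<subseteq> {..<N}" "card \<nu> = m'" "finite \<nu>" "N \<notin> \<nu>" and N': "m' + n = N"
        using that N Suc by (auto simp: shuffles_of_def intro: finite_subset)
      have "insert N \<nu> \<inter> {..<Suc N} = insert N \<nu>" "{..<Suc N} - insert N \<nu> = {..<N} - \<nu>"
        using \<nu> by auto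
      then have "lattice_path (Suc N) (insert N \<nu>) = lattice_path N \<nu> @ [(m, n)]"
        using \<nu> N' Suc by (simp add: lattice_path_snoc lattice_path_insert card_Diff_subset)
      moreover have "N - card \<nu> = n"
        using \<nu> N' by auto
      ultimately show ?thesis
        using \<nu> by (simp add: N N' shuffle_sign_insert snoc_chain_def frag_extend_cmul)
    qed
    then show ?thesis
      unfolding A sum.reindex [OF inj]
      by (simp add: Suc snoc_chain_def frag_extend_sum' frag_cmul_sum
          frag_extend_cmul o_def)
  qed
  moreover have "(\<Sum>\<mu>\<in>?B. ?F \<mu>) = snoc_chain (m, n) (shuffle_chain (Suc m) n)"
  proof (cases n)
    case 0
    \<comment> \<open>When n is 0, every step goes in the first direction, in particular the last
      step \<open>N\<close>.\<close>
    have "\<not> (\<mu> \<subseteq> {..<m} \<and> card \<mu> = m \<and> N \<notin> \<mu>)" for \<mu>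
      using card_subset_eq [of "{..<m}" \<mu>] N 0 by auto
    then have B: "?B = {}"
      using 0 by (auto simp: shuffles_of_def)
    show ?thesis
      unfolding B by (simp add: 0 snoc_chain_def)
  next
    case (Suc n')
    have less: "{..<Suc N} = insert N {..<N}"
      by auto
    have B: "?B = shuffles_of m n'"
      using N Suc by (auto simp: shuffles_of_def less)
    have "?F \<nu> = snoc_chain (m, n)
        (frag_cmul (shuffle_sign (m + n') \<nu>) (frag_of (lattice_path (m + n') \<nu>)))"
      if "\<nu> \<in> shuffles_of m n'" for \<nu>
    proof -
      have \<nu>: "\<nu> \<subseteq> {..<N}" "card \<nu> = m" "finite \<nu>" and N': "m + n' = N"
        using that N Suc by (auto simp: shuffles_of_def intro: finite_subset)
      have "\<nu> \<subseteq> {..<Suc N}"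
        using \<nu> by (auto simp: less)
      then have "\<nu> \<inter> {..<Suc N} = \<nu>" "card ({..<Suc N} - \<nu>) = n"
        using \<nu> N' Suc by (auto simp: card_Diff_subset)
      then have "lattice_path (Suc N) \<nu> = lattice_path N \<nu> @ [(m, n)]"
        using \<nu> by (simp add: lattice_path_snoc)
      then show ?thesis
        using \<nu> by (simp add: N N' shuffle_sign_Suc snoc_chain_def frag_extend_cmul)
    qed
    then show ?thesis
      by (simp only: B) (simp add: Suc snoc_chain_def frag_extend_sum')
  qed
  ultimately have "(\<Sum>\<mu>\<in>?A \<union> ?B. ?F \<mu>) = snoc_chain (m, n)
      (frag_cmul ((-1) ^ n) (shuffle_chain m (Suc n))) + snoc_chain (m, n) (shuffle_chain (Suc m) n)"
    using split(2) finite_shuffles_of [of m n] by (subst sum.union_disjoint) auto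
  then show ?thesis
    using split(1) by (simp add: snoc_chain_def frag_extend_add)
qed

text \<open>In the shifted indices a path has (m - 1) + (n - 1) steps, hence m + n - 1
  vertices.\<close>

lemma shuffle_chain_keys:
  assumes "u \<in> Poly_Mapping.keys (shuffle_chain m n)"
  shows "length u = m + n - 1" "set u \<subseteq> {..<m} \<times> {..<n}"
proof -
  obtain m' n' where mn: "m = Suc m'" "n = Suc n'"
    using assms by (cases m; cases n) auto
  have "Poly_Mapping.keys (shuffle_chain m n) \<subseteq> (\<Union>\<mu>\<in>shuffles_of m' n'.
      Poly_Mapping.keys (frag_cmul (shuffle_sign (m' + n') \<mu>) (frag_of (lattice_path (m' + n') \<mu>))))"
    unfolding mn shuffle_chain.simps by (rule keys_sum)
  then obtain \<mu> where \<mu>': "\<mu> \<in> shuffles_of m' n'"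
      "u \<in> Poly_Mapping.keys (frag_cmul (shuffle_sign (m' + n') \<mu>) (frag_of (lattice_path (m' + n') \<mu>)))"
    using assms by blast
  then have "u \<in> Poly_Mapping.keys (frag_of (lattice_path (m' + n') \<mu>))"
    using keys_cmul by blast
  then have \<mu>: "\<mu> \<subseteq> {..<m' + n'}" "card \<mu> = m'" "u = lattice_path (m' + n') \<mu>"
    using \<mu>'(1) by (simp_all add: shuffles_of_def)
  then show "length u = m + n - 1"
    by (simp add: lattice_path_def mn)
  have "finite \<mu>"
    using \<mu>(1) finite_subset by blast
  have "card (\<mu> \<inter> {..<i}) < m" "card ({..<i} - \<mu>) < n" if "i < Suc (m' + n')" for i
  proof -
    have "card (\<mu> \<inter> {..<i}) \<le> card \<mu>"
      using \<open>finite \<mu>\<close> by (intro card_mono) auto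
    then show "card (\<mu> \<inter> {..<i}) < m"
      using \<mu> mn by simp
    have "card ({..<i} - \<mu>) \<le> card ({..<m' + n'} - \<mu>)"
      using that by (intro card_mono) auto
    also have "\<dots> = n'"
      using \<mu> \<open>finite \<mu>\<close> by (simp add: card_Diff_subset)
    finally show "card ({..<i} - \<mu>) < n"
      using mn by simp
  qed
  then show "set u \<subseteq> {..<m} \<times> {..<n}"
    unfolding \<mu>(3) lattice_path_def by auto
qed

declare shuffle_chain.simps [simp del]

lemma map_chain_lin:
  "map_chain h (a + b) = map_chain h a + map_chain h b"
  "map_chain h (frag_cmul c a) = frag_cmul c (map_chain h a)"
  "map_chain h 0 = 0"
  by (simp_all add: map_chain_def frag_extend_lin)

lemma snoc_chain_lin:
  "snoc_chain v (a + b) = snoc_chain v a + snoc_chain v b"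
  "snoc_chain v (frag_cmul c a) = frag_cmul c (snoc_chain v a)"
  "snoc_chain v 0 = 0"
  "snoc_chain v (- a) = - snoc_chain v a"
  "snoc_chain v (a - b) = snoc_chain v a - snoc_chain v b"
  "snoc_chain v (\<Sum>i\<in>I. x i) = (\<Sum>i\<in>I. snoc_chain v (x i))"
  by (simp_all add: snoc_chain_def frag_extend_lin frag_extend_sum')

lemma face_sum_lin:
  "face_sum (a + b) = face_sum a + face_sum b"
  "face_sum (frag_cmul c a) = frag_cmul c (face_sum a)"
  "face_sum 0 = 0"
  by (simp_all add: face_sum_def frag_extend_lin)

lemma map_chain_snoc_chain: "map_chain h (snoc_chain v c) = snoc_chain (h v) (map_chain h c)"
proof -
  have "Poly_Mapping.keys c \<subseteq> UNIV"
    by simp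
  then show ?thesis
    by (induction rule: frag_induction) (simp_all add: map_chain_def snoc_chain_def frag_extend_lin)
qed

lemma map_chain_ident:
  assumes "\<And>u v. \<lbrakk>u \<in> Poly_Mapping.keys c; v \<in> set u\<rbrakk> \<Longrightarrow> h v = v"
  shows "map_chain h c = c"
proof -
  have "map_chain h c = frag_extend frag_of c"
    unfolding map_chain_def by (intro frag_extend_eq) (use assms in \<open>simp add: map_idI\<close>)
  then show ?thesis
    by (simp flip: frag_expansion)
qed

definition skip_fst :: "nat \<Rightarrow> nat \<times> nat \<Rightarrow> nat \<times> nat" where
  "skip_fst j = map_prod (skip j) id"

definition skip_snd :: "nat \<Rightarrow> nat \<times> nat \<Rightarrow> nat \<times> nat" where
  "skip_snd j = map_prod id (skip j)"

text \<open>The vertices of these paths have coordinates below m and n, where the last coface is the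
  identity. The resulting terms are those that cancel in the induction for the boundary.\<close>

lemma map_chain_skip_last:
  "map_chain (skip_fst m) (shuffle_chain m n) = shuffle_chain m n"
  "map_chain (skip_snd n) (shuffle_chain m n) = shuffle_chain m n"
  using shuffle_chain_keys(2)
  by (auto intro!: map_chain_ident simp: skip_fst_def skip_snd_def skip_def) fastforce+

lemma shuffle_chain_1 [simp]: "shuffle_chain (Suc 0) (Suc 0) = frag_of [(0, 0)]"
proof -
  have "shuffles_of 0 0 = {{}}"
    by (auto simp: shuffles_of_def)
  then show ?thesis
    by (simp add: shuffle_chain.simps shuffle_sign_def lattice_path_def)
qed

text \<open>The Leibniz expression for the product of the universal simplices of dimensions m and n.
  The value 0 of \<open>shuffle_chain\<close> at index 0 makes the boundary of a point
  vanish.\<close>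

definition shuffle_boundary :: "nat \<Rightarrow> nat \<Rightarrow> (nat \<times> nat) list \<Rightarrow>\<^sub>0 int" where
  "shuffle_boundary m n =
     (\<Sum>j\<le>m. frag_cmul ((-1) ^ j) (map_chain (skip_fst j) (shuffle_chain m (Suc n)))) +
     frag_cmul ((-1) ^ m)
       (\<Sum>j\<le>n. frag_cmul ((-1) ^ j) (map_chain (skip_snd j) (shuffle_chain (Suc m) n)))"

text \<open>Cofaces act on the cone decomposition vertex by vertex; the bound on j means that the
  relevant coordinate of the apex is moved up by one.\<close>

lemma map_chain_skip_snoc:
  assumes "(m, n) \<noteq> (0, 0)"
  shows "j \<le> m \<Longrightarrow> map_chain (skip_fst j) (shuffle_chain (Suc m) (Suc n)) = snoc_chain (Suc m, n)
      (frag_cmul ((-1) ^ n) (map_chain (skip_fst j) (shuffle_chain m (Suc n))) +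
       map_chain (skip_fst j) (shuffle_chain (Suc m) n))"
    and "j \<le> n \<Longrightarrow> map_chain (skip_snd j) (shuffle_chain (Suc m) (Suc n)) = snoc_chain (m, Suc n)
      (frag_cmul ((-1) ^ n) (map_chain (skip_snd j) (shuffle_chain m (Suc n))) +
       map_chain (skip_snd j) (shuffle_chain (Suc m) n))"
  unfolding shuffle_chain_rec [OF assms] map_chain_snoc_chain map_chain_lin
  by (simp_all add: skip_fst_def skip_snd_def skip_def)

text \<open>The coface with the largest index acts as the identity and gives the separate last term;
  all others commute with the cone decomposition. The companion lemma treats the second
  direction.\<close>

lemma sum_skip_fst:
  assumes "(m, n) \<noteq> (0, 0)"
  shows "(\<Sum>j\<le>Suc m. frag_cmul ((-1) ^ j) (map_chain (skip_fst j) (shuffle_chain (Suc m) (Suc n)))) =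
    snoc_chain (Suc m, n)
      (frag_cmul ((-1) ^ n) (\<Sum>j\<le>m. frag_cmul ((-1) ^ j) (map_chain (skip_fst j) (shuffle_chain m (Suc n)))) +
       (\<Sum>j\<le>m. frag_cmul ((-1) ^ j) (map_chain (skip_fst j) (shuffle_chain (Suc m) n)))) +
    frag_cmul ((-1) ^ Suc m) (shuffle_chain (Suc m) (Suc n))"
proof -
  have "(\<Sum>j\<le>m. frag_cmul ((-1) ^ j) (map_chain (skip_fst j) (shuffle_chain (Suc m) (Suc n)))) =
      (\<Sum>j\<le>m. frag_cmul ((-1) ^ j) (snoc_chain (Suc m, n)
        (frag_cmul ((-1) ^ n) (map_chain (skip_fst j) (shuffle_chain m (Suc n))) +
         map_chain (skip_fst j) (shuffle_chain (Suc m) n))))"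
    by (intro sum.cong refl arg_cong [where f = "frag_cmul _"] map_chain_skip_snoc(1) [OF assms]) simp
  then show ?thesis
    unfolding sum.atMost_Suc map_chain_skip_last
    by (simp add: snoc_chain_lin frag_cmul_distrib2 sum.distrib frag_cmul_sum mult.commute)
qed

lemma sum_skip_snd:
  assumes "(m, n) \<noteq> (0, 0)"
  shows "(\<Sum>j\<le>Suc n. frag_cmul ((-1) ^ j) (map_chain (skip_snd j) (shuffle_chain (Suc m) (Suc n)))) =
    snoc_chain (m, Suc n)
      (frag_cmul ((-1) ^ n) (\<Sum>j\<le>n. frag_cmul ((-1) ^ j) (map_chain (skip_snd j) (shuffle_chain m (Suc n)))) +
       (\<Sum>j\<le>n. frag_cmul ((-1) ^ j) (map_chain (skip_snd j) (shuffle_chain (Suc m) n)))) +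
    frag_cmul ((-1) ^ Suc n) (shuffle_chain (Suc m) (Suc n))"
proof -
  have "(\<Sum>j\<le>n. frag_cmul ((-1) ^ j) (map_chain (skip_snd j) (shuffle_chain (Suc m) (Suc n)))) =
      (\<Sum>j\<le>n. frag_cmul ((-1) ^ j) (snoc_chain (m, Suc n)
        (frag_cmul ((-1) ^ n) (map_chain (skip_snd j) (shuffle_chain m (Suc n))) +
         map_chain (skip_snd j) (shuffle_chain (Suc m) n))))"
    by (intro sum.cong refl arg_cong [where f = "frag_cmul _"] map_chain_skip_snoc(2) [OF assms]) simp
  then show ?thesis
    unfolding sum.atMost_Suc map_chain_skip_last
    by (simp add: snoc_chain_lin frag_cmul_distrib2 sum.distrib frag_cmul_sum mult.commute)
qed

text \<open>Induction on the number of steps: the chain is a cone with apex (m, n), so the cone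
  formula reduces its faces to those of the two shorter shuffle chains. The term
  \<open>frag_of []\<close> is the augmentation of a single vertex.\<close>

lemma face_sum_shuffle_chain:
  "face_sum (shuffle_chain (Suc m) (Suc n)) =
    shuffle_boundary m n + (if m = 0 \<and> n = 0 then frag_of [] else 0)"
proof (induction "m + n" arbitrary: m n)
  case 0
  then show ?case
    by (simp add: face_sum_def shuffle_boundary_def map_chain_lin del_at_def)
next
  case (Suc N)
  then have mn: "(m, n) \<noteq> (0, 0)"
    by auto
  let ?R = "frag_cmul ((-1) ^ n) (shuffle_chain m (Suc n)) + shuffle_chain (Suc m) n"
  have "Poly_Mapping.keys ?R \<subseteq> {u. length u = m + n}"
  proof
    fix u assume "u \<in> Poly_Mapping.keys ?R"
    then have "u \<in> Poly_Mapping.keys (shuffle_chain m (Suc n)) \<union> Poly_Mapping.keys (shuffle_chain (Suc m) n)"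
      using keys_add [of "frag_cmul ((-1) ^ n) (shuffle_chain m (Suc n))" "shuffle_chain (Suc m) n"]
      by auto
    then show "u \<in> {u. length u = m + n}"
      using shuffle_chain_keys(1) by fastforce
  qed
  then have *: "face_sum (shuffle_chain (Suc m) (Suc n)) =
      snoc_chain (m, n) (frag_cmul ((-1) ^ n) (face_sum (shuffle_chain m (Suc n))) +
        face_sum (shuffle_chain (Suc m) n)) + frag_cmul ((-1) ^ (m + n)) ?R"
    by (simp add: shuffle_chain_rec [OF mn] face_sum_snoc_chain face_sum_lin)
  show ?case
  proof (cases m)
    case m: 0
    then obtain n' where n: "n = Suc n'"
      using mn by (cases n) auto
    have IH: "face_sum (shuffle_chain 1 (Suc n')) = shuffle_boundary 0 n' + (if n' = 0 then frag_of [] else 0)"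
      using Suc.hyps(1) [of 0 n'] Suc.hyps(2) m n by simp
    show ?thesis
    \<comment> \<open>For a single edge the augmentation term of the hypothesis survives: its cone
      is the one-vertex list at the apex, which is a genuine face of the edge.\<close>
    proof (cases "n' = 0")
      case True
      then show ?thesis
        using * IH m n
        by (simp add: shuffle_boundary_def snoc_chain_def map_chain_def skip_snd_def skip_def face_sum_lin)
    next
      case False
      then have "(0, n') \<noteq> (0, 0)"
        by simp
      from sum_skip_snd [OF this] show ?thesis
        using * IH m n False
        by (simp add: shuffle_boundary_def snoc_chain_lin map_chain_lin face_sum_lin)
    qed
  next
    case m: (Suc m')
    have IH1: "face_sum (shuffle_chain m (Suc n)) = shuffle_boundary m' n +
        (if m' = 0 \<and> n = 0 then frag_of [] else 0)"
      using Suc.hyps(1) [of m' n] Suc.hyps(2) m by simp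
    show ?thesis
    proof (cases n)
      case n: 0
      show ?thesis
      proof (cases "m' = 0")
        case True
        then show ?thesis
          using * IH1 m n
          by (simp add: shuffle_boundary_def snoc_chain_def map_chain_def skip_fst_def skip_def face_sum_lin)
      next
        case False
        then have "(m', 0) \<noteq> (0, 0)"
          by simp
        from sum_skip_fst [OF this] show ?thesis
          using * IH1 m n False
          by (simp add: shuffle_boundary_def snoc_chain_lin map_chain_lin face_sum_lin)
      qed
    next
      case n: (Suc n')
      have IH2: "face_sum (shuffle_chain (Suc m) n) = shuffle_boundary m n'"
        using Suc.hyps(1) [of m n'] Suc.hyps(2) m n by simp
      define A where "A = (\<Sum>j\<le>m'. frag_cmul ((-1) ^ j) (map_chain (skip_fst j) (shuffle_chain m' (Suc n))))"
      define B where "B = (\<Sum>j\<le>m'. frag_cmul ((-1) ^ j) (map_chain (skip_fst j) (shuffle_chain m n)))"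
      define D where "D = (\<Sum>j\<le>n'. frag_cmul ((-1) ^ j) (map_chain (skip_snd j) (shuffle_chain m n)))"
      define E where "E = (\<Sum>j\<le>n'. frag_cmul ((-1) ^ j) (map_chain (skip_snd j) (shuffle_chain (Suc m) n')))"
      \<comment> \<open>The terms with \<open>shuffle_chain m n\<close> in 1 and 2 are paths to (m',
        n'). Coned with (m, n) they are the faces shared by the two orders of the last two steps,
        and they enter with the opposite signs (-1)^m' and (-1)^m.\<close>
      have 1: "shuffle_boundary m' n = A + frag_cmul ((-1) ^ m') (D + frag_cmul ((-1) ^ n) (shuffle_chain m n))"
        by (simp add: shuffle_boundary_def A_def D_def m n map_chain_skip_last)
      have 2: "shuffle_boundary m n' = B + frag_cmul ((-1) ^ m) (shuffle_chain m n) + frag_cmul ((-1) ^ m) E"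
        by (simp add: shuffle_boundary_def B_def E_def m n map_chain_skip_last)
      have "(m', n) \<noteq> (0, 0)" "(m, n') \<noteq> (0, 0)"
        using m n by auto
      from sum_skip_fst [OF this(1)] sum_skip_snd [OF this(2)]
      have 3: "shuffle_boundary m n =
          snoc_chain (m, n) (frag_cmul ((-1) ^ n) A + B) + frag_cmul ((-1) ^ m) (shuffle_chain m (Suc n)) +
          frag_cmul ((-1) ^ m)
            (snoc_chain (m, n) (frag_cmul ((-1) ^ n') D + E) + frag_cmul ((-1) ^ n) (shuffle_chain (Suc m) n))"
        by (simp only: shuffle_boundary_def A_def B_def D_def E_def m n)
      show ?thesis
        unfolding * IH1 IH2 1 2 3
        by (cases "even m'"; cases "even n'")
          (simp_all add: m n snoc_chain_lin frag_cmul_distrib2)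
    qed
  qed
qed

text \<open>In barycentric coordinates, the affine map of simplices that sends vertex i to vertex
  \<open>a i\<close>.\<close>

definition gather :: "nat \<Rightarrow> (nat \<Rightarrow> nat) \<Rightarrow> (nat \<Rightarrow> real) \<Rightarrow> nat \<Rightarrow> real" where
  "gather N a t = (\<lambda>j. \<Sum>i | i \<le> N \<and> a i = j. t i)"

lemma gather_in_standard_simplex:
  assumes a: "\<And>i. i \<le> N \<Longrightarrow> a i \<le> m" and t: "t \<in> standard_simplex N"
  shows "gather N a t \<in> standard_simplex m"
proof -
  have t1: "(\<Sum>i\<le>N. t i) = 1" and t0: "0 \<le> t i" for i
    using t by (auto simp: standard_simplex_def)
  have "(\<Sum>j\<le>m. gather N a t j) = (\<Sum>j\<le>m. \<Sum>i | i \<in> {..N} \<and> a i = j. t i)"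
    by (simp add: gather_def)
  also have "\<dots> = (\<Sum>i\<le>N. t i)"
    by (rule sum.group) (use a in auto)
  finally have 1: "(\<Sum>j\<le>m. gather N a t j) = 1"
    using t1 by simp
  have 0: "gather N a t j \<ge> 0" for j
    unfolding gather_def using t0 by (intro sum_nonneg) auto
  have out: "gather N a t j = 0" if "j > m" for j
  proof -
    have *: "{i. i \<le> N \<and> a i = j} = {}"
      using that a by fastforce
    show ?thesis
      unfolding gather_def * by simp
  qed
  have "gather N a t j \<le> 1" for j
  proof (cases "j \<le> m")
    case True
    then have "gather N a t j \<le> (\<Sum>j\<le>m. gather N a t j)"
      using 0 by (intro member_le_sum) auto
    then show ?thesis
      using 1 by simp
  qed (use out in auto)
  then show ?thesis
    using 0 1 out by (simp add: standard_simplex_def)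
qed

lemma continuous_map_gather:
  assumes "\<And>i. i \<le> N \<Longrightarrow> a i \<le> m"
  shows "continuous_map (subtopology (powertop_real UNIV) (standard_simplex N))
    (subtopology (powertop_real UNIV) (standard_simplex m)) (gather N a)"
proof -
  have "continuous_map (powertop_real UNIV) (powertop_real UNIV) (gather N a)"
    unfolding continuous_map_componentwise_UNIV gather_def
    by (auto intro!: continuous_map_sum continuous_map_product_projection)
  then show ?thesis
    using gather_in_standard_simplex [OF assms]
    by (auto simp: continuous_map_in_subtopology continuous_map_from_subtopology)
qed

text \<open>The affine simplex in a product of two simplices whose vertices are listed in
  \<open>u\<close>, followed by \<open>f\<close> and \<open>g\<close> on the factors.\<close>

definition realize :: "((nat \<Rightarrow> real) \<Rightarrow> 'a) \<Rightarrow> ((nat \<Rightarrow> real) \<Rightarrow> 'b) \<Rightarrow> (nat \<times> nat) list \<Rightarrow>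
    (nat \<Rightarrow> real) \<Rightarrow> 'a \<times> 'b" where
  "realize f g u = (\<lambda>t\<in>standard_simplex (length u - 1).
     (f (gather (length u - 1) (\<lambda>i. fst (u ! i)) t), g (gather (length u - 1) (\<lambda>i. snd (u ! i)) t)))"

lemma gather_cong: "(\<And>i. i \<le> N \<Longrightarrow> a i = b i) \<Longrightarrow> gather N a t = gather N b t"
  unfolding gather_def by (intro ext sum.cong) auto

lemma shuffle_projection_gather:
  "shuffle_projection N \<mu> = gather N (\<lambda>i. card (\<mu> \<inter> {..<i}))"
  by (simp add: shuffle_projection_def gather_def fun_eq_iff)

lemma shuffle_simplex_realize: "shuffle_simplex N \<mu> f g = realize f g (lattice_path N \<mu>)"
proof -
  have len: "length (lattice_path N \<mu>) - 1 = N"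
    by (simp add: lattice_path_def)
  have u: "lattice_path N \<mu> ! i = (card (\<mu> \<inter> {..<i}), card ({..<i} - \<mu>))" if "i \<le> N" for i
    using that unfolding lattice_path_def by (subst nth_map) (auto simp del: upt_Suc)
  have "({..<N} - \<mu>) \<inter> {..<i} = {..<i} - \<mu>" if "i \<le> N" for i
    using that by auto
  then show ?thesis
    unfolding shuffle_simplex_def realize_def len shuffle_projection_gather
    by (intro restrict_ext arg_cong2 [where f = Pair] arg_cong [where f = f] arg_cong [where f = g]
        gather_cong) (simp_all add: u)
qed

text \<open>The face inclusion is the affine map belonging to the vertex map \<open>skip i\<close>:
  it inserts a zero at coordinate i, which drops out of the sums. So deleting a vertex from a list
  corresponds to taking a face.\<close>

lemma simplical_face_gather:
  assumes "i \<le> Suc N"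
  shows "gather (Suc N) a (simplical_face i t) = gather N (a \<circ> skip i) t"
proof
  fix j
  have bij: "bij_betw (skip i) {l. l \<le> N \<and> a (skip i l) = j} {l. l \<le> Suc N \<and> l \<noteq> i \<and> a l = j}"
  proof (rule bij_betwI [where g = "\<lambda>l. if l < i then l else l - 1"])
    show "skip i \<in> {l. l \<le> N \<and> a (skip i l) = j} \<rightarrow> {l. l \<le> Suc N \<and> l \<noteq> i \<and> a l = j}"
      by (auto simp: skip_def)
    show "(\<lambda>l. if l < i then l else l - 1) \<in> {l. l \<le> Suc N \<and> l \<noteq> i \<and> a l = j} \<rightarrow>
        {l. l \<le> N \<and> a (skip i l) = j}"
      using assms by (auto simp: skip_def split: if_splits)
  qed (auto simp: skip_def)
  have "gather (Suc N) a (simplical_face i t) j =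
      (\<Sum>l | l \<le> Suc N \<and> l \<noteq> i \<and> a l = j. simplical_face i t l)"
    unfolding gather_def by (rule sum.mono_neutral_right) (auto simp: simplical_face_def)
  also have "\<dots> = (\<Sum>l | l \<le> N \<and> a (skip i l) = j. simplical_face i t (skip i l))"
    by (rule sum.reindex_bij_betw [OF bij, symmetric])
  also have "\<dots> = gather N (a \<circ> skip i) t j"
    unfolding gather_def by (intro sum.cong) (auto simp: simplical_face_def skip_def)
  finally show "gather (Suc N) a (simplical_face i t) j = gather N (a \<circ> skip i) t j" .
qed

lemma gather_skip:
  "gather N (\<lambda>i. skip j (a i)) t = simplical_face j (gather N a t)"
proof
  fix l
  have "gather N (\<lambda>i. skip j (a i)) t l =
      (if l < j then gather N a t l else if l = j then 0 else gather N a t (l - 1))"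
  proof -
    have "{i. i \<le> N \<and> skip j (a i) = l} =
        (if l < j then {i. i \<le> N \<and> a i = l} else if l = j then {} else {i. i \<le> N \<and> a i = l - 1})"
      by (auto simp: skip_def split: if_splits)
    then show ?thesis
      by (simp add: gather_def)
  qed
  then show "gather N (\<lambda>i. skip j (a i)) t l = simplical_face j (gather N a t) l"
    by (simp add: simplical_face_def)
qed

lemma length_del_at: "i < length u \<Longrightarrow> length (del_at i u) = length u - 1"
  by (simp add: del_at_def)

lemma nth_del_at: "\<lbrakk>i < length u; l < length u - 1\<rbrakk> \<Longrightarrow> del_at i u ! l = u ! skip i l"
  by (auto simp: del_at_def nth_append skip_def min_def)

lemma singular_face_realize:
  assumes u: "length u = Suc (Suc N)" and i: "i \<le> Suc N"
  shows "singular_face (Suc N) i (realize f g u) = realize f g (del_at i u)"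
proof -
  have len: "length (del_at i u) - 1 = N" "length u - 1 = Suc N"
    using u i by (simp_all add: length_del_at)
  have "simplical_face i t \<in> standard_simplex (Suc N)" if "t \<in> standard_simplex N" for t :: "nat \<Rightarrow> real"
    using simplical_face_in_standard_simplex [of "Suc N" i t] i that by simp
  moreover have "gather N ((\<lambda>l. h (u ! l)) \<circ> skip i) t = gather N (\<lambda>l. h (del_at i u ! l)) t"
    for h :: "nat \<times> nat \<Rightarrow> nat" and t
    using u i by (intro gather_cong) (simp add: nth_del_at)
  ultimately show ?thesis
    unfolding singular_face_def realize_def len
    by (intro ext) (simp add: restrict_def simplical_face_gather [OF i])
qed

text \<open>By \<open>gather_skip\<close>, relabelling by \<open>skip j\<close> inserts a zero at
  coordinate j, which can be moved into \<open>f\<close> as its j-th face. The bound on the vertices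
  keeps the argument in the simplex to which \<open>singular_face\<close> is restricted.\<close>

lemma realize_skip_fst:
  assumes "u \<noteq> []" "set u \<subseteq> {..<m} \<times> UNIV"
  shows "realize f g (map (skip_fst j) u) = realize (singular_face m j f) g u"
proof -
  let ?N = "length u - 1"
  have *: "gather ?N (\<lambda>i. fst (map (skip_fst j) u ! i)) t = gather ?N (\<lambda>i. skip j (fst (u ! i))) t"
    "gather ?N (\<lambda>i. snd (map (skip_fst j) u ! i)) t = gather ?N (\<lambda>i. snd (u ! i)) t" for t
    using assms(1) by (auto intro!: gather_cong simp: skip_fst_def less_Suc_eq_le[symmetric])
  have "gather ?N (\<lambda>i. fst (u ! i)) t \<in> standard_simplex (m - Suc 0)" if "t \<in> standard_simplex ?N" for t
  proof (rule gather_in_standard_simplex [OF _ that])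
    fix i assume "i \<le> ?N"
    then have "u ! i \<in> set u"
      using assms(1) by (intro nth_mem) (cases u; simp)
    then show "fst (u ! i) \<le> m - Suc 0"
      using assms(2) by fastforce
  qed
  then show ?thesis
    unfolding realize_def length_map * gather_skip
    by (intro restrict_ext) (simp add: singular_face_def)
qed

lemma realize_skip_snd:
  assumes "u \<noteq> []" "set u \<subseteq> UNIV \<times> {..<n}"
  shows "realize f g (map (skip_snd j) u) = realize f (singular_face n j g) u"
proof -
  let ?N = "length u - 1"
  have *: "gather ?N (\<lambda>i. snd (map (skip_snd j) u ! i)) t = gather ?N (\<lambda>i. skip j (snd (u ! i))) t"
    "gather ?N (\<lambda>i. fst (map (skip_snd j) u ! i)) t = gather ?N (\<lambda>i. fst (u ! i)) t" for t
    using assms(1) by (auto intro!: gather_cong simp: skip_snd_def less_Suc_eq_le[symmetric])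
  have "gather ?N (\<lambda>i. snd (u ! i)) t \<in> standard_simplex (n - Suc 0)" if "t \<in> standard_simplex ?N" for t
  proof (rule gather_in_standard_simplex [OF _ that])
    fix i assume "i \<le> ?N"
    then have "u ! i \<in> set u"
      using assms(1) by (intro nth_mem) (cases u; simp)
    then show "snd (u ! i) \<le> n - Suc 0"
      using assms(2) by fastforce
  qed
  then show ?thesis
    unfolding realize_def length_map * gather_skip
    by (intro restrict_ext) (simp add: singular_face_def)
qed

definition realize_chain :: "((nat \<Rightarrow> real) \<Rightarrow> 'a) \<Rightarrow> ((nat \<Rightarrow> real) \<Rightarrow> 'b) \<Rightarrow> ((nat \<times> nat) list \<Rightarrow>\<^sub>0 int) \<Rightarrow>
    ('a \<times> 'b) chain" where
  "realize_chain f g = frag_extend (\<lambda>u. frag_of (realize f g u))"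

lemma realize_chain_lin:
  "realize_chain f g 0 = 0"
  "realize_chain f g (a + b) = realize_chain f g a + realize_chain f g b"
  "realize_chain f g (a - b) = realize_chain f g a - realize_chain f g b"
  "realize_chain f g (frag_cmul c a) = frag_cmul c (realize_chain f g a)"
  "realize_chain f g (\<Sum>i\<in>I. x i) = (\<Sum>i\<in>I. realize_chain f g (x i))"
  by (simp_all add: realize_chain_def frag_extend_lin frag_extend_sum')

lemma cross_chain_of:
  "cross_chain m n (frag_of f) (frag_of g) = realize_chain f g (shuffle_chain (Suc m) (Suc n))"
  by (simp add: cross_chain_def shuffle_chain.simps realize_chain_lin)
    (simp add: realize_chain_def shuffle_simplex_realize)

text \<open>Realization commutes with faces. Lists have at least two vertices here because
  \<open>face_sum\<close> is augmented on a single vertex, whereas \<open>chain_boundary 0\<close>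
  is zero.\<close>

lemma chain_boundary_realize:
  assumes "Poly_Mapping.keys c \<subseteq> {u. length u = Suc (Suc N)}"
  shows "chain_boundary (Suc N) (realize_chain f g c) = realize_chain f g (face_sum c)"
  using assms
proof (induction rule: frag_induction)
  case (one u)
  then have "(\<Sum>k\<le>Suc N. frag_cmul ((-1) ^ k) (frag_of (singular_face (Suc N) k (realize f g u)))) =
      (\<Sum>k<length u. frag_cmul ((-1) ^ k) (frag_of (realize f g (del_at k u))))"
    by (intro sum.cong) (auto simp: singular_face_realize)
  then show ?case
    by (simp add: realize_chain_def face_sum_def chain_boundary_of frag_extend_sum' frag_extend_cmul)
next
  case (diff a b)
  then show ?case
    by (simp add: realize_chain_lin chain_boundary_diff face_sum_def frag_extend_diff)
qed (simp_all add: realize_chain_lin face_sum_lin)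

lemma realize_chain_skip_fst:
  "realize_chain f g (map_chain (skip_fst j) (shuffle_chain (Suc m) (Suc n))) =
    realize_chain (singular_face (Suc m) j f) g (shuffle_chain (Suc m) (Suc n))"
  unfolding realize_chain_def map_chain_def frag_extend_compose [unfolded o_def]
proof (rule frag_extend_eq)
  fix u assume "u \<in> Poly_Mapping.keys (shuffle_chain (Suc m) (Suc n))"
  from shuffle_chain_keys [OF this]
  show "frag_of (realize f g (map (skip_fst j) u)) = frag_of (realize (singular_face (Suc m) j f) g u)"
    by (subst realize_skip_fst [of u "Suc m"]) auto
qed

lemma realize_chain_skip_snd:
  "realize_chain f g (map_chain (skip_snd j) (shuffle_chain (Suc m) (Suc n))) =
    realize_chain f (singular_face (Suc n) j g) (shuffle_chain (Suc m) (Suc n))"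
  unfolding realize_chain_def map_chain_def frag_extend_compose [unfolded o_def]
proof (rule frag_extend_eq)
  fix u assume "u \<in> Poly_Mapping.keys (shuffle_chain (Suc m) (Suc n))"
  from shuffle_chain_keys [OF this]
  show "frag_of (realize f g (map (skip_snd j) u)) = frag_of (realize f (singular_face (Suc n) j g) u)"
    by (subst realize_skip_snd [of u "Suc n"]) auto
qed

section \<open>Bilinearity and the Leibniz rule for the cross product\<close>

lemma frag_induct:
  assumes "P 0" "\<And>x. P (frag_of x)" "\<And>a b. \<lbrakk>P a; P b\<rbrakk> \<Longrightarrow> P (a - b)"
  shows "P c"
  by (rule frag_induction [of c UNIV]) (use assms in auto)

lemma cross_chain_left:
  "cross_chain m n 0 b = 0"
  "cross_chain m n (a + a') b = cross_chain m n a b + cross_chain m n a' b"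
  "cross_chain m n (a - a') b = cross_chain m n a b - cross_chain m n a' b"
  "cross_chain m n (- a) b = - cross_chain m n a b"
  "cross_chain m n (frag_cmul c a) b = frag_cmul c (cross_chain m n a b)"
  "cross_chain m n (\<Sum>i\<in>I. x i) b = (\<Sum>i\<in>I. cross_chain m n (x i) b)"
  by (simp_all add: cross_chain_def frag_extend_lin frag_extend_sum')

lemma cross_chain_right:
  "cross_chain m n a 0 = 0"
  "cross_chain m n a (b - b') = cross_chain m n a b - cross_chain m n a b'"
  "cross_chain m n a (b + b') = cross_chain m n a b + cross_chain m n a b'"
  "cross_chain m n a (- b) = - cross_chain m n a b"
  "cross_chain m n a (frag_cmul c b) = frag_cmul c (cross_chain m n a b)"
proof -
  show 0: "cross_chain m n a 0 = 0"
    by (simp add: cross_chain_def frag_extend_eq_0)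
  show diff: "cross_chain m n a (b - b') = cross_chain m n a b - cross_chain m n a b'" for b b'
    by (induction a rule: frag_induct) (simp_all add: cross_chain_left, simp add: cross_chain_def frag_extend_lin)
  show minus: "cross_chain m n a (- b) = - cross_chain m n a b" for b
    using diff [of 0 b] 0 by simp
  show "cross_chain m n a (b + b') = cross_chain m n a b + cross_chain m n a b'"
    using diff [of b "- b'"] unfolding minus by simp
  show "cross_chain m n a (frag_cmul c b) = frag_cmul c (cross_chain m n a b)"
    by (induction a rule: frag_induct)
      (simp_all add: cross_chain_left frag_cmul_diff_right, simp add: cross_chain_def frag_extend_lin)
qed

lemma cross_chain_right_sum:
  "cross_chain m n a (\<Sum>i\<in>I. x i) = (\<Sum>i\<in>I. cross_chain m n a (x i))"
  by (induction I rule: infinite_finite_induct) (simp_all add: cross_chain_right)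

text \<open>By bilinearity single simplices suffice, and there the product realizes a universal
  shuffle chain, to which \<open>face_sum_shuffle_chain\<close> applies. Truncated subtraction at
  degree 0 is harmless because \<open>chain_boundary 0\<close> vanishes.\<close>

theorem chain_boundary_cross_chain:
  "chain_boundary (m + n) (cross_chain m n a b) =
    cross_chain (m - 1) n (chain_boundary m a) b +
    frag_cmul ((-1) ^ m) (cross_chain m (n - 1) a (chain_boundary n b))"
proof (induction a rule: frag_induct)
  case (2 f)
  show ?case
  proof (induction b rule: frag_induct)
    case (2 g)
    show ?case
    proof (cases "m + n")
      case 0
      then show ?thesis
        by (simp add: chain_boundary_def cross_chain_left cross_chain_right)
    next
      case (Suc N)
      have "chain_boundary (m + n) (cross_chain m n (frag_of f) (frag_of g)) =
          realize_chain f g (shuffle_boundary m n)"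
      proof -
        have "Poly_Mapping.keys (shuffle_chain (Suc m) (Suc n)) \<subseteq> {u. length u = Suc (Suc N)}"
          using shuffle_chain_keys(1) Suc by fastforce
        moreover have "(if m = 0 \<and> n = 0 then frag_of [] else 0) = (0 :: (nat \<times> nat) list \<Rightarrow>\<^sub>0 int)"
          using Suc by auto
        ultimately show ?thesis
          unfolding cross_chain_of Suc by (simp only: chain_boundary_realize face_sum_shuffle_chain add_0_right)
      qed
      moreover have "realize_chain f g (\<Sum>j\<le>m. frag_cmul ((-1) ^ j)
          (map_chain (skip_fst j) (shuffle_chain m (Suc n)))) =
          cross_chain (m - 1) n (chain_boundary m (frag_of f)) (frag_of g)"
        by (cases m) (simp_all add: chain_boundary_of cross_chain_left map_chain_lin realize_chain_lin
            realize_chain_skip_fst cross_chain_of del: sum.atMost_Suc)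
      moreover have "realize_chain f g (\<Sum>j\<le>n. frag_cmul ((-1) ^ j)
          (map_chain (skip_snd j) (shuffle_chain (Suc m) n))) =
          cross_chain m (n - 1) (frag_of f) (chain_boundary n (frag_of g))"
        by (cases n) (simp_all add: chain_boundary_of cross_chain_right cross_chain_right_sum map_chain_lin
            realize_chain_lin realize_chain_skip_snd cross_chain_of del: sum.atMost_Suc)
      ultimately show ?thesis
        by (simp add: shuffle_boundary_def realize_chain_lin)
    qed
  qed (simp_all add: cross_chain_right chain_boundary_diff frag_cmul_diff_right)
qed (simp_all add: cross_chain_left chain_boundary_diff frag_cmul_diff_right)

section \<open>Homology classes modulo p\<close>

lemma graded_chain_0 [simp]: "graded_chain n X 0"
  by (simp add: graded_chain_def)

lemma graded_chain_neg: "\<lbrakk>graded_chain n X c; n < 0\<rbrakk> \<Longrightarrow> c = 0"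
  by (simp add: graded_chain_def)

lemma graded_chain_add: "\<lbrakk>graded_chain n X a; graded_chain n X b\<rbrakk> \<Longrightarrow> graded_chain n X (a + b)"
  and graded_chain_diff: "\<lbrakk>graded_chain n X a; graded_chain n X b\<rbrakk> \<Longrightarrow> graded_chain n X (a - b)"
  and graded_chain_minus: "graded_chain n X a \<Longrightarrow> graded_chain n X (- a)"
  and graded_chain_cmul: "graded_chain n X a \<Longrightarrow> graded_chain n X (frag_cmul k a)"
  by (auto simp: graded_chain_def singular_chain_add singular_chain_diff singular_chain_minus
      singular_chain_cmul split: if_splits)

lemmas graded_chain_lin = graded_chain_add graded_chain_diff graded_chain_minus graded_chain_cmul

lemma graded_chain_subtopology_empty: "graded_chain n (subtopology X {}) c \<longleftrightarrow> c = 0"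
  by (auto simp: graded_chain_def singular_chain_empty)

lemma graded_chain_from_subtopology: "graded_chain n (subtopology X A) c \<Longrightarrow> graded_chain n X c"
  by (auto simp: graded_chain_def singular_chain_subtopology split: if_splits)

lemma graded_chain_boundary:
  assumes "graded_chain n X c"
  shows "graded_chain (n - 1) X (chain_boundary (nat n) c)"
proof (cases "n \<ge> 1")
  case True
  then have "nat (n - 1) = nat n - Suc 0"
    by simp
  then show ?thesis
    using assms True singular_chain_boundary [of "nat n" X c] by (simp add: graded_chain_def)
next
  case False
  then have "chain_boundary (nat n) c = 0"
    by (simp add: chain_boundary_def)
  then show ?thesis
    by simp
qed

lemma graded_chain_boundary_Suc:
  "graded_chain (n + 1) X c \<Longrightarrow> graded_chain n X (chain_boundary (nat (n + 1)) c)"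
  using graded_chain_boundary [of "n + 1" X c] by simp

lemma graded_chain_boundary_boundary:
  assumes "graded_chain n X c"
  shows "chain_boundary (nat (n - 1)) (chain_boundary (nat n) c) = 0"
proof (cases "n \<ge> 1")
  case True
  then have "nat (n - 1) = nat n - Suc 0"
    by simp
  then show ?thesis
    using assms True chain_boundary_boundary [of "nat n" X c] by (simp add: graded_chain_def)
next
  case False
  then have "chain_boundary (nat n) c = 0"
    by (simp add: chain_boundary_def)
  then show ?thesis
    by simp
qed

lemma graded_chain_chain_map:
  "\<lbrakk>graded_chain n X c; continuous_map X Y f\<rbrakk> \<Longrightarrow> graded_chain n Y (chain_map (nat n) f c)"
  by (auto simp: graded_chain_def intro: singular_chain_chain_map split: if_splits)

lemma chain_boundary_graded_chain_map:
  assumes "graded_chain n X c"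
  shows "chain_boundary (nat n) (chain_map (nat n) f c) = chain_map (nat (n - 1)) f (chain_boundary (nat n) c)"
proof (cases "n \<ge> 0")
  case True
  moreover have "nat (n - 1) = nat n - Suc 0"
    by simp
  ultimately show ?thesis
    using assms chain_boundary_chain_map [of "nat n" X c] by (simp add: graded_chain_def)
qed (use assms in \<open>simp add: graded_chain_def\<close>)

text \<open>Lying in a subspace is a condition on the support of a chain, and multiplication by a
  nonzero integer preserves the support.\<close>

lemma graded_chain_cmul_cancel:
  assumes "graded_chain n X (frag_cmul k c)" "k \<noteq> 0"
  shows "graded_chain n X c"
  using assms by (auto simp: graded_chain_def singular_chain_def split: if_splits)

section \<open>Relative cycles and boundaries modulo p and their quotient groups\<close>

lemma mod_relcycleI:
  assumes "graded_chain n X c" "graded_chain (n - 1) (subtopology X A) a" "graded_chain (n - 1) X d"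
    "chain_boundary (nat n) c = a + frag_cmul (int p) d"
  shows "mod_relcycle p n X A c"
  using assms unfolding mod_relcycle_def by blast

lemma mod_relboundaryI:
  assumes "graded_chain (n + 1) X b" "graded_chain n (subtopology X A) a" "graded_chain n X d"
    "c = chain_boundary (nat (n + 1)) b + a + frag_cmul (int p) d"
  shows "mod_relboundary p n X A c"
  using assms unfolding mod_relboundary_def by blast

lemma mod_relcycle_graded: "mod_relcycle p n X A c \<Longrightarrow> graded_chain n X c"
  by (simp add: mod_relcycle_def)

lemma mod_relcycle_lin:
  assumes c: "mod_relcycle p n X A c" and c': "mod_relcycle p n X A c'"
  shows "mod_relcycle p n X A (frag_cmul k c + frag_cmul l c')"
proof -
  obtain a d where ad: "graded_chain (n - 1) (subtopology X A) a" "graded_chain (n - 1) X d"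
      "chain_boundary (nat n) c = a + frag_cmul (int p) d"
    using c unfolding mod_relcycle_def by blast
  obtain a' d' where ad': "graded_chain (n - 1) (subtopology X A) a'" "graded_chain (n - 1) X d'"
      "chain_boundary (nat n) c' = a' + frag_cmul (int p) d'"
    using c' unfolding mod_relcycle_def by blast
  show ?thesis
  proof (rule mod_relcycleI)
    show "chain_boundary (nat n) (frag_cmul k c + frag_cmul l c') =
        (frag_cmul k a + frag_cmul l a') + frag_cmul (int p) (frag_cmul k d + frag_cmul l d')"
      using ad ad' by (simp add: chain_boundary_add chain_boundary_cmul frag_cmul_distrib2 mult.commute)
  qed (use c c' ad ad' in \<open>auto intro: graded_chain_lin dest: mod_relcycle_graded\<close>)
qed

lemma mod_relboundary_lin:
  assumes c: "mod_relboundary p n X A c" and c': "mod_relboundary p n X A c'"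
  shows "mod_relboundary p n X A (frag_cmul k c + frag_cmul l c')"
proof -
  obtain b a d where bad: "graded_chain (n + 1) X b" "graded_chain n (subtopology X A) a"
      "graded_chain n X d" "c = chain_boundary (nat (n + 1)) b + a + frag_cmul (int p) d"
    using c unfolding mod_relboundary_def by blast
  obtain b' a' d' where bad': "graded_chain (n + 1) X b'" "graded_chain n (subtopology X A) a'"
      "graded_chain n X d'" "c' = chain_boundary (nat (n + 1)) b' + a' + frag_cmul (int p) d'"
    using c' unfolding mod_relboundary_def by blast
  show ?thesis
  proof (rule mod_relboundaryI)
    show "frag_cmul k c + frag_cmul l c' =
        chain_boundary (nat (n + 1)) (frag_cmul k b + frag_cmul l b') + (frag_cmul k a + frag_cmul l a') +
        frag_cmul (int p) (frag_cmul k d + frag_cmul l d')"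
      using bad bad' by (simp add: chain_boundary_add chain_boundary_cmul frag_cmul_distrib2 mult.commute)
  qed (use bad bad' in \<open>auto intro: graded_chain_lin\<close>)
qed

lemma mod_relcycle_0: "mod_relcycle p n X A 0"
  by (rule mod_relcycleI [of _ _ _ _ 0 0]) auto

lemma mod_relboundary_0: "mod_relboundary p n X A 0"
  by (rule mod_relboundaryI [of _ _ 0 _ 0 0]) auto

lemma mod_relcycle_add: "\<lbrakk>mod_relcycle p n X A c; mod_relcycle p n X A c'\<rbrakk> \<Longrightarrow> mod_relcycle p n X A (c + c')"
  and mod_relcycle_cmul: "mod_relcycle p n X A c \<Longrightarrow> mod_relcycle p n X A (frag_cmul k c)"
  using mod_relcycle_lin [of p n X A c c' 1 1] mod_relcycle_lin [of p n X A c 0 k 0] mod_relcycle_0 [of p n X A]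
  by auto

lemma mod_relboundary_add:
    "\<lbrakk>mod_relboundary p n X A c; mod_relboundary p n X A c'\<rbrakk> \<Longrightarrow> mod_relboundary p n X A (c + c')"
  and mod_relboundary_diff:
    "\<lbrakk>mod_relboundary p n X A c; mod_relboundary p n X A c'\<rbrakk> \<Longrightarrow> mod_relboundary p n X A (c - c')"
  and mod_relboundary_cmul: "mod_relboundary p n X A c \<Longrightarrow> mod_relboundary p n X A (frag_cmul k c)"
  using mod_relboundary_lin [of p n X A c c' 1 1] mod_relboundary_lin [of p n X A c c' 1 "-1"]
    mod_relboundary_lin [of p n X A c 0 k 0] mod_relboundary_0 [of p n X A]
  by auto

lemma mod_relboundary_imp_relcycle:
  assumes "mod_relboundary p n X A c"
  shows "mod_relcycle p n X A c"
proof -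
  obtain b a d where bad: "graded_chain (n + 1) X b" "graded_chain n (subtopology X A) a"
      "graded_chain n X d" "c = chain_boundary (nat (n + 1)) b + a + frag_cmul (int p) d"
    using assms unfolding mod_relboundary_def by blast
  show ?thesis
  proof (rule mod_relcycleI)
    show "chain_boundary (nat n) c = chain_boundary (nat n) a + frag_cmul (int p) (chain_boundary (nat n) d)"
      using graded_chain_boundary_boundary [OF bad(1)] bad(4)
      by (simp add: chain_boundary_add chain_boundary_cmul)
    show "graded_chain n X c"
      unfolding bad(4) using bad
      by (intro graded_chain_lin graded_chain_boundary_Suc) (auto intro: graded_chain_from_subtopology)
  qed (use bad in \<open>auto intro: graded_chain_boundary\<close>)
qed

lemma homology_class_eq_iff:
  "homology_class p n X A c = homology_class p n X A c' \<longleftrightarrow> mod_relboundary p n X A (c - c')"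
proof
  assume "homology_class p n X A c = homology_class p n X A c'"
  moreover have "c \<in> homology_class p n X A c"
    by (simp add: homology_class_def mod_relboundary_0)
  ultimately show "mod_relboundary p n X A (c - c')"
    by (simp add: homology_class_def)
next
  assume c: "mod_relboundary p n X A (c - c')"
  have "mod_relboundary p n X A (x - c) \<longleftrightarrow> mod_relboundary p n X A (x - c')" for x
    using mod_relboundary_add [OF _ c, of "x - c"] mod_relboundary_diff [OF _ c, of "x - c'"] by auto
  then show "homology_class p n X A c = homology_class p n X A c'"
    by (simp add: homology_class_def)
qed

lemma homology_class_self: "c \<in> homology_class p n X A c"
  by (simp add: homology_class_def mod_relboundary_0)

lemma mod_relcycle_homologous:
  assumes "c' \<in> homology_class p n X A c" "mod_relcycle p n X A c"
  shows "mod_relcycle p n X A c'"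
  using mod_relcycle_add [OF assms(2) mod_relboundary_imp_relcycle, of "c' - c"] assms(1)
  by (simp add: homology_class_def)

abbreviation mod_relcycle_group :: "nat \<Rightarrow> int \<Rightarrow> 'a topology \<Rightarrow> 'a set \<Rightarrow> 'a chain monoid" where
  "mod_relcycle_group p n X A \<equiv> (chain_group (nat n) X)\<lparr>carrier := Collect (mod_relcycle p n X A)\<rparr>"

lemma comm_group_mod_relcycle: "comm_group (mod_relcycle_group p n X A)"
proof (rule comm_groupI)
  fix x assume x: "x \<in> carrier (mod_relcycle_group p n X A)"
  show "\<exists>y\<in>carrier (mod_relcycle_group p n X A). y \<otimes>\<^bsub>mod_relcycle_group p n X A\<^esub> x =
      \<one>\<^bsub>mod_relcycle_group p n X A\<^esub>"
    using x mod_relcycle_cmul [of p n X A x "-1"] by (intro bexI [of _ "- x"]) auto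
qed (auto simp: mod_relcycle_add mod_relcycle_0 algebra_simps)

lemma subgroup_mod_relboundary: "subgroup (Collect (mod_relboundary p n X A)) (mod_relcycle_group p n X A)"
proof -
  interpret comm_group "mod_relcycle_group p n X A"
    by (rule comm_group_mod_relcycle)
  show ?thesis
  proof (rule subgroupI)
    fix a assume a: "a \<in> Collect (mod_relboundary p n X A)"
    then have "mod_relcycle p n X A a" "mod_relcycle p n X A (- a)" "mod_relboundary p n X A (- a)"
      using mod_relboundary_imp_relcycle mod_relboundary_cmul [of p n X A a "-1"] by auto
    then have "inv\<^bsub>mod_relcycle_group p n X A\<^esub> a = - a"
      by (intro inv_equality) auto
    then show "inv\<^bsub>mod_relcycle_group p n X A\<^esub> a \<in> Collect (mod_relboundary p n X A)"
      using \<open>mod_relboundary p n X A (- a)\<close> by simp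
  qed (use mod_relboundary_0 [of p n X A] in \<open>auto simp: mod_relboundary_imp_relcycle mod_relboundary_add\<close>)
qed

lemma comm_group_rel_homology_mod: "comm_group (rel_homology_mod p n X A)"
  unfolding rel_homology_mod_def
  using comm_group.abelian_FactGroup [OF comm_group_mod_relcycle subgroup_mod_relboundary] .

lemma r_coset_mod_relboundary:
  "Collect (mod_relboundary p n X A) #>\<^bsub>mod_relcycle_group p n X A\<^esub> c = homology_class p n X A c"
proof -
  have "x \<in> Collect (mod_relboundary p n X A) #>\<^bsub>mod_relcycle_group p n X A\<^esub> c \<longleftrightarrow>
      x \<in> homology_class p n X A c" for x
    by (auto simp: r_coset_def homology_class_def intro: exI [of _ "x - c"])
  then show ?thesis
    by blast
qed

lemma carrier_rel_homology_mod:
  "carrier (rel_homology_mod p n X A) = homology_class p n X A ` Collect (mod_relcycle p n X A)"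
  unfolding rel_homology_mod_def carrier_FactGroup r_coset_mod_relboundary by simp

lemma homology_class_0: "homology_class p n X A 0 = Collect (mod_relboundary p n X A)"
  by (simp add: homology_class_def)

lemma one_rel_homology_mod: "\<one>\<^bsub>rel_homology_mod p n X A\<^esub> = homology_class p n X A 0"
  by (simp add: rel_homology_mod_def homology_class_0)

lemma mult_rel_homology_mod:
  "homology_class p n X A c \<otimes>\<^bsub>rel_homology_mod p n X A\<^esub> homology_class p n X A c' =
    homology_class p n X A (c + c')"
proof -
  have "x \<in> homology_class p n X A c <#>\<^bsub>mod_relcycle_group p n X A\<^esub> homology_class p n X A c' \<longleftrightarrow>
      x \<in> homology_class p n X A (c + c')" for x
  proof
    assume "x \<in> homology_class p n X A c <#>\<^bsub>mod_relcycle_group p n X A\<^esub> homology_class p n X A c'"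
    then obtain y z where "mod_relboundary p n X A (y - c)" "mod_relboundary p n X A (z - c')" "x = y + z"
      by (auto simp: set_mult_def homology_class_def)
    then show "x \<in> homology_class p n X A (c + c')"
      using mod_relboundary_add [of p n X A "y - c" "z - c'"] by (simp add: homology_class_def algebra_simps)
  next
    assume "x \<in> homology_class p n X A (c + c')"
    then have "x - c' \<in> homology_class p n X A c"
      by (simp add: homology_class_def algebra_simps)
    then show "x \<in> homology_class p n X A c <#>\<^bsub>mod_relcycle_group p n X A\<^esub> homology_class p n X A c'"
      using homology_class_self [of c' p n X A] unfolding set_mult_def
      by simp (intro bexI [of _ "x - c'"] bexI [of _ c']; simp)
  qed
  then show ?thesis
    by (auto simp: rel_homology_mod_def)
qed

lemma the_elem_constant:
  assumes "a \<in> A" "\<And>x. x \<in> A \<Longrightarrow> f x = y"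
  shows "the_elem {f x |x. x \<in> A} = y"
proof -
  have "{f x |x. x \<in> A} = {y}"
    using assms by auto
  then show ?thesis
    by simp
qed

text \<open>Preserving boundaries is all that independence of the representative requires; this
  covers evaluation on the pair as well as the passage from (X, {}) to the pair of \<open>X\<close>
  and its base point.\<close>

lemma induced_homology_class:
  assumes "\<And>b. mod_relboundary p n X A b \<Longrightarrow> mod_relboundary p n Y B (chain_map (nat n) f b)"
  shows "induced p n Y B f (homology_class p n X A c) = homology_class p n Y B (chain_map (nat n) f c)"
  unfolding induced_def
proof (rule the_elem_constant [OF homology_class_self])
  fix c' assume "c' \<in> homology_class p n X A c"
  then have "mod_relboundary p n Y B (chain_map (nat n) f (c' - c))"
    by (intro assms) (simp add: homology_class_def)
  then show "homology_class p n Y B (chain_map (nat n) f c') = homology_class p n Y B (chain_map (nat n) f c)"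
    by (simp add: homology_class_eq_iff chain_map_diff)
qed

lemma mod_relboundary_chain_map:
  assumes f: "continuous_map X Y f" and fA: "f ` (topspace X \<inter> A) \<subseteq> B"
    and c: "mod_relboundary p n X A c"
  shows "mod_relboundary p n Y B (chain_map (nat n) f c)"
proof -
  obtain b a d where bad: "graded_chain (n + 1) X b" "graded_chain n (subtopology X A) a"
      "graded_chain n X d" "c = chain_boundary (nat (n + 1)) b + a + frag_cmul (int p) d"
    using c unfolding mod_relboundary_def by blast
  have fs: "continuous_map (subtopology X A) (subtopology Y B) f"
    using fA by (auto simp: continuous_map_in_subtopology continuous_map_from_subtopology [OF f])
  show ?thesis
  proof (rule mod_relboundaryI)
    show "chain_map (nat n) f c = chain_boundary (nat (n + 1)) (chain_map (nat (n + 1)) f b) +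
        chain_map (nat n) f a + frag_cmul (int p) (chain_map (nat n) f d)"
      using chain_boundary_graded_chain_map [OF bad(1), of f] bad(4) by (simp add: chain_map_add)
  qed (use bad f fs in \<open>auto intro: graded_chain_chain_map\<close>)
qed

text \<open>Two choices of representative and splitting give boundary parts that differ by a
  boundary in \<open>A\<close> plus p times a chain \<open>?e\<close>. A priori \<open>?e\<close>
  lives in \<open>X\<close> only.\<close>

lemma connecting_homology_class:
  assumes p: "p \<noteq> 0" and c: "graded_chain n X c" "graded_chain (n - 1) (subtopology X A) a"
    "graded_chain (n - 1) X d" "chain_boundary (nat n) c = a + frag_cmul (int p) d"
  shows "connecting p n X A (homology_class p n X A c) =
    homology_class p (n - 1) (subtopology X A) {} (frag_cmul ((-1) ^ nat n) a)"
proof -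
  let ?H = "homology_class p (n - 1) (subtopology X A) {}" and ?s = "(-1 :: int) ^ nat n"
  have "?H (frag_cmul ?s a') = ?H (frag_cmul ?s a)"
    if c': "c' \<in> homology_class p n X A c" and a': "graded_chain (n - 1) (subtopology X A) a'"
      "graded_chain (n - 1) X d'" "chain_boundary (nat n) c' = a' + frag_cmul (int p) d'" for a' c' d'
  proof -
    obtain b a0 d0 where bad: "graded_chain (n + 1) X b" "graded_chain n (subtopology X A) a0"
        "graded_chain n X d0" "c' - c = chain_boundary (nat (n + 1)) b + a0 + frag_cmul (int p) d0"
      using c' unfolding homology_class_def mod_relboundary_def by blast
    let ?e = "chain_boundary (nat n) d0 + d - d'"
    have "chain_boundary (nat n) c' - chain_boundary (nat n) c =
        chain_boundary (nat n) a0 + frag_cmul (int p) (chain_boundary (nat n) d0)"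
      using bad(4) graded_chain_boundary_boundary [OF bad(1)]
      by (simp add: chain_boundary_add chain_boundary_cmul flip: chain_boundary_diff)
    then have "(a' + frag_cmul (int p) d') - (a + frag_cmul (int p) d) =
        chain_boundary (nat n) a0 + frag_cmul (int p) (chain_boundary (nat n) d0)"
      unfolding a'(3) c(4) .
    then have eq: "a' - a = chain_boundary (nat n) a0 + frag_cmul (int p) ?e"
      by (simp add: frag_cmul_distrib2 frag_cmul_diff_right algebra_simps)
    then have "frag_cmul (int p) ?e = a' - a - chain_boundary (nat n) a0"
      by simp
    \<comment> \<open>All other terms of the equation lie in \<open>A\<close>, so p times
      \<open>?e\<close> does, and cancelling p moves \<open>?e\<close> itself into
      \<open>A\<close>.\<close>
    then have "graded_chain (n - 1) (subtopology X A) (frag_cmul (int p) ?e)"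
      using a' c bad by (simp add: graded_chain_diff graded_chain_boundary)
    then have "graded_chain (n - 1) (subtopology X A) ?e"
      by (rule graded_chain_cmul_cancel) (simp add: p)
    then have "mod_relboundary p (n - 1) (subtopology X A) {} (a' - a)"
      by (rule mod_relboundaryI [where b = a0 and a = 0, rotated 2]) (use bad(2) eq in simp_all)
    then have "mod_relboundary p (n - 1) (subtopology X A) {} (frag_cmul ?s a' - frag_cmul ?s a)"
      unfolding frag_cmul_diff_right [symmetric] by (rule mod_relboundary_cmul)
    then show ?thesis
      by (simp add: homology_class_eq_iff)
  qed
  note unique = this
  have "{?H (frag_cmul ?s a) |a c' d. c' \<in> homology_class p n X A c \<and>
      graded_chain (n - 1) (subtopology X A) a \<and> graded_chain (n - 1) X d \<and>
      chain_boundary (nat n) c' = a + frag_cmul (int p) d} = {?H (frag_cmul ?s a)}" (is "?S = _")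
  proof (intro equalityI subsetI)
    fix h assume "h \<in> ?S"
    then show "h \<in> {?H (frag_cmul ?s a)}"
      by (elim CollectE exE conjE) (simp add: unique)
  next
    fix h assume "h \<in> {?H (frag_cmul ?s a)}"
    then show "h \<in> ?S"
      using c homology_class_self [of c p n X A] by simp (intro exI conjI, auto)
  qed
  then show ?thesis
    by (simp add: connecting_def)
qed

section \<open>Cross products and pairings\<close>

text \<open>What shuffle simplices use to be continuous into \<open>k_prod\<close>. It holds for
  weakly Hausdorff spaces, for path spaces over them by means of evaluations, and passes to
  subspaces, hence to loop spaces.\<close>

definition Hausdorff_simplices :: "'a topology \<Rightarrow> bool" where
  "Hausdorff_simplices X \<longleftrightarrow>
     (\<forall>q f. singular_simplex q X f \<longrightarrow> Hausdorff_space (subtopology X (f ` standard_simplex q)))"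

abbreviation simplex_space :: "nat \<Rightarrow> (nat \<Rightarrow> real) topology" where
  "simplex_space q \<equiv> subtopology (powertop_real UNIV) (standard_simplex q)"

lemma compact_space_simplex: "compact_space (simplex_space q)"
  using compactin_standard_simplex by (rule compact_space_subtopology)

lemma Hausdorff_space_simplex: "Hausdorff_space (simplex_space q)"
  by (simp add: Hausdorff_space_product_topology Hausdorff_space_subtopology)

lemma topspace_simplex_space: "topspace (simplex_space q) = standard_simplex q"
  by simp

lemma weakly_Hausdorff_imp_Hausdorff_simplices:
  assumes "weakly_Hausdorff_space X"
  shows "Hausdorff_simplices X"
  unfolding Hausdorff_simplices_def singular_simplex_def
  using Hausdorff_compact_image [OF compact_space_simplex Hausdorff_space_simplex _ assms]
  by (metis topspace_simplex_space)

lemma Hausdorff_simplices_path_space: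
  assumes "weakly_Hausdorff_space X"
  shows "Hausdorff_simplices (path_space X x\<^sub>0)"
  unfolding Hausdorff_simplices_def singular_simplex_def
  using Hausdorff_path_space_image [OF assms compact_space_simplex Hausdorff_space_simplex]
  by (metis topspace_simplex_space)

lemma Hausdorff_simplices_subtopology:
  assumes "Hausdorff_simplices X"
  shows "Hausdorff_simplices (subtopology X A)"
  unfolding Hausdorff_simplices_def
proof (intro allI impI)
  fix q f assume "singular_simplex q (subtopology X A) f"
  then have f: "singular_simplex q X f" "f ` standard_simplex q \<subseteq> A"
    by (auto simp: singular_simplex_subtopology)
  then have "A \<inter> f ` standard_simplex q = f ` standard_simplex q"
    by auto
  then show "Hausdorff_space (subtopology (subtopology X A) (f ` standard_simplex q))"
    using assms f(1) by (simp add: subtopology_subtopology Hausdorff_simplices_def)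
qed

lemma shuffle_projection_simplex:
  assumes "\<mu> \<in> shuffles_of m n"
  shows "continuous_map (simplex_space (m + n)) (simplex_space m) (shuffle_projection (m + n) \<mu>)"
    and "continuous_map (simplex_space (m + n)) (simplex_space n)
      (shuffle_projection (m + n) ({..<m + n} - \<mu>))"
proof -
  have \<mu>: "\<mu> \<subseteq> {..<m + n}" "card \<mu> = m" "finite \<mu>"
    using assms by (auto simp: shuffles_of_def intro: finite_subset)
  then have "card ({..<m + n} - \<mu>) = n"
    by (simp add: card_Diff_subset)
  moreover have "card (({..<m + n} - \<mu>) \<inter> {..<i}) \<le> card ({..<m + n} - \<mu>)" for i
    by (intro card_mono) auto
  moreover have "card (\<mu> \<inter> {..<i}) \<le> card \<mu>" for i
    using \<mu> by (intro card_mono) auto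
  ultimately show "continuous_map (simplex_space (m + n)) (simplex_space m) (shuffle_projection (m + n) \<mu>)"
    "continuous_map (simplex_space (m + n)) (simplex_space n)
      (shuffle_projection (m + n) ({..<m + n} - \<mu>))"
    unfolding shuffle_projection_gather using \<mu>(2) by (auto intro!: continuous_map_gather)
qed

lemma singular_simplex_shuffle:
  assumes X: "Hausdorff_simplices X" and Y: "Hausdorff_simplices Y"
    and f: "singular_simplex m X f" and g: "singular_simplex n Y g" and \<mu>: "\<mu> \<in> shuffles_of m n"
  shows "singular_simplex (m + n) (k_prod X Y) (shuffle_simplex (m + n) \<mu> f g)"
proof -
  let ?S = "simplex_space (m + n)" and ?p = "shuffle_projection (m + n) \<mu>"
    and ?q = "shuffle_projection (m + n) ({..<m + n} - \<mu>)"
  have f': "continuous_map ?S X (f \<circ> ?p)" and g': "continuous_map ?S Y (g \<circ> ?q)"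
    using f g shuffle_projection_simplex [OF \<mu>]
    by (auto simp: singular_simplex_def intro: continuous_map_compose)
  have sub: "(f \<circ> ?p) ` standard_simplex (m + n) \<subseteq> f ` standard_simplex m"
    "(g \<circ> ?q) ` standard_simplex (m + n) \<subseteq> g ` standard_simplex n"
    using continuous_map_image_subset_topspace [OF shuffle_projection_simplex(1) [OF \<mu>]]
      continuous_map_image_subset_topspace [OF shuffle_projection_simplex(2) [OF \<mu>]]
    by (simp_all add: image_subset_iff)
  have H: "Hausdorff_space (subtopology Z B)" if "Hausdorff_space (subtopology Z A)" "B \<subseteq> A"
    for A B and Z :: "'z topology"
    using Hausdorff_space_subtopology [OF that(1), of B] that(2) by (simp add: subtopology_subtopology Int_absorb1)
  have "continuous_map ?S (k_prod X Y) (\<lambda>t. ((f \<circ> ?p) t, (g \<circ> ?q) t))"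
  proof (rule continuous_map_into_k_prod [OF compact_space_simplex f' _ g'])
    show "Hausdorff_space (subtopology X ((f \<circ> ?p) ` topspace ?S))"
      unfolding topspace_simplex_space using X f sub(1) by (auto simp: Hausdorff_simplices_def intro: H)
    show "Hausdorff_space (subtopology Y ((g \<circ> ?q) ` topspace ?S))"
      unfolding topspace_simplex_space using Y g sub(2) by (auto simp: Hausdorff_simplices_def intro: H)
  qed
  then have "continuous_map ?S (k_prod X Y) (shuffle_simplex (m + n) \<mu> f g)"
    by (rule continuous_map_eq) (simp add: shuffle_simplex_def)
  then show ?thesis
    by (simp add: singular_simplex_def shuffle_simplex_def)
qed

lemma singular_chain_cross_chain:
  assumes X: "Hausdorff_simplices X" and Y: "Hausdorff_simplices Y"
    and a: "singular_chain m X a" and b: "singular_chain n Y b"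
  shows "singular_chain (m + n) (k_prod X Y) (cross_chain m n a b)"
proof -
  have "singular_simplex m X f" if "f \<in> Poly_Mapping.keys a" for f
    using a that by (auto simp: singular_chain_def)
  moreover have "singular_simplex n Y g" if "g \<in> Poly_Mapping.keys b" for g
    using b that by (auto simp: singular_chain_def)
  ultimately show ?thesis
    unfolding cross_chain_def
    by (intro singular_chain_extend singular_chain_sum singular_chain_cmul)
      (simp add: singular_chain_of singular_simplex_shuffle [OF X Y])
qed

text \<open>In a negative degree \<open>nat\<close> is not additive, but then one of the chains is
  zero.\<close>

lemma graded_chain_cross_chain:
  assumes "Hausdorff_simplices X" "Hausdorff_simplices Y" "graded_chain m X a" "graded_chain n Y b"
  shows "graded_chain (m + n) (k_prod X Y) (cross_chain (nat m) (nat n) a b)"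
proof (cases "m < 0 \<or> n < 0")
  case True
  then have "a = 0 \<or> b = 0"
    using graded_chain_neg [OF assms(3)] graded_chain_neg [OF assms(4)] by blast
  then show ?thesis
    by (auto simp: cross_chain_left cross_chain_right)
next
  case False
  then show ?thesis
    using assms singular_chain_cross_chain [OF assms(1,2)] by (simp add: graded_chain_def nat_add_distrib)
qed

lemma chain_boundary_graded_cross_chain:
  assumes a: "graded_chain m X a" and b: "graded_chain n Y b"
  shows "chain_boundary (nat (m + n)) (cross_chain (nat m) (nat n) a b) =
    cross_chain (nat (m - 1)) (nat n) (chain_boundary (nat m) a) b +
    frag_cmul ((-1) ^ nat m) (cross_chain (nat m) (nat (n - 1)) a (chain_boundary (nat n) b))"
proof (cases "m < 0 \<or> n < 0")
  case True
  then have "a = 0 \<or> b = 0"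
    using graded_chain_neg [OF a] graded_chain_neg [OF b] by blast
  then show ?thesis
    by (auto simp: cross_chain_left cross_chain_right)
next
  case False
  then have "nat (m + n) = nat m + nat n" "nat (m - 1) = nat m - 1" "nat (n - 1) = nat n - 1"
    by (auto simp: nat_add_distrib)
  then show ?thesis
    using chain_boundary_cross_chain [of "nat m" "nat n" a b] by simp
qed

text \<open>A bilinear chain pairing of \<open>X\<close> with a pair (Y, B) into a pair (Z, D)
  obeying the Leibniz rule. It is instantiated with the cross product, with the action on
  \<open>X\<close> (absolute and relative to the base point), and with the action on the pair of
  paths and loops.\<close>

locale chain_pairing =
  fixes X :: "'a topology" and Y :: "'b topology" and B :: "'b set" and Z :: "'c topology" and D :: "'c set"
    and M :: "int \<Rightarrow> int \<Rightarrow> 'a chain \<Rightarrow> 'b chain \<Rightarrow> 'c chain"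
  assumes left: "M m n (a + a') b = M m n a b + M m n a' b" "M m n (frag_cmul k a) b = frag_cmul k (M m n a b)"
    and right: "M m n a (b + b') = M m n a b + M m n a b'" "M m n a (frag_cmul k b) = frag_cmul k (M m n a b)"
    and graded: "\<lbrakk>graded_chain m X a; graded_chain n Y b\<rbrakk> \<Longrightarrow> graded_chain (m + n) Z (M m n a b)"
    and graded_sub: "\<lbrakk>graded_chain m X a; graded_chain n (subtopology Y B) b\<rbrakk>
      \<Longrightarrow> graded_chain (m + n) (subtopology Z D) (M m n a b)"
    and boundary: "\<lbrakk>graded_chain m X a; graded_chain n Y b\<rbrakk> \<Longrightarrow>
      chain_boundary (nat (m + n)) (M m n a b) =
      M (m - 1) n (chain_boundary (nat m) a) b + frag_cmul ((-1) ^ nat m) (M m (n - 1) a (chain_boundary (nat n) b))"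
begin

text \<open>For a cycle modulo p the Leibniz term with the boundary of \<open>a\<close> is a
  multiple of p, so only the part from \<open>e\<close> remains. The formula gives the relative
  cycle property and, later, the boundary of the transgression witness.\<close>

lemma boundary_cycle:
  assumes a: "graded_chain m X a" "graded_chain (m - 1) X d" "chain_boundary (nat m) a = frag_cmul (int p) d"
    and b: "graded_chain n Y b" "chain_boundary (nat n) b = e + frag_cmul (int p) d'"
  shows "chain_boundary (nat (m + n)) (M m n a b) = frag_cmul ((-1) ^ nat m) (M m (n - 1) a e) +
    frag_cmul (int p) (M (m - 1) n d b + frag_cmul ((-1) ^ nat m) (M m (n - 1) a d'))"
  unfolding boundary [OF a(1) b(1)] a(3) b(2)
  by (simp add: left right frag_cmul_distrib2 mult.commute)

lemma graded_boundary_right: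
  assumes "graded_chain m X a" "graded_chain (n - 1) Y e"
  shows "graded_chain (m + n - 1) Z (M m (n - 1) a e)"
  using graded [OF assms] by (simp add: algebra_simps)

lemma graded_boundary_right_sub:
  assumes "graded_chain m X a" "graded_chain (n - 1) (subtopology Y B) e"
  shows "graded_chain (m + n - 1) (subtopology Z D) (M m (n - 1) a e)"
  using graded_sub [OF assms] by (simp add: algebra_simps)

lemma graded_boundary_left:
  assumes "graded_chain (m - 1) X a" "graded_chain n Y e"
  shows "graded_chain (m + n - 1) Z (M (m - 1) n a e)"
  using graded [OF assms] by (simp add: algebra_simps)

lemma mod_cycleE:
  assumes "mod_relcycle p m W {} a"
  obtains d where "graded_chain m W a" "graded_chain (m - 1) W d" "chain_boundary (nat m) a = frag_cmul (int p) d"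
  using assms unfolding mod_relcycle_def graded_chain_subtopology_empty by auto

lemma mod_relcycle_pairing:
  assumes a: "mod_relcycle p m X {} a" and b: "mod_relcycle p n Y B b"
  shows "mod_relcycle p (m + n) Z D (M m n a b)"
proof -
  obtain d where d: "graded_chain m X a" "graded_chain (m - 1) X d" "chain_boundary (nat m) a = frag_cmul (int p) d"
    using a by (rule mod_cycleE)
  obtain e d' where b': "graded_chain n Y b" "graded_chain (n - 1) (subtopology Y B) e" "graded_chain (n - 1) Y d'"
      "chain_boundary (nat n) b = e + frag_cmul (int p) d'"
    using b unfolding mod_relcycle_def by blast
  show ?thesis
    using boundary_cycle [OF d b'(1,4)] d b'
    by (intro mod_relcycleI) (auto intro!: graded_chain_lin graded graded_boundary_right
        graded_boundary_right_sub graded_boundary_left)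
qed

text \<open>The Leibniz rule for \<open>a\<close> times the bounding chain \<open>c\<close>,
  multiplied by its own sign, isolates \<open>a\<close> times the boundary of \<open>c\<close>; the
  other term is a multiple of p.\<close>

lemma mod_relboundary_pairing_right:
  assumes a: "mod_relcycle p m X {} a" and b: "mod_relboundary p n Y B b"
  shows "mod_relboundary p (m + n) Z D (M m n a b)"
proof -
  obtain d where d: "graded_chain m X a" "graded_chain (m - 1) X d" "chain_boundary (nat m) a = frag_cmul (int p) d"
    using a by (rule mod_cycleE)
  obtain c e d' where b': "graded_chain (n + 1) Y c" "graded_chain n (subtopology Y B) e" "graded_chain n Y d'"
      "b = chain_boundary (nat (n + 1)) c + e + frag_cmul (int p) d'"
    using b unfolding mod_relboundary_def by blast
  let ?s = "(-1 :: int) ^ nat m"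
  have s: "?s * ?s = 1"
    by (simp flip: power_add power2_eq_square power_mult)
  have "chain_boundary (nat (m + (n + 1))) (M m (n + 1) a c) = frag_cmul (int p) (M (m - 1) (n + 1) d c) +
      frag_cmul ?s (M m n a (chain_boundary (nat (n + 1)) c))"
    using boundary [OF d(1) b'(1)] by (simp add: d(3) left)
  then have "frag_cmul ?s (chain_boundary (nat (m + (n + 1))) (M m (n + 1) a c)) =
      frag_cmul (int p) (frag_cmul ?s (M (m - 1) (n + 1) d c)) + M m n a (chain_boundary (nat (n + 1)) c)"
    using s by (simp add: frag_cmul_distrib2 mult.commute)
  then have eq: "M m n a b = chain_boundary (nat (m + n + 1)) (frag_cmul ?s (M m (n + 1) a c)) + M m n a e +
      frag_cmul (int p) (M m n a d' - frag_cmul ?s (M (m - 1) (n + 1) d c))"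
    unfolding b'(4) by (simp add: right chain_boundary_cmul frag_cmul_diff_right add.assoc algebra_simps)
  have "graded_chain (m + n + 1) Z (M m (n + 1) a c)" "graded_chain (m + n) Z (M (m - 1) (n + 1) d c)"
    using graded [OF d(1) b'(1)] graded [OF d(2) b'(1)] by (simp_all add: algebra_simps)
  then show ?thesis
    using d b' by (intro mod_relboundaryI [OF _ _ _ eq]) (auto intro!: graded_chain_lin graded graded_sub)
qed

text \<open>The boundary of \<open>c\<close> times \<open>b\<close> produces \<open>a\<close> times
  \<open>b\<close> up to p, together with \<open>c\<close> times the boundary of \<open>b\<close>;
  since \<open>b\<close> is a relative cycle, the latter lies in \<open>D\<close> up to p.\<close>

lemma mod_relboundary_pairing_left:
  assumes a: "mod_relboundary p m X {} a" and b: "mod_relcycle p n Y B b"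
  shows "mod_relboundary p (m + n) Z D (M m n a b)"
proof -
  obtain c d where a': "graded_chain (m + 1) X c" "graded_chain m X d"
      "a = chain_boundary (nat (m + 1)) c + frag_cmul (int p) d"
    using a unfolding mod_relboundary_def graded_chain_subtopology_empty by auto
  obtain e d' where b': "graded_chain n Y b" "graded_chain (n - 1) (subtopology Y B) e" "graded_chain (n - 1) Y d'"
      "chain_boundary (nat n) b = e + frag_cmul (int p) d'"
    using b unfolding mod_relcycle_def by blast
  let ?s = "(-1 :: int) ^ nat (m + 1)"
  have "chain_boundary (nat (m + n + 1)) (M (m + 1) n c b) = M m n (chain_boundary (nat (m + 1)) c) b +
      frag_cmul ?s (M (m + 1) (n - 1) c e + frag_cmul (int p) (M (m + 1) (n - 1) c d'))"
    using boundary [OF a'(1) b'(1)] by (simp add: b'(4) right algebra_simps)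
  then have eq: "M m n a b = chain_boundary (nat (m + n + 1)) (M (m + 1) n c b) +
      frag_cmul (- ?s) (M (m + 1) (n - 1) c e) +
      frag_cmul (int p) (M m n d b - frag_cmul ?s (M (m + 1) (n - 1) c d'))"
    unfolding a'(3) by (simp add: left frag_cmul_distrib2 frag_cmul_diff_right mult.commute algebra_simps
        flip: minus_frag_cmul)
  have "graded_chain (m + n + 1) Z (M (m + 1) n c b)" "graded_chain (m + n) Z (M (m + 1) (n - 1) c d')"
      "graded_chain (m + n) (subtopology Z D) (M (m + 1) (n - 1) c e)"
    using graded [OF a'(1) b'(1)] graded [OF a'(1) b'(3)] graded_sub [OF a'(1) b'(2)]
    by (simp_all add: algebra_simps)
  then show ?thesis
    using a' b' by (intro mod_relboundaryI [OF _ _ _ eq]) (auto intro!: graded_chain_cmul graded_chain_diff graded)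
qed

end

lemma chain_pairing_cross:
  assumes "Hausdorff_simplices X" "Hausdorff_simplices Y"
  shows "chain_pairing X Y {} (k_prod X Y) {} (\<lambda>m n. cross_chain (nat m) (nat n))"
proof
  fix m n :: int and a :: "'a chain" and b :: "'b chain"
  assume "graded_chain n (subtopology Y {}) b"
  then have "b = 0"
    unfolding graded_chain_subtopology_empty .
  then show "graded_chain (m + n) (subtopology (k_prod X Y) {}) (cross_chain (nat m) (nat n) a b)"
    by (simp only: cross_chain_right graded_chain_0)
qed (simp_all add: cross_chain_left cross_chain_right graded_chain_cross_chain [OF assms]
    chain_boundary_graded_cross_chain)

definition pairing_chain :: "('a \<times> 'b \<Rightarrow> 'c) \<Rightarrow> int \<Rightarrow> int \<Rightarrow> 'a chain \<Rightarrow> 'b chain \<Rightarrow> 'c chain" where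
  "pairing_chain \<phi> m n a b = chain_map (nat (m + n)) \<phi> (cross_chain (nat m) (nat n) a b)"

lemma chain_pairing_pairing_chain:
  assumes X: "Hausdorff_simplices X" and Y: "Hausdorff_simplices Y"
    and \<phi>: "continuous_map (k_prod X Y) Z \<phi>"
    and \<phi>s: "continuous_map (k_prod X (subtopology Y B)) (subtopology Z D) \<phi>"
  shows "chain_pairing X Y B Z D (pairing_chain \<phi>)"
proof
  fix m n a b assume ab: "graded_chain m X a" "graded_chain n Y b"
  note c = graded_chain_cross_chain [OF X Y ab]
  show "graded_chain (m + n) Z (pairing_chain \<phi> m n a b)"
    unfolding pairing_chain_def using c \<phi> by (rule graded_chain_chain_map)
  have "m + n - 1 = (m - 1) + n" "m + n - 1 = m + (n - 1)"
    by simp_all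
  then show "chain_boundary (nat (m + n)) (pairing_chain \<phi> m n a b) =
      pairing_chain \<phi> (m - 1) n (chain_boundary (nat m) a) b +
      frag_cmul ((-1) ^ nat m) (pairing_chain \<phi> m (n - 1) a (chain_boundary (nat n) b))"
    unfolding pairing_chain_def chain_boundary_graded_chain_map [OF c]
      chain_boundary_graded_cross_chain [OF ab] chain_map_add chain_map_cmul by metis
next
  fix m n a b assume ab: "graded_chain m X a" "graded_chain n (subtopology Y B) b"
  show "graded_chain (m + n) (subtopology Z D) (pairing_chain \<phi> m n a b)"
    unfolding pairing_chain_def
    using graded_chain_cross_chain [OF X Hausdorff_simplices_subtopology [OF Y] ab] \<phi>s
    by (rule graded_chain_chain_map)
qed (simp_all add: pairing_chain_def cross_chain_left cross_chain_right chain_map_add)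

lemma cross_product_homology_class:
  assumes X: "Hausdorff_simplices X" and Y: "Hausdorff_simplices Y"
    and a: "mod_relcycle p m X {} a" and b: "mod_relcycle p n Y {} b"
  shows "cross_product p m n X Y (homology_class p m X {} a) (homology_class p n Y {} b) =
    homology_class p (m + n) (k_prod X Y) {} (cross_chain (nat m) (nat n) a b)"
proof -
  interpret chain_pairing X Y "{}" "k_prod X Y" "{}" "\<lambda>m n. cross_chain (nat m) (nat n)"
    using X Y by (rule chain_pairing_cross)
  let ?H = "homology_class p (m + n) (k_prod X Y) {}" and ?M = "cross_chain (nat m) (nat n)"
  have unique: "?H (?M a' b') = ?H (?M a b)"
    if a': "a' \<in> homology_class p m X {} a" and b': "b' \<in> homology_class p n Y {} b" for a' b'
  proof -
    \<comment> \<open>The two representatives are replaced one at a time; for the first replacement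
      \<open>b'\<close> must itself be a cycle.\<close>
    have "mod_relboundary p (m + n) (k_prod X Y) {} (?M (a' - a) b' + ?M a (b' - b))"
      using a a' b' mod_relcycle_homologous [OF b' b]
      by (intro mod_relboundary_add mod_relboundary_pairing_left mod_relboundary_pairing_right)
        (simp_all add: homology_class_def)
    then show ?thesis
      by (simp add: homology_class_eq_iff cross_chain_left cross_chain_right)
  qed
  have "{?H (?M a' b') |a' b'. a' \<in> homology_class p m X {} a \<and> b' \<in> homology_class p n Y {} b} = {?H (?M a b)}"
    (is "?S = _")
  proof (intro equalityI subsetI)
    fix h assume "h \<in> ?S"
    then show "h \<in> {?H (?M a b)}"
      by (elim CollectE exE conjE) (simp add: unique)
  next
    fix h assume "h \<in> {?H (?M a b)}"
    then show "h \<in> ?S"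
      using homology_class_self [of a p m X "{}"] homology_class_self [of b p n Y "{}"] by blast
  qed
  then show ?thesis
    by (simp add: cross_product_def)
qed

lemma circ_summand_homology_class:
  assumes X: "Hausdorff_simplices (BSym C k)" and Y: "Hausdorff_simplices Y"
    and \<phi>: "continuous_map (k_prod (BSym C k) Y) Y (diagonal_action \<theta> k)"
    and a: "mod_relcycle p m (BSym C k) {} a" and b: "mod_relcycle p n Y {} b"
  shows "circ_summand p C m n Y \<theta> k (homology_class p m (BSym C k) {} a) (homology_class p n Y {} b) =
    homology_class p (m + n) Y {} (pairing_chain (diagonal_action \<theta> k) m n a b)"
  unfolding circ_summand_def cross_product_homology_class [OF X Y a b] pairing_chain_def
  using mod_relboundary_chain_map [OF \<phi>, of "{}" "{}"] by (intro induced_homology_class) simp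

section \<open>Transgression\<close>

text \<open>The relative class in \<open>transgresses\<close> on the level of chains. Here
  \<open>e\<close> is the part of the boundary in the loop space before the sign of
  \<open>connecting\<close> is applied.\<close>

definition transgression_witness ::
    "nat \<Rightarrow> int \<Rightarrow> 'a topology \<Rightarrow> 'a \<Rightarrow> 'a chain \<Rightarrow> (real \<Rightarrow> 'a) chain \<Rightarrow> (real \<Rightarrow> 'a) chain \<Rightarrow> bool" where
  "transgression_witness p s X x\<^sub>0 \<xi> c e \<longleftrightarrow>
     mod_relcycle p s X {} \<xi> \<and> graded_chain s (path_space X x\<^sub>0) c \<and>
     graded_chain (s - 1) (loop_space X x\<^sub>0) e \<and>
     (\<exists>d. graded_chain (s - 1) (path_space X x\<^sub>0) d \<and> chain_boundary (nat s) c = e + frag_cmul (int p) d) \<and>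
     mod_relboundary p s X {x\<^sub>0} (chain_map (nat s) (\<lambda>\<alpha>. \<alpha> 1) c - \<xi>)"

lemma transgression_witness_add:
  assumes "transgression_witness p s X x\<^sub>0 \<xi> c e" "transgression_witness p s X x\<^sub>0 \<xi>' c' e'"
  shows "transgression_witness p s X x\<^sub>0 (\<xi> + \<xi>') (c + c') (e + e')"
proof -
  obtain d where d: "graded_chain (s - 1) (path_space X x\<^sub>0) d" "chain_boundary (nat s) c = e + frag_cmul (int p) d"
    using assms(1) unfolding transgression_witness_def by blast
  obtain d' where d': "graded_chain (s - 1) (path_space X x\<^sub>0) d'" "chain_boundary (nat s) c' = e' + frag_cmul (int p) d'"
    using assms(2) unfolding transgression_witness_def by blast
  have "mod_relboundary p s X {x\<^sub>0}
      ((chain_map (nat s) (\<lambda>\<alpha>. \<alpha> 1) c - \<xi>) + (chain_map (nat s) (\<lambda>\<alpha>. \<alpha> 1) c' - \<xi>'))"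
    using assms by (intro mod_relboundary_add) (simp_all add: transgression_witness_def)
  then have "mod_relboundary p s X {x\<^sub>0} (chain_map (nat s) (\<lambda>\<alpha>. \<alpha> 1) (c + c') - (\<xi> + \<xi>'))"
    by (simp add: chain_map_add algebra_simps)
  moreover have "chain_boundary (nat s) (c + c') = (e + e') + frag_cmul (int p) (d + d')"
    using d d' by (simp add: chain_boundary_add frag_cmul_distrib2)
  ultimately show ?thesis
    using assms graded_chain_add [OF d(1) d'(1)]
    unfolding transgression_witness_def by (auto intro: mod_relcycle_add graded_chain_add)
qed

lemma transgression_witness_0: "transgression_witness p s X x\<^sub>0 0 0 0"
  unfolding transgression_witness_def
  by (auto simp: mod_relcycle_0 mod_relboundary_0 intro: exI [of _ 0])

text \<open>Passing to representatives replaces \<open>the_elem\<close> by explicit formulas, so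
  that witnesses can be added and paired as chains.\<close>

lemma transgresses_iff:
  assumes p: "p \<noteq> 0"
  shows "transgresses p s X x\<^sub>0 x y \<longleftrightarrow>
    (\<exists>\<xi> c e. transgression_witness p s X x\<^sub>0 \<xi> c e \<and> x = homology_class p s X {} \<xi> \<and>
      y = homology_class p (s - 1) (loop_space X x\<^sub>0) {} (frag_cmul ((-1) ^ nat s) e))"
proof -
  let ?P = "path_space X x\<^sub>0" and ?W = "loops X x\<^sub>0" and ?L = "loop_space X x\<^sub>0"
  have ev: "continuous_map ?P X (\<lambda>\<alpha>. \<alpha> 1)"
    by (rule continuous_map_path_eval) simp
  have ev_class: "induced p s X {x\<^sub>0} (\<lambda>\<alpha>. \<alpha> 1) (homology_class p s ?P ?W c) =
      homology_class p s X {x\<^sub>0} (chain_map (nat s) (\<lambda>\<alpha>. \<alpha> 1) c)" for c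
    by (intro induced_homology_class mod_relboundary_chain_map [OF ev]) (auto simp: loops_def)
  have id_class: "induced p s X {x\<^sub>0} id (homology_class p s X {} \<xi>) = homology_class p s X {x\<^sub>0} \<xi>"
    if "graded_chain s X \<xi>" for \<xi>
  proof -
    have "chain_map (nat s) id \<xi> = \<xi>"
      using that by (auto simp: graded_chain_def chain_map_ident split: if_splits)
    moreover have "induced p s X {x\<^sub>0} id (homology_class p s X {} \<xi>) =
        homology_class p s X {x\<^sub>0} (chain_map (nat s) id \<xi>)"
      by (intro induced_homology_class mod_relboundary_chain_map [OF continuous_map_id]) auto
    ultimately show ?thesis
      by simp
  qed
  show ?thesis
  proof
    assume "transgresses p s X x\<^sub>0 x y"
    then obtain \<xi> c where \<xi>: "mod_relcycle p s X {} \<xi>" "x = homology_class p s X {} \<xi>"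
        and c: "mod_relcycle p s ?P ?W c"
        and ind: "induced p s X {x\<^sub>0} (\<lambda>\<alpha>. \<alpha> 1) (homology_class p s ?P ?W c) = induced p s X {x\<^sub>0} id x"
        and conn: "connecting p s ?P ?W (homology_class p s ?P ?W c) = y"
      unfolding transgresses_def carrier_rel_homology_mod by blast
    obtain e d where c': "graded_chain s ?P c" "graded_chain (s - 1) (subtopology ?P ?W) e"
        "graded_chain (s - 1) ?P d" "chain_boundary (nat s) c = e + frag_cmul (int p) d"
      using c unfolding mod_relcycle_def by blast
    have "mod_relboundary p s X {x\<^sub>0} (chain_map (nat s) (\<lambda>\<alpha>. \<alpha> 1) c - \<xi>)"
      using ind unfolding \<xi>(2) ev_class id_class [OF mod_relcycle_graded [OF \<xi>(1)]]
      by (simp add: homology_class_eq_iff)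
    moreover have "y = homology_class p (s - 1) ?L {} (frag_cmul ((-1) ^ nat s) e)"
      using connecting_homology_class [OF p c'] conn by (simp add: loop_space_def)
    ultimately show "\<exists>\<xi> c e. transgression_witness p s X x\<^sub>0 \<xi> c e \<and> x = homology_class p s X {} \<xi> \<and>
        y = homology_class p (s - 1) ?L {} (frag_cmul ((-1) ^ nat s) e)"
      using \<xi> c' unfolding transgression_witness_def loop_space_def by blast
  next
    assume "\<exists>\<xi> c e. transgression_witness p s X x\<^sub>0 \<xi> c e \<and> x = homology_class p s X {} \<xi> \<and>
        y = homology_class p (s - 1) ?L {} (frag_cmul ((-1) ^ nat s) e)"
    then obtain \<xi> c e d where \<xi>: "mod_relcycle p s X {} \<xi>" "x = homology_class p s X {} \<xi>"
        and c: "graded_chain s ?P c" "graded_chain (s - 1) (subtopology ?P ?W) e"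
        "graded_chain (s - 1) ?P d" "chain_boundary (nat s) c = e + frag_cmul (int p) d"
        and y: "y = homology_class p (s - 1) ?L {} (frag_cmul ((-1) ^ nat s) e)"
        and ind: "mod_relboundary p s X {x\<^sub>0} (chain_map (nat s) (\<lambda>\<alpha>. \<alpha> 1) c - \<xi>)"
      unfolding transgression_witness_def loop_space_def by blast
    \<comment> \<open>Vanishing of the double boundary makes the boundary of \<open>e\<close> a
      multiple of p in the path space; cancelling p there puts the cofactor into the loop space, so
      \<open>e\<close> is a cycle modulo p in it.\<close>
    have "chain_boundary (nat (s - 1)) (e + frag_cmul (int p) d) = 0"
      using graded_chain_boundary_boundary [OF c(1)] by (simp only: c(4))
    then have e: "chain_boundary (nat (s - 1)) e = frag_cmul (int p) (- chain_boundary (nat (s - 1)) d)"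
      unfolding chain_boundary_add chain_boundary_cmul frag_cmul_minus_right eq_neg_iff_add_eq_0 .
    have "graded_chain (s - 1 - 1) (subtopology ?P ?W) (frag_cmul (int p) (- chain_boundary (nat (s - 1)) d))"
      unfolding e [symmetric] by (rule graded_chain_boundary [OF c(2)])
    then have "graded_chain (s - 1 - 1) (subtopology ?P ?W) (- chain_boundary (nat (s - 1)) d)"
      by (rule graded_chain_cmul_cancel) (simp add: p)
    then have "mod_relcycle p (s - 1) ?L {} e"
      unfolding loop_space_def using c(2) e by (intro mod_relcycleI [where a = 0]) simp_all
    then have "y \<in> carrier (homology_mod p (s - 1) ?L)"
      unfolding y carrier_rel_homology_mod by (intro imageI) (simp add: mod_relcycle_cmul)
    moreover have "x \<in> carrier (homology_mod p s X)"
      unfolding \<xi>(2) carrier_rel_homology_mod using \<xi>(1) by simp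
    moreover have "homology_class p s ?P ?W c \<in> carrier (rel_homology_mod p s ?P ?W)"
      unfolding carrier_rel_homology_mod using mod_relcycleI [OF c] by simp
    moreover have "induced p s X {x\<^sub>0} (\<lambda>\<alpha>. \<alpha> 1) (homology_class p s ?P ?W c) = induced p s X {x\<^sub>0} id x"
      unfolding \<xi>(2) ev_class id_class [OF mod_relcycle_graded [OF \<xi>(1)]]
      using ind by (simp add: homology_class_eq_iff)
    moreover have "connecting p s ?P ?W (homology_class p s ?P ?W c) = y"
      unfolding y connecting_homology_class [OF p c] by (simp add: loop_space_def)
    ultimately show "transgresses p s X x\<^sub>0 x y"
      unfolding transgresses_def by blast
  qed
qed

lemma transgresses_mult:
  assumes p: "p \<noteq> 0" and x: "transgresses p s X x\<^sub>0 x y" and x': "transgresses p s X x\<^sub>0 x' y'"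
  shows "transgresses p s X x\<^sub>0 (x \<otimes>\<^bsub>homology_mod p s X\<^esub> x')
    (y \<otimes>\<^bsub>homology_mod p (s - 1) (loop_space X x\<^sub>0)\<^esub> y')"
proof -
  obtain \<xi> c e \<xi>' c' e' where
      w: "transgression_witness p s X x\<^sub>0 \<xi> c e" "transgression_witness p s X x\<^sub>0 \<xi>' c' e'"
      and "x = homology_class p s X {} \<xi>" "x' = homology_class p s X {} \<xi>'"
      and "y = homology_class p (s - 1) (loop_space X x\<^sub>0) {} (frag_cmul ((-1) ^ nat s) e)"
      and "y' = homology_class p (s - 1) (loop_space X x\<^sub>0) {} (frag_cmul ((-1) ^ nat s) e')"
    using x x' unfolding transgresses_iff [OF p] by blast
  then show ?thesis
    using transgression_witness_add [OF w]
    unfolding transgresses_iff [OF p] mult_rel_homology_mod frag_cmul_distrib2 [symmetric]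
    by (auto simp: mult_rel_homology_mod simp flip: frag_cmul_distrib2)
qed

lemma transgresses_one:
  assumes p: "p \<noteq> 0"
  shows "transgresses p s X x\<^sub>0 \<one>\<^bsub>homology_mod p s X\<^esub> \<one>\<^bsub>homology_mod p (s - 1) (loop_space X x\<^sub>0)\<^esub>"
  unfolding transgresses_iff [OF p] one_rel_homology_mod
  using transgression_witness_0 [of p s X x\<^sub>0] by (intro exI [of _ 0]) simp

text \<open>Transgression is an additive relation, and \<open>circ\<close> extends its summands
  linearly over the finite support of r.\<close>

lemma transgresses_finprod:
  assumes p: "p \<noteq> 0" and K: "finite K"
    and t: "\<And>k. k \<in> K \<Longrightarrow> transgresses p s X x\<^sub>0 (f k) (g k)"
  shows "transgresses p s X x\<^sub>0 (finprod (homology_mod p s X) f K)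
    (finprod (homology_mod p (s - 1) (loop_space X x\<^sub>0)) g K)"
proof -
  interpret H: comm_group "homology_mod p s X"
    by (rule comm_group_rel_homology_mod)
  interpret H': comm_group "homology_mod p (s - 1) (loop_space X x\<^sub>0)"
    by (rule comm_group_rel_homology_mod)
  show ?thesis
    using K t
  proof (induction K)
    case empty
    then show ?case
      using transgresses_one [OF p] by simp
  next
    case (insert k K)
    have "f \<in> K \<rightarrow> carrier (homology_mod p s X)" "f k \<in> carrier (homology_mod p s X)"
      "g \<in> K \<rightarrow> carrier (homology_mod p (s - 1) (loop_space X x\<^sub>0))"
      "g k \<in> carrier (homology_mod p (s - 1) (loop_space X x\<^sub>0))"
      using insert.prems by (auto simp: transgresses_def)
    then show ?case
      using insert by (simp add: transgresses_mult [OF p])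
  qed
qed

text \<open>A shuffle simplex treats its factors separately, so a map of the second factor may be
  applied before the product is formed. With evaluation at 1 as \<open>h\<close> and
  \<open>h'\<close> this says that acting on paths and evaluating commute on chains.\<close>

lemma pairing_chain_natural:
  assumes h: "\<And>x y. \<lbrakk>x \<in> topspace X; y \<in> topspace Y\<rbrakk> \<Longrightarrow> h (\<phi> (x, y)) = \<psi> (x, h' y)"
    and a: "graded_chain m X a" and b: "graded_chain n Y b"
  shows "chain_map (nat (m + n)) h (pairing_chain \<phi> m n a b) = pairing_chain \<psi> m n a (chain_map (nat n) h' b)"
proof (cases "m < 0 \<or> n < 0")
  case True
  then have "a = 0 \<or> b = 0"
    using graded_chain_neg [OF a] graded_chain_neg [OF b] by blast
  then show ?thesis
    by (auto simp: pairing_chain_def cross_chain_left cross_chain_right)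
next
  case False
  define i j where "i = nat m" and "j = nat n"
  have ij: "nat (m + n) = i + j"
    using False by (simp add: i_def j_def nat_add_distrib)
  have a': "Poly_Mapping.keys a \<subseteq> singular_simplex_set i X" and b': "Poly_Mapping.keys b \<subseteq> singular_simplex_set j Y"
    using a b False by (simp_all add: graded_chain_def singular_chain_def i_def j_def)
  let ?L = "\<lambda>a b. chain_map (i + j) h (chain_map (i + j) \<phi> (cross_chain i j a b))"
  let ?R = "\<lambda>a b. chain_map (i + j) \<psi> (cross_chain i j a (chain_map j h' b))"
  have "?L a b = ?R a b"
    using a'
  proof (induction rule: frag_induction)
    case (one f)
    then have f: "singular_simplex i X f"
      by simp
    show ?case
      using b'
    proof (induction rule: frag_induction)
      case (one g)
      then have g: "singular_simplex j Y g"
        by simp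
      have "simplex_map (i + j) h (simplex_map (i + j) \<phi> (shuffle_simplex (i + j) \<mu> f g)) =
          simplex_map (i + j) \<psi> (shuffle_simplex (i + j) \<mu> f (simplex_map j h' g))"
        if \<mu>: "\<mu> \<in> shuffles_of i j" for \<mu>
        unfolding simplex_map_def
      proof (rule restrict_ext)
        fix t assume t: "t \<in> standard_simplex (i + j)"
        let ?p = "shuffle_projection (i + j) \<mu> t" and ?q = "shuffle_projection (i + j) ({..<i + j} - \<mu>) t"
        \<comment> \<open>\<open>simplex_map\<close> is restricted to the standard simplex, so
          \<open>h'\<close> can be pulled out only where the projections land in it.\<close>
        have pq: "?p \<in> standard_simplex i" "?q \<in> standard_simplex j"
          using funcset_mem [OF continuous_map_funspace [OF shuffle_projection_simplex(1) [OF \<mu>]]]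
            funcset_mem [OF continuous_map_funspace [OF shuffle_projection_simplex(2) [OF \<mu>]]] t
          by simp_all
        then have "f ?p \<in> topspace X" "g ?q \<in> topspace Y"
          using f g by (auto simp: singular_simplex_def dest!: continuous_map_funspace)
        then show "(h \<circ> restrict (\<phi> \<circ> shuffle_simplex (i + j) \<mu> f g) (standard_simplex (i + j))) t =
            (\<psi> \<circ> shuffle_simplex (i + j) \<mu> f (restrict (h' \<circ> g) (standard_simplex j))) t"
          using t pq h by (simp add: shuffle_simplex_def)
      qed
      then show ?case
        by (simp add: cross_chain_def chain_map_sum finite_shuffles_of)
    qed (simp_all add: cross_chain_right chain_map_diff)
  qed (simp_all add: cross_chain_left chain_map_diff)
  then show ?thesis
    by (simp add: pairing_chain_def ij flip: i_def j_def)
qed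

section \<open>Transgression and the pairing\<close>

context algebra_over_operad
begin

text \<open>The factor (-1)^m is the Leibniz sign of moving the boundary past \<open>a\<close>. The
  comparison with \<open>\<xi>\<close> is a boundary relative to the base point, and the pairing
  preserves it because the action fixes that point.\<close>

lemma transgression_witness_pairing:
  assumes a: "mod_relcycle p m (BSym C k) {} a" and w: "transgression_witness p s X pt \<xi> c e"
  shows "transgression_witness p (m + s) X pt
    (pairing_chain (diagonal_action \<theta> k) m s a \<xi>)
    (pairing_chain (diagonal_action (pointwise_action \<theta>) k) m s a c)
    (frag_cmul ((-1) ^ nat m) (pairing_chain (diagonal_action (pointwise_action \<theta>) k) m (s - 1) a e))"
proof -
  let ?B = "BSym C k" and ?P = "path_space X pt" and ?W = "loops X pt"
  let ?\<phi> = "diagonal_action \<theta> k" and ?\<psi> = "diagonal_action (pointwise_action \<theta>) k"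
  have B: "Hausdorff_simplices ?B" and X: "Hausdorff_simplices X"
    using weakly_Hausdorff_imp_Hausdorff_simplices weakly_Hausdorff_BSym weakly_Hausdorff_X by auto
  have P: "Hausdorff_simplices ?P"
    using weakly_Hausdorff_X by (rule Hausdorff_simplices_path_space)
  have "continuous_map (k_prod ?B (subtopology X {pt})) (subtopology X {pt}) ?\<phi>"
  proof (rule continuous_map_eq)
    show "continuous_map (k_prod ?B (subtopology X {pt})) (subtopology X {pt}) (\<lambda>_. pt)"
      by (simp add: continuous_map_const pt_in_topspace)
    show "pt = ?\<phi> z" if "z \<in> topspace (k_prod ?B (subtopology X {pt}))" for z
      using that diagonal_action_pt by auto
  qed
  then interpret M: chain_pairing ?B X "{pt}" X "{pt}" "pairing_chain ?\<phi>"
    by (rule chain_pairing_pairing_chain [OF B X continuous_map_diagonal_action_k_prod])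
  \<comment> \<open>The instance relative to the base point yields only a relative cycle; the
    witness asks for an absolute one.\<close>
  have "continuous_map (k_prod ?B (subtopology X {})) (subtopology X {}) ?\<phi>"
    by (simp add: continuous_map_def)
  then have triv: "chain_pairing ?B X {} X {} (pairing_chain ?\<phi>)"
    by (rule chain_pairing_pairing_chain [OF B X continuous_map_diagonal_action_k_prod])
  interpret N: chain_pairing ?B ?P ?W ?P ?W "pairing_chain ?\<psi>"
    by (rule chain_pairing_pairing_chain [OF B P continuous_map_diagonal_action_k_prod_paths
          continuous_map_diagonal_action_k_prod_loops [unfolded loop_space_def]])
  obtain d where d: "graded_chain m ?B a" "graded_chain (m - 1) ?B d" "chain_boundary (nat m) a = frag_cmul (int p) d"
    using a by (rule M.mod_cycleE)
  obtain d' where \<xi>: "mod_relcycle p s X {} \<xi>" and c: "graded_chain s ?P c"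
      "graded_chain (s - 1) (subtopology ?P ?W) e" "graded_chain (s - 1) ?P d'"
      "chain_boundary (nat s) c = e + frag_cmul (int p) d'"
      and ev: "mod_relboundary p s X {pt} (chain_map (nat s) (\<lambda>\<alpha>. \<alpha> 1) c - \<xi>)"
    using w unfolding transgression_witness_def loop_space_def by blast
  have "mod_relboundary p (m + s) X {pt}
      (pairing_chain ?\<phi> m s a (chain_map (nat s) (\<lambda>\<alpha>. \<alpha> 1) c - \<xi>))"
    using a ev by (rule M.mod_relboundary_pairing_right)
  moreover have "chain_map (nat (m + s)) (\<lambda>\<alpha>. \<alpha> 1) (pairing_chain ?\<psi> m s a c) =
      pairing_chain ?\<phi> m s a (chain_map (nat s) (\<lambda>\<alpha>. \<alpha> 1) c)"
    by (rule pairing_chain_natural [OF _ d(1) c(1)]) (simp add: diagonal_action_pointwise)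
  ultimately have "mod_relboundary p (m + s) X {pt}
      (chain_map (nat (m + s)) (\<lambda>\<alpha>. \<alpha> 1) (pairing_chain ?\<psi> m s a c) - pairing_chain ?\<phi> m s a \<xi>)"
    by (simp add: pairing_chain_def cross_chain_right chain_map_diff)
  moreover have "mod_relcycle p (m + s) X {} (pairing_chain ?\<phi> m s a \<xi>)"
    using triv a \<xi> by (rule chain_pairing.mod_relcycle_pairing)
  moreover have "graded_chain (m + s) ?P (pairing_chain ?\<psi> m s a c)"
    using d(1) c(1) by (rule N.graded)
  moreover have "graded_chain (m + s - 1) (loop_space X pt)
      (frag_cmul ((-1) ^ nat m) (pairing_chain ?\<psi> m (s - 1) a e))"
    unfolding loop_space_def by (intro graded_chain_cmul N.graded_boundary_right_sub d c)
  moreover have "graded_chain (m + s - 1) ?P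
      (pairing_chain ?\<psi> (m - 1) s d c + frag_cmul ((-1) ^ nat m) (pairing_chain ?\<psi> m (s - 1) a d'))"
    by (intro graded_chain_add graded_chain_cmul N.graded_boundary_right N.graded_boundary_left d c)
  ultimately show ?thesis
    unfolding transgression_witness_def using N.boundary_cycle [OF d c(1,4)] by blast
qed

text \<open>The new witness carries the Leibniz sign (-1)^m and \<open>connecting\<close> adds
  (-1)^(m+s); together they leave (-1)^s, which is the sign already contained in
  \<open>y\<close>.\<close>

lemma transgresses_circ_summand:
  assumes p: "p \<noteq> 0" and r: "r \<in> carrier (homology_mod p m (BSym C k))"
    and x: "transgresses p s X pt x y"
  shows "transgresses p (m + s) X pt (circ_summand p C m s X \<theta> k r x)
    (circ_summand p C m (s - 1) (loop_space X pt) (pointwise_action \<theta>) k r y)"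
proof -
  let ?B = "BSym C k" and ?L = "loop_space X pt"
  let ?\<phi> = "diagonal_action \<theta> k" and ?\<psi> = "diagonal_action (pointwise_action \<theta>) k"
  have B: "Hausdorff_simplices ?B" and X: "Hausdorff_simplices X"
    using weakly_Hausdorff_imp_Hausdorff_simplices weakly_Hausdorff_BSym weakly_Hausdorff_X by auto
  have L: "Hausdorff_simplices ?L"
    unfolding loop_space_def
    by (intro Hausdorff_simplices_subtopology Hausdorff_simplices_path_space weakly_Hausdorff_X)
  obtain a where a: "mod_relcycle p m ?B {} a" "r = homology_class p m ?B {} a"
    using r unfolding carrier_rel_homology_mod by blast
  obtain \<xi> c e where w: "transgression_witness p s X pt \<xi> c e" and x': "x = homology_class p s X {} \<xi>"
      and y: "y = homology_class p (s - 1) ?L {} (frag_cmul ((-1) ^ nat s) e)"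
    using x unfolding transgresses_iff [OF p] by blast
  have \<xi>: "mod_relcycle p s X {} \<xi>" and e: "graded_chain (s - 1) ?L e"
    using w by (simp_all add: transgression_witness_def)
  \<comment> \<open>The witness records \<open>e\<close> only as a chain. Its signed version is a
    cycle because it belongs to the homology class \<open>y\<close>, all of whose members are
    cycles.\<close>
  have "y \<in> carrier (homology_mod p (s - 1) ?L)"
    using x by (simp add: transgresses_def)
  then obtain e' where "mod_relcycle p (s - 1) ?L {} e'" "y = homology_class p (s - 1) ?L {} e'"
    unfolding carrier_rel_homology_mod by blast
  then have e_cycle: "mod_relcycle p (s - 1) ?L {} (frag_cmul ((-1) ^ nat s) e)"
    using mod_relcycle_homologous [of "frag_cmul ((-1) ^ nat s) e" p "s - 1" ?L "{}" e'] y
    by (metis homology_class_self)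
  have "circ_summand p C m s X \<theta> k r x = homology_class p (m + s) X {} (pairing_chain ?\<phi> m s a \<xi>)"
    unfolding a(2) x' by (rule circ_summand_homology_class [OF B X continuous_map_diagonal_action_k_prod a(1) \<xi>])
  moreover have "circ_summand p C m (s - 1) ?L (pointwise_action \<theta>) k r y =
      homology_class p (m + s - 1) ?L {} (frag_cmul ((-1) ^ nat (m + s))
        (frag_cmul ((-1) ^ nat m) (pairing_chain ?\<psi> m (s - 1) a e)))"
  proof -
    have "frag_cmul ((-1) ^ nat (m + s)) (frag_cmul ((-1) ^ nat m) (pairing_chain ?\<psi> m (s - 1) a e)) =
        pairing_chain ?\<psi> m (s - 1) a (frag_cmul ((-1) ^ nat s) e)"
    \<comment> \<open>The sign identity uses additivity of \<open>nat\<close>. In a negative degree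
      a factor vanishes instead: \<open>s < 0\<close> forces \<open>e = 0\<close>, as
      \<open>e\<close> has degree \<open>s - 1\<close>.\<close>
    proof (cases "m < 0 \<or> s < 0")
      case True
      then have "a = 0 \<or> e = 0"
        using graded_chain_neg [OF mod_relcycle_graded [OF a(1)]] graded_chain_neg [OF e] by auto
      then show ?thesis
        by (auto simp: pairing_chain_def cross_chain_left cross_chain_right)
    next
      case False
      then have "(-1 :: int) ^ nat (m + s) * (-1) ^ nat m = (-1) ^ nat s"
        by (simp add: nat_add_distrib power_add)
      then show ?thesis
        by (simp add: pairing_chain_def cross_chain_right)
    qed
    moreover have "m + (s - 1) = m + s - 1"
      by simp
    ultimately show ?thesis
      using circ_summand_homology_class [OF B L continuous_map_diagonal_action_k_prod_loops a(1) e_cycle]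
      unfolding a(2) y by metis
  qed
  ultimately show ?thesis
    unfolding transgresses_iff [OF p] using transgression_witness_pairing [OF a(1) w] by blast
qed

end

theorem theorem70:
  fixes p :: nat and C :: "'c operad" and X :: "'a topology"
    and \<theta> :: "nat \<Rightarrow> 'c \<Rightarrow> (nat \<Rightarrow> 'a) \<Rightarrow> 'a"
    and m s :: int
  assumes "prime p"
    and "E_infinity_operad TYPE('z) C"
    and "operad_algebra C X \<theta>"
    and "simply_connected_space X"
    and "x\<^sub>0 = algebra_point C \<theta>"
    and "transgresses p s X x\<^sub>0 x y"
    and "r \<in> carrier (homology_Sym_sum p C m)"
  shows "transgresses p (m + s) X x\<^sub>0
           (circ p C m s X \<theta> r x)
           (circ p C m (s - 1) (loop_space X x\<^sub>0) (pointwise_action \<theta>) r y)"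
proof -
  interpret algebra_over_operad C X \<theta>
    using assms(2,3) by unfold_locales (simp_all add: E_infinity_operad_def)
  have p: "p \<noteq> 0"
    using assms(1) by (metis not_prime_0)
  let ?K = "{k. r k \<noteq> \<one>\<^bsub>homology_mod p m (BSym C k)\<^esub>}"
  have "group (homology_mod p m (BSym C k))" for k
    using comm_group_rel_homology_mod by (rule comm_group.axioms(2))
  then have r: "finite ?K" "r k \<in> carrier (homology_mod p m (BSym C k))" for k
    using assms(7) by (auto simp: carrier_sum_group)
  have "transgresses p (m + s) X x\<^sub>0
      (finprod (homology_mod p (m + s) X) (\<lambda>k. circ_summand p C m s X \<theta> k (r k) x) ?K)
      (finprod (homology_mod p (m + s - 1) (loop_space X x\<^sub>0))
        (\<lambda>k. circ_summand p C m (s - 1) (loop_space X x\<^sub>0) (pointwise_action \<theta>) k (r k) y) ?K)"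
    using assms(5,6) r by (intro transgresses_finprod p) (auto intro: transgresses_circ_summand [OF p])
  \<comment> \<open>The pairing on loops is formed in degree \<open>m + (s - 1)\<close>, while
    transgression from degree \<open>m + s\<close> asks for \<open>m + s - 1\<close>.\<close>
  moreover have "m + (s - 1) = m + s - 1"
    by simp
  ultimately show ?thesis
    unfolding circ_def by (simp only:)
qed

end
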